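(* Let $\mathcal{F}$ be a finite signature, $E$ a fixed finite set of permutation equations over $\mathcal{F}$, $\mathcal{F}_E$ the set of function symbols occurring in $E$, and $B$ a set of $B$-rules (possibly empty) for an interpreted symbol $g\in\mathcal{F}$. Given, for each $f\in\mathcal{F}_E$, the table $Table(Eq(f))$, a congruence closure modulo $E\cup B$ for a finite set $P$ of ground equations over $\mathcal{T}(\mathcal{F})$ can be computed in $O(n^3)$ time, where $n$ is the total number of symbols in the left- and right-hand sides of the equations of $P$.
   Context: A permutation equation is an equation $f(x_1,\dots,x_n)\approx f(x_{\rho(1)},\dots,x_{\rho(n)})$ with $\rho$ a permutation of $\{1,\dots,n\}$; $\approx_E$ is the equational theory generated by $E$. For $f\in\mathcal{F}_E$, $Eq(f)$ is the set of equations of $E$ with top symbol $f$, and $Table(Eq(f))$ is the data structure of Avenhaus et al. (constructible in polynomial time for fixed $E$, of size bounded by a constant independent of input terms) with which, after checking equality of argument multisets, $E$-equality of two flat terms headed by $f$ is decided in constant time; consequently $E$-equality of two flat terms $s,t$ can be decided in $O(|s|+|t|)$ time. $B$-rules for a binary interpreted symbol $g\in\mathcal{F}$ are one of: $\{g(x,x)\to x\}$, $\{g(x,x)\to 0\}$, $\{g(x,0)\to x,g(0,x)\to x\}$, the union of the first and third, or the union of the second and third ($0$ a constant); if $g\in\mathcal{F}_E$ then $g(x_1,x_2)\approx g(x_2,x_1)\in E$. Rewriting modulo $E$: $s\to_{R,E}t$ if there is a non-variable position $p$ of $s$, $l\to r\in R$ and $\sigma$ with $s|_p\approx_E l\sigma$,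 $t=s[r\sigma]_p$; $s\to_{R/E}t$ if $s\approx_E u\to_R v\approx_E t$. $R,E$ is convergent modulo $E$ if $R/E$ is well-founded and $s\xleftrightarrow{*}_{R\cup E}t$ implies $s\xrightarrow{*}_{R,E}u\xleftrightarrow{*}_E v\xleftarrow{*}_{R,E}t$ for some $u,v$. Let $K$ be a finite set of constants disjoint from $\mathcal{F}$. A $D$-rule is $f(c_1,\dots,c_n)\to c$ with $f\in\mathcal{F}$ of arity $n\ge0$, $c_i,c\in K$; a $C$-rule is $c\to d$ with $c,d\in K$. A ground rewrite system $R=D\cup C$ ($D$ a set of $D$-rules, $C$ a set of $C$-rules) is a congruence closure modulo $E\cup B$ for $P$ if: every $c\in K$ satisfies $t\xleftrightarrow{*}_{R,E}c$ for some $t\in\mathcal{T}(\mathcal{F})$; $R\cup B,E$ is convergent modulo $E$ over $\mathcal{T}(\mathcal{F}\cup K,\mathcal{X})$; and for all $s,t\in\mathcal{T}(\mathcal{F})$, $s\xleftrightarrow{*}_{P\cup B\cup E}t$ iff there are $u,v\in\mathcal{T}(\mathcal{F}\cup K)$ with $s\xrightarrow{*}_{R\cup B,E}u\xleftrightarrow{*}_E v\xleftarrow{*}_{R\cup B,E}t$.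
   Formalization: When B contains the unit rules g(x,0)→x, g(0,x)→x, the constant 0 of F may also belong to K; otherwise K is disjoint from F. With literal disjointness the claim fails, e.g. for the unit rules alone, E empty and P = {b≈0}. *)

theory Defs
  imports
    "HOL-Library.Landau_Symbols"
    "HOL-Combinatorics.Permutations"
begin

section \<open>Terms and rewriting modulo a theory\<close>

text \<open>Function symbols, the additional constants and variables are named by natural numbers, so
  that a term can be written into the memory of the machine below. A signature is a
  set \<open>F\<close> of symbols together with an arity function \<open>ar\<close>.\<close>

datatype trm = Var nat | Fun nat "trm list"

type_synonym eqn = "trm \<times> trm"

abbreviation Cst :: "nat \<Rightarrow> trm" where
  "Cst c \<equiv> Fun c []"

text \<open>\<open>terms ar F K\<close> is \<open>T(F \<union> K, X)\<close>, and \<open>gterms ar F K\<close> is \<open>T(F \<union> K)\<close>; the elements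
  of \<open>K\<close> are constants, regardless of \<open>ar\<close>.\<close>

inductive_set terms :: "(nat \<Rightarrow> nat) \<Rightarrow> nat set \<Rightarrow> nat set \<Rightarrow> trm set"
  for ar :: "nat \<Rightarrow> nat" and F K :: "nat set" where
  "Var x \<in> terms ar F K"
| "c \<in> K \<Longrightarrow> Cst c \<in> terms ar F K"
| "f \<in> F \<Longrightarrow> length ts = ar f \<Longrightarrow> (\<And>t. t \<in> set ts \<Longrightarrow> t \<in> terms ar F K) \<Longrightarrow>
    Fun f ts \<in> terms ar F K"

fun vars :: "trm \<Rightarrow> nat set" where
  "vars (Var x) = {x}"
| "vars (Fun f ts) = (\<Union>t\<in>set ts. vars t)"

fun syms :: "trm \<Rightarrow> nat set" where
  "syms (Var x) = {}"
| "syms (Fun f ts) = insert f (\<Union>t\<in>set ts. syms t)"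

definition gterms :: "(nat \<Rightarrow> nat) \<Rightarrow> nat set \<Rightarrow> nat set \<Rightarrow> trm set" where
  "gterms ar F K = {t \<in> terms ar F K. vars t = {}}"

fun nsyms :: "trm \<Rightarrow> nat" where
  "nsyms (Var x) = 1"
| "nsyms (Fun f ts) = 1 + (\<Sum>t\<leftarrow>ts. nsyms t)"

fun subst :: "trm \<Rightarrow> (nat \<Rightarrow> trm) \<Rightarrow> trm" where
  "subst (Var x) \<sigma> = \<sigma> x"
| "subst (Fun f ts) \<sigma> = Fun f (map (\<lambda>t. subst t \<sigma>) ts)"

fun poss :: "trm \<Rightarrow> nat list set" where
  "poss (Var x) = {[]}"
| "poss (Fun f ts) = insert [] {i # p | i p. i < length ts \<and> p \<in> map poss ts ! i}"

fun subt_at :: "trm \<Rightarrow> nat list \<Rightarrow> trm" where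
  "subt_at t [] = t"
| "subt_at (Fun f ts) (i # p) = subt_at (ts ! i) p"
| "subt_at (Var x) (i # p) = Var x"

fun replace_at :: "trm \<Rightarrow> nat list \<Rightarrow> trm \<Rightarrow> trm" where
  "replace_at t [] u = u"
| "replace_at (Fun f ts) (i # p) u = Fun f (ts[i := replace_at (ts ! i) p u])"
| "replace_at (Var x) (i # p) u = Var x"

text \<open>All relations below are relations on a given set \<open>T\<close> of terms, such as
  \<open>terms ar F K\<close>.\<close>

definition rstep :: "trm set \<Rightarrow> eqn set \<Rightarrow> trm rel" where
  "rstep T R = {(s, t). s \<in> T \<and> t \<in> T \<and>
     (\<exists>p l r \<sigma>. p \<in> poss s \<and> (l, r) \<in> R \<and> subt_at s p = subst l \<sigma> \<and>
        t = replace_at s p (subst r \<sigma>))}"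

definition conversion :: "trm rel \<Rightarrow> trm rel" where
  "conversion r = (r \<union> r\<inverse>)\<^sup>*"

definition eqth :: "trm set \<Rightarrow> eqn set \<Rightarrow> trm rel" where
  "eqth T E = conversion (rstep T E)"

text \<open>\<open>rstep_mod T R E\<close> is the relation \<open>\<rightarrow>\<close> with index \<open>R,E\<close>, which matches modulo \<open>E\<close>;
  \<open>rstep_class T R E\<close> is the relation with index \<open>R/E\<close>.\<close>

definition rstep_mod :: "trm set \<Rightarrow> eqn set \<Rightarrow> eqn set \<Rightarrow> trm rel" where
  "rstep_mod T R E = {(s, t). s \<in> T \<and> t \<in> T \<and>
     (\<exists>p l r \<sigma>. p \<in> poss s \<and> (\<nexists>x. subt_at s p = Var x) \<and> (l, r) \<in> R \<and>
        (subt_at s p, subst l \<sigma>) \<in> eqth T E \<and> t = replace_at s p (subst r \<sigma>))}"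

definition rstep_class :: "trm set \<Rightarrow> eqn set \<Rightarrow> eqn set \<Rightarrow> trm rel" where
  "rstep_class T R E = eqth T E O rstep T R O eqth T E"

definition convergent_mod :: "trm set \<Rightarrow> eqn set \<Rightarrow> eqn set \<Rightarrow> bool" where
  "convergent_mod T R E \<longleftrightarrow>
     wf ((rstep_class T R E)\<inverse>) \<and>
     (\<forall>s\<in>T. \<forall>t\<in>T. (s, t) \<in> eqth T (R \<union> E) \<longrightarrow>
        (\<exists>u v. (s, u) \<in> (rstep_mod T R E)\<^sup>* \<and> (u, v) \<in> eqth T E \<and>
               (t, v) \<in> (rstep_mod T R E)\<^sup>*))"

section \<open>Permutation equations and rules for the interpreted symbol\<close>

definition perm_eqn :: "(nat \<Rightarrow> nat) \<Rightarrow> nat \<Rightarrow> (nat \<Rightarrow> nat) \<Rightarrow> eqn" where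
  "perm_eqn ar f \<rho> =
     (Fun f (map Var [1..<Suc (ar f)]), Fun f (map (\<lambda>i. Var (\<rho> i)) [1..<Suc (ar f)]))"

definition is_perm_eqn :: "(nat \<Rightarrow> nat) \<Rightarrow> nat set \<Rightarrow> eqn \<Rightarrow> bool" where
  "is_perm_eqn ar F e \<longleftrightarrow> (\<exists>f\<in>F. \<exists>\<rho>. \<rho> permutes {1..ar f} \<and> e = perm_eqn ar f \<rho>)"

definition eqn_syms :: "eqn set \<Rightarrow> nat set" where
  "eqn_syms E = (\<Union>(l, r)\<in>E. syms l \<union> syms r)"

text \<open>In the following rules \<open>z\<close> is the constant \<open>0\<close>.\<close>

definition idem_rules :: "nat \<Rightarrow> eqn set" where
  "idem_rules g = {(Fun g [Var 1, Var 1], Var 1)}"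

definition nilp_rules :: "nat \<Rightarrow> nat \<Rightarrow> eqn set" where
  "nilp_rules g z = {(Fun g [Var 1, Var 1], Cst z)}"

definition unit_rules :: "nat \<Rightarrow> nat \<Rightarrow> eqn set" where
  "unit_rules g z = {(Fun g [Var 1, Cst z], Var 1), (Fun g [Cst z, Var 1], Var 1)}"

definition is_B_rules ::
  "(nat \<Rightarrow> nat) \<Rightarrow> nat set \<Rightarrow> eqn set \<Rightarrow> nat \<Rightarrow> nat \<Rightarrow> eqn set \<Rightarrow> bool" where
  "is_B_rules ar F E g z B \<longleftrightarrow>
     g \<in> F \<and> ar g = 2 \<and>
     B \<in> {idem_rules g, nilp_rules g z, unit_rules g z,
          idem_rules g \<union> unit_rules g z, nilp_rules g z \<union> unit_rules g z} \<and>
     (B \<noteq> idem_rules g \<longrightarrow> z \<in> F \<and> ar z = 0) \<and>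
     (g \<in> eqn_syms E \<longrightarrow> (Fun g [Var 1, Var 2], Fun g [Var 2, Var 1]) \<in> E)"

section \<open>Congruence closure modulo permutation equations and interpreted rules\<close>

definition D_rules :: "(nat \<Rightarrow> nat) \<Rightarrow> nat set \<Rightarrow> nat set \<Rightarrow> eqn set" where
  "D_rules ar F K = {(Fun f (map Cst cs), Cst c) | f cs c.
     f \<in> F \<and> length cs = ar f \<and> set cs \<subseteq> K \<and> c \<in> K}"

definition C_rules :: "nat set \<Rightarrow> eqn set" where
  "C_rules K = {(Cst c, Cst d) | c d. c \<in> K \<and> d \<in> K}"

text \<open>The set \<open>K\<close> is disjoint from \<open>F\<close>, except that the constant \<open>0\<close> may be used as a member
  of \<open>K\<close> when \<open>B\<close> contains the unit rules. Without this exception the equation \<open>b \<approx> 0\<close>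
  would have no congruence closure modulo the unit rules: \<open>b\<close> and \<open>0\<close> only become joinable if
  there is a rule \<open>0 \<rightarrow> c\<close> with \<open>c \<in> K\<close>, but then \<open>g(x,0)\<close> rewrites to \<open>x\<close> and to \<open>g(x,c)\<close>,
  which have no common reduct.\<close>

definition unit_consts :: "eqn set \<Rightarrow> nat set" where
  "unit_consts B = {z. \<exists>g. unit_rules g z \<subseteq> B}"

definition cong_closure_mod ::
  "(nat \<Rightarrow> nat) \<Rightarrow> nat set \<Rightarrow> eqn set \<Rightarrow> eqn set \<Rightarrow> eqn set \<Rightarrow>
   nat set \<Rightarrow> eqn set \<Rightarrow> eqn set \<Rightarrow> bool" where
  "cong_closure_mod ar F E B P K D C \<longleftrightarrow>
     finite K \<and> K \<inter> F \<subseteq> unit_consts B \<and> D \<subseteq> D_rules ar F K \<and> C \<subseteq> C_rules K \<and>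
     (let T = terms ar F K; R = D \<union> C in
        (\<forall>c\<in>K. \<exists>t\<in>gterms ar F {}. (t, Cst c) \<in> conversion (rstep_mod T R E)) \<and>
        convergent_mod T (R \<union> B) E \<and>
        (\<forall>s\<in>gterms ar F {}. \<forall>t\<in>gterms ar F {}.
           (s, t) \<in> eqth (terms ar F {}) (P \<union> B \<union> E) \<longleftrightarrow>
           (\<exists>u\<in>gterms ar F K. \<exists>v\<in>gterms ar F K.
              (s, u) \<in> (rstep_mod T (R \<union> B) E)\<^sup>* \<and> (u, v) \<in> eqth T E \<and>
              (t, v) \<in> (rstep_mod T (R \<union> B) E)\<^sup>*)))"

section \<open>The tables\<close>

text \<open>The table of a symbol \<open>f\<close> of arity \<open>n\<close> is the stabilizer-chain table (Sims; Furst, Hopcroft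
  and Luks) of the group of all permutations of \<open>{1..n}\<close> under which \<open>f\<close> is invariant modulo \<open>E\<close>:
  the entry \<open>(i,j)\<close> is a group element that fixes \<open>1, \<dots>, i-1\<close> and maps \<open>i\<close> to \<open>j\<close>, if there is
  any.\<close>

definition perm_group :: "(nat \<Rightarrow> nat) \<Rightarrow> nat set \<Rightarrow> eqn set \<Rightarrow> nat \<Rightarrow> (nat \<Rightarrow> nat) set" where
  "perm_group ar F E f =
     {\<pi>. \<pi> permutes {1..ar f} \<and> perm_eqn ar f \<pi> \<in> eqth (terms ar F {}) E}"

type_synonym table = "nat \<Rightarrow> nat \<Rightarrow> (nat \<Rightarrow> nat) option"

definition is_table :: "(nat \<Rightarrow> nat) \<Rightarrow> nat set \<Rightarrow> eqn set \<Rightarrow> nat \<Rightarrow> table \<Rightarrow> bool" where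
  "is_table ar F E f tab \<longleftrightarrow>
     (\<forall>i\<in>{1..ar f}. \<forall>j\<in>{1..ar f}.
        let S = {\<pi> \<in> perm_group ar F E f. (\<forall>k\<in>{1..<i}. \<pi> k = k) \<and> \<pi> i = j} in
        case tab i j of None \<Rightarrow> S = {} | Some \<pi> \<Rightarrow> \<pi> \<in> S)"

section \<open>Random access machines\<close>

text \<open>Programs of a unit-cost random access machine with addition and truncated subtraction. A
  state consists of registers and of a memory that can be addressed indirectly. Evaluating an
  expression costs one unit per operation in it; a condition holds if its value is not \<open>0\<close>.\<close>

datatype expr = Num nat | Reg nat | Load expr | Add expr expr | Sub expr expr

datatype cmd =
    Skip
  | Assign nat expr
  | Store expr expr
  | Seq cmd cmd
  | Cond expr cmd cmd
  | While expr cmd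

type_synonym state = "(nat \<Rightarrow> nat) \<times> (nat \<Rightarrow> nat)"

fun val :: "expr \<Rightarrow> state \<Rightarrow> nat" where
  "val (Num k) s = k"
| "val (Reg r) s = fst s r"
| "val (Load a) s = snd s (val a s)"
| "val (Add a b) s = val a s + val b s"
| "val (Sub a b) s = val a s - val b s"

fun cost :: "expr \<Rightarrow> nat" where
  "cost (Num k) = 1"
| "cost (Reg r) = 1"
| "cost (Load a) = 1 + cost a"
| "cost (Add a b) = 1 + cost a + cost b"
| "cost (Sub a b) = 1 + cost a + cost b"

text \<open>\<open>exec c s t s'\<close>: started in state \<open>s\<close>, program \<open>c\<close> halts in state \<open>s'\<close> after \<open>t\<close> steps.\<close>

inductive exec :: "cmd \<Rightarrow> state \<Rightarrow> nat \<Rightarrow> state \<Rightarrow> bool" where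
  Skip: "exec Skip s 1 s"
| Assign: "exec (Assign r a) s (1 + cost a) ((fst s)(r := val a s), snd s)"
| Store: "exec (Store a b) s (1 + cost a + cost b) (fst s, (snd s)(val a s := val b s))"
| Seq: "exec c1 s t1 s1 \<Longrightarrow> exec c2 s1 t2 s2 \<Longrightarrow> exec (Seq c1 c2) s (t1 + t2) s2"
| CondTrue: "val b s \<noteq> 0 \<Longrightarrow> exec c1 s t s1 \<Longrightarrow> exec (Cond b c1 c2) s (1 + cost b + t) s1"
| CondFalse: "val b s = 0 \<Longrightarrow> exec c2 s t s1 \<Longrightarrow> exec (Cond b c1 c2) s (1 + cost b + t) s1"
| WhileFalse: "val b s = 0 \<Longrightarrow> exec (While b c) s (1 + cost b) s"
| WhileTrue: "val b s \<noteq> 0 \<Longrightarrow> exec c s t1 s1 \<Longrightarrow> exec (While b c) s1 t2 s2 \<Longrightarrow>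
    exec (While b c) s (1 + cost b + t1 + t2) s2"

section \<open>Input and output of the machine\<close>

text \<open>A ground term is written in prefix notation, one memory cell for each symbol. An equation
  or rule is written as its left-hand side followed by its right-hand side, and a list of
  equations is preceded by its length.\<close>

fun prefix_word :: "trm \<Rightarrow> nat list" where
  "prefix_word (Var x) = [x]"
| "prefix_word (Fun f ts) = f # concat (map prefix_word ts)"

definition eqns_word :: "eqn list \<Rightarrow> nat list" where
  "eqns_word es = length es # concat (map (\<lambda>(l, r). prefix_word l @ prefix_word r) es)"

text \<open>An empty table entry of a symbol of arity \<open>n\<close> is written as \<open>n\<close> zeros.\<close>

definition table_word :: "nat \<Rightarrow> table \<Rightarrow> nat list" where
  "table_word n tab =
     concat (map (\<lambda>i. concat (map (\<lambda>j.
       case tab i j of None \<Rightarrow> replicate n 0 | Some \<pi> \<Rightarrow> map \<pi> [1..<Suc n])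
     [1..<Suc n])) [1..<Suc n])"

definition tables_word :: "(nat \<Rightarrow> nat) \<Rightarrow> eqn set \<Rightarrow> (nat \<Rightarrow> table) \<Rightarrow> nat list" where
  "tables_word ar E tabs =
     concat (map (\<lambda>f. table_word (ar f) (tabs f)) (sorted_list_of_set (eqn_syms E)))"

text \<open>Initially the memory holds the tables followed by the equations, and zeros otherwise.
  Register \<open>0\<close> holds the address of the equations, register \<open>1\<close> the first unused address.\<close>

definition initial_state ::
  "(nat \<Rightarrow> nat) \<Rightarrow> eqn set \<Rightarrow> (nat \<Rightarrow> table) \<Rightarrow> eqn list \<Rightarrow> state" where
  "initial_state ar E tabs es =
     (let w = tables_word ar E tabs; m = w @ eqns_word es in
       ((\<lambda>r. if r = 0 then length w else if r = 1 then length m else 0),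
        (\<lambda>a. if a < length m then m ! a else 0)))"

text \<open>In the final state register \<open>0\<close> holds the address of the output.\<close>

definition outputs :: "state \<Rightarrow> nat set \<Rightarrow> eqn set \<Rightarrow> eqn set \<Rightarrow> bool" where
  "outputs s K D C \<longleftrightarrow>
     (\<exists>Ks Ds Cs. set Ks = K \<and> set Ds = D \<and> set Cs = C \<and>
        (let w = length Ks # Ks @ eqns_word Ds @ eqns_word Cs in
          \<forall>i<length w. snd s (fst s 0 + i) = w ! i))"

definition eqns_size :: "eqn set \<Rightarrow> nat" where
  "eqns_size P = (\<Sum>(l, r)\<in>P. nsyms l + nsyms r)"

end

theory Submission
  imports Defs
begin

text \<open>Every position of the input word starts a subterm, and these positions are the nodes of a
  congruence closure that merges classes naively: a test of constant cost decides whether two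
  nodes must be merged, because they are the sides of an equation, because they are congruent up
  to one of the finitely many argument permutations of their symbol, or because of a rule of
  \<open>B\<close>. The at most \<open>n\<close> merges are separated by at most quadratically many tests. The
  permutations depend on \<open>E\<close> only, so they are built into the program.

  In the resulting system every class has one constant and \<open>C\<close> is empty. When the unit rules are
  present, the class of \<open>0\<close> has the constant \<open>0\<close> itself; it is the least label, and of two labels the
  larger one is always replaced. Convergence follows from a compositional normal form: it
  evaluates terms in an algebra on normal forms in which all rules and equations hold up to \<open>E\<close>.\<close>

section \<open>Terms and contexts\<close>

text \<open>The point beyond ordinary congruence closure is that testing nodes suffices although the
  rules of \<open>B\<close> apply to arbitrary terms. In the algebra, an application that matches a
  node up to \<open>E\<close> takes the label of that node, any other application of
  \<open>g\<close> obeys the rules of \<open>B\<close>, and every remaining application stays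
  uninterpreted. Saturation ensures that a node match agrees with the rule of \<open>B\<close>
  whenever both are possible. Hence convertible terms have \<open>E\<close>-equal values, and no
  critical pairs modulo \<open>E\<close> have to be examined; the same fact gives convergence and
  completeness. Nilpotency and unit laws refer to \<open>0\<close>, so \<open>0\<close> has to be a
  node even if it does not occur in the input: the program appends the trivial equation between
  \<open>0\<close> and itself. Unit tests compare a label with the fixed number \<open>z\<close>,
  which is why the class of \<open>0\<close> must keep the label \<open>z\<close> through all
  merges. The rewriting argument is carried out for an abstract labelled set of nodes
  (\<open>closed_labelling\<close>) and meets the machine only in
  \<open>saturated_closure\<close>.\<close>

lemma Fun_in_terms_iff:
  "Fun f ts \<in> terms ar F K \<longleftrightarrow>
     ts = [] \<and> f \<in> K \<or> f \<in> F \<and> length ts = ar f \<and> set ts \<subseteq> terms ar F K"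
  by (subst terms.simps) auto

lemma Var_in_terms [simp]: "Var x \<in> terms ar F K"
  by (rule terms.intros)

lemma nth_in_terms: "Fun f ts \<in> terms ar F K \<Longrightarrow> i < length ts \<Longrightarrow> ts ! i \<in> terms ar F K"
  using nth_mem[of i ts] by (auto simp: Fun_in_terms_iff)

lemma subt_at_in_terms:
  "s \<in> terms ar F K \<Longrightarrow> p \<in> poss s \<Longrightarrow> subt_at s p \<in> terms ar F K"
  by (induction s p rule: subt_at.induct) (auto dest: nth_in_terms)

text \<open>\<open>rstep_mod\<close> asserts membership only for the whole terms; this recovers it
  for the contractum, as needed in the soundness proof.\<close>

lemma replace_at_in_terms_iff:
  "s \<in> terms ar F K \<Longrightarrow> p \<in> poss s \<Longrightarrow>
     replace_at s p u \<in> terms ar F K \<longleftrightarrow> u \<in> terms ar F K"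
proof (induction s p u rule: replace_at.induct)
  case (2 f ts i p u)
  then have i: "i < length ts" "p \<in> poss (ts ! i)" by auto
  with 2 have "f \<in> F" "length ts = ar f" "set ts \<subseteq> terms ar F K"
    by (auto simp: Fun_in_terms_iff)
  moreover have "replace_at (ts ! i) p u \<in> terms ar F K \<longleftrightarrow> u \<in> terms ar F K"
    using "2.IH"[OF nth_in_terms[OF "2.prems"(1) i(1)] i(2)] .
  ultimately show ?case
    using i(1) set_update_subset_insert[of ts i "replace_at (ts ! i) p u"]
      set_update_memI[of i ts "replace_at (ts ! i) p u"]
    by (auto simp: Fun_in_terms_iff)
qed auto

text \<open>Used for every later invariant of single steps (\<open>eqv\<close>, \<open>nf\<close>,
  \<open>wt\<close>, \<open>ext\<close>): what remains is the instance at the root and the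
  replacement of one argument, so no later proof recurses over positions.\<close>

lemma replace_at_induct:
  assumes "p \<in> poss s" and "Q (subt_at s p) u"
    and "\<And>f ts i v. i < length ts \<Longrightarrow> Q (ts ! i) v \<Longrightarrow> Q (Fun f ts) (Fun f (ts[i := v]))"
  shows "Q s (replace_at s p u)"
  using assms(1,2)
proof (induction s p u rule: replace_at.induct)
  case (2 f ts i p u)
  then have "i < length ts" "Q (ts ! i) (replace_at (ts ! i) p u)" by auto
  then show ?case by (simp add: assms(3))
qed auto

lemma gterms_Fun_iff:
  "Fun f ts \<in> gterms ar F K \<longleftrightarrow>
     ts = [] \<and> f \<in> K \<or> f \<in> F \<and> length ts = ar f \<and> set ts \<subseteq> gterms ar F K"
  unfolding gterms_def mem_Collect_eq Fun_in_terms_iff by fastforce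

lemma subst_ground: "vars t = {} \<Longrightarrow> subst t \<sigma> = t"
proof (induction t)
  case (Fun f ts)
  then have "map (\<lambda>t. subst t \<sigma>) ts = ts" by (intro map_idI) auto
  then show ?case by simp
qed simp

section \<open>Relations on terms that are closed under contexts\<close>

definition ctx_closed :: "trm set \<Rightarrow> trm rel \<Rightarrow> bool" where
  "ctx_closed T r \<longleftrightarrow> r \<subseteq> T \<times> T \<and>
     (\<forall>f ts i y. i < length ts \<and> Fun f ts \<in> T \<and> (ts ! i, y) \<in> r \<longrightarrow>
        (Fun f ts, Fun f (ts[i := y])) \<in> r)"

lemma update_in_terms:
  assumes "Fun f ts \<in> terms ar F K" and "i < length ts" and "y \<in> terms ar F K"
  shows "Fun f (ts[i := y]) \<in> terms ar F K"
  using assms set_update_subset_insert[of ts i y] by (auto simp: Fun_in_terms_iff)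

lemma ctx_closed_converse:
  assumes "ctx_closed (terms ar F K) r"
  shows "ctx_closed (terms ar F K) (r\<inverse>)"
  unfolding ctx_closed_def
proof (intro conjI allI impI)
  show "r\<inverse> \<subseteq> terms ar F K \<times> terms ar F K" using assms by (auto simp: ctx_closed_def)
  fix f ts i y
  assume a: "i < length ts \<and> Fun f ts \<in> terms ar F K \<and> (ts ! i, y) \<in> r\<inverse>"
  then have "Fun f (ts[i := y]) \<in> terms ar F K" "(ts[i := y] ! i, ts ! i) \<in> r"
    using assms by (auto intro!: update_in_terms simp: ctx_closed_def)
  \<comment> \<open>The forward step is taken from the updated term and restores the original
    argument.\<close>
  with a assms have "(Fun f (ts[i := y]), Fun f (ts[i := y, i := ts ! i])) \<in> r"
    unfolding ctx_closed_def by (metis length_list_update)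
  then show "(Fun f ts, Fun f (ts[i := y])) \<in> r\<inverse>" by simp
qed

lemma ctx_closed_Un: "ctx_closed T r \<Longrightarrow> ctx_closed T r' \<Longrightarrow> ctx_closed T (r \<union> r')"
  unfolding ctx_closed_def by blast

lemma rstep_ctx_closed: "ctx_closed (terms ar F K) (rstep (terms ar F K) X)"
  unfolding ctx_closed_def
proof (intro conjI allI impI)
  fix f ts i y
  assume a: "i < length ts \<and> Fun f ts \<in> terms ar F K \<and> (ts ! i, y) \<in> rstep (terms ar F K) X"
  then obtain p l r \<sigma> where h: "p \<in> poss (ts ! i)" "(l, r) \<in> X" "subt_at (ts ! i) p = subst l \<sigma>"
    "y = replace_at (ts ! i) p (subst r \<sigma>)" "y \<in> terms ar F K"
    unfolding rstep_def by blast
  have "i # p \<in> poss (Fun f ts)" "subt_at (Fun f ts) (i # p) = subst l \<sigma>"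
    "Fun f (ts[i := y]) = replace_at (Fun f ts) (i # p) (subst r \<sigma>)"
    using a h by auto
  moreover have "Fun f (ts[i := y]) \<in> terms ar F K" using a h update_in_terms by blast
  ultimately show "(Fun f ts, Fun f (ts[i := y])) \<in> rstep (terms ar F K) X"
    using a h(2) unfolding rstep_def by blast
qed (auto simp: rstep_def)

lemma rstep_mod_ctx_closed: "ctx_closed (terms ar F K) (rstep_mod (terms ar F K) X E)"
  unfolding ctx_closed_def
proof (intro conjI allI impI)
  fix f ts i y
  assume a: "i < length ts \<and> Fun f ts \<in> terms ar F K \<and> (ts ! i, y) \<in> rstep_mod (terms ar F K) X E"
  then obtain p l r \<sigma> where h: "p \<in> poss (ts ! i)" "\<nexists>x. subt_at (ts ! i) p = Var x" "(l, r) \<in> X"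
    "(subt_at (ts ! i) p, subst l \<sigma>) \<in> eqth (terms ar F K) E"
    "y = replace_at (ts ! i) p (subst r \<sigma>)" "y \<in> terms ar F K"
    unfolding rstep_mod_def by blast
  have "i # p \<in> poss (Fun f ts)" "\<nexists>x. subt_at (Fun f ts) (i # p) = Var x"
    "(subt_at (Fun f ts) (i # p), subst l \<sigma>) \<in> eqth (terms ar F K) E"
    "Fun f (ts[i := y]) = replace_at (Fun f ts) (i # p) (subst r \<sigma>)"
    using a h by auto
  moreover have "Fun f (ts[i := y]) \<in> terms ar F K" using a h update_in_terms by blast
  ultimately show "(Fun f ts, Fun f (ts[i := y])) \<in> rstep_mod (terms ar F K) X E"
    using a h(3) unfolding rstep_mod_def by blast
qed (auto simp: rstep_mod_def)

lemma ctx_closed_rtrancl_in: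
  assumes "ctx_closed T r" and "(s, t) \<in> r\<^sup>*" and "s \<in> T"
  shows "t \<in> T"
  using assms(2,1,3) by (induction rule: rtrancl_induct) (auto simp: ctx_closed_def)

lemma ctx_closed_rtrancl_update:
  assumes "ctx_closed (terms ar F K) r" and "(x, y) \<in> r\<^sup>*"
    and "i < length ts" and "ts ! i = x" and "Fun f ts \<in> terms ar F K"
  shows "(Fun f ts, Fun f (ts[i := y])) \<in> r\<^sup>*"
  using assms(2)
proof (induction rule: rtrancl_induct)
  case base
  then show ?case using assms(4) by auto
next
  case (step u v)
  have "u \<in> terms ar F K" using step.hyps(2) assms(1) by (auto simp: ctx_closed_def)
  then have "Fun f (ts[i := u]) \<in> terms ar F K" by (rule update_in_terms[OF assms(5,3)])
  then have "(Fun f (ts[i := u]), Fun f (ts[i := u, i := v])) \<in> r"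
    using step.hyps(2) assms(1,3) unfolding ctx_closed_def
    by (metis length_list_update nth_list_update_eq)
  then show ?case using step.IH by simp
qed

lemma ctx_closed_rtrancl_args:
  assumes cl: "ctx_closed (terms ar F K) r" and len: "length us = length ts"
    and args: "\<And>i. i < length ts \<Longrightarrow> (ts ! i, us ! i) \<in> r\<^sup>*" and T: "Fun f ts \<in> terms ar F K"
  shows "(Fun f ts, Fun f us) \<in> r\<^sup>*"
proof -
  \<comment> \<open>After \<open>k\<close> rounds the first \<open>k\<close> arguments are the new
    ones. The mixed term has to be a member of \<open>terms ar F K\<close> for the next round to be
    possible.\<close>
  have "(Fun f ts, Fun f (take k us @ drop k ts)) \<in> r\<^sup>*" if "k \<le> length ts" for k
    using that
  proof (induction k)
    case (Suc k)
    let ?vs = "take k us @ drop k ts"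
    have k: "k < length ts" "(Fun f ts, Fun f ?vs) \<in> r\<^sup>*" using Suc by auto
    have nth: "?vs ! k = ts ! k" using k len by (simp add: nth_append min_def)
    have "Fun f ?vs \<in> terms ar F K" using ctx_closed_rtrancl_in[OF cl k(2) T] .
    then have "(Fun f ?vs, Fun f (?vs[k := us ! k])) \<in> r\<^sup>*"
      using ctx_closed_rtrancl_update[OF cl args[OF k(1)], of k ?vs] k len nth by simp
    moreover have "?vs[k := us ! k] = take (Suc k) us @ drop (Suc k) ts"
      using k len by (intro nth_equalityI) (auto simp: nth_append nth_list_update min_def less_Suc_eq)
    ultimately show ?case using k(2) by (metis rtrancl_trans)
  qed simp
  from this[of "length ts"] show ?thesis using len by simp
qed

lemma eqth_ctx_closed:
  "ctx_closed (terms ar F K) (rstep (terms ar F K) X \<union> (rstep (terms ar F K) X)\<inverse>)"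
  by (intro ctx_closed_Un ctx_closed_converse rstep_ctx_closed)

section \<open>Equational theories as congruences\<close>

lemma eqth_in:
  "(s, t) \<in> eqth (terms ar F K) X \<Longrightarrow> s \<in> terms ar F K \<Longrightarrow> t \<in> terms ar F K"
  unfolding eqth_def conversion_def using ctx_closed_rtrancl_in[OF eqth_ctx_closed] by blast

lemma eqth_args:
  assumes "length us = length ts" and "\<And>i. i < length ts \<Longrightarrow> (ts ! i, us ! i) \<in> eqth (terms ar F K) X"
    and "Fun f ts \<in> terms ar F K"
  shows "(Fun f ts, Fun f us) \<in> eqth (terms ar F K) X"
  using ctx_closed_rtrancl_args[OF eqth_ctx_closed, of us ts] assms
  unfolding eqth_def conversion_def by blast

lemma eqth_refl [simp]: "(s, s) \<in> eqth T X"
  by (simp add: eqth_def conversion_def)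

lemma conversion_sym: "(s, t) \<in> conversion r \<Longrightarrow> (t, s) \<in> conversion r"
  using rtrancl_converseI[of t s "r \<union> r\<inverse>"]
  by (auto simp: conversion_def converse_Un Un_commute dest: rtrancl_converseI)

lemma eqth_sym: "(s, t) \<in> eqth T X \<Longrightarrow> (t, s) \<in> eqth T X"
  unfolding eqth_def by (rule conversion_sym)

lemma eqth_trans: "(s, t) \<in> eqth T X \<Longrightarrow> (t, u) \<in> eqth T X \<Longrightarrow> (s, u) \<in> eqth T X"
  unfolding eqth_def conversion_def by (rule rtrancl_trans)

lemma eqth_mono: "X \<subseteq> Y \<Longrightarrow> eqth T X \<subseteq> eqth T Y"
  unfolding eqth_def conversion_def by (intro rtrancl_mono Un_mono) (fastforce simp: rstep_def)+

lemma eqth_rule: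
  assumes "(l, r) \<in> X" and "subst l \<sigma> \<in> T" and "subst r \<sigma> \<in> T"
  shows "(subst l \<sigma>, subst r \<sigma>) \<in> eqth T X"
proof -
  have "[] \<in> poss (subst l \<sigma>)" by (cases "subst l \<sigma>") auto
  with assms have "(subst l \<sigma>, subst r \<sigma>) \<in> rstep T X"
    unfolding rstep_def by force
  then show ?thesis unfolding eqth_def conversion_def by blast
qed

lemma eqth_induct_steps:
  assumes "(s, t) \<in> eqth T X" and "\<And>s. Q s s" and "\<And>s t. Q s t \<Longrightarrow> Q t s"
    and "\<And>s t u. Q s t \<Longrightarrow> Q t u \<Longrightarrow> Q s u" and "\<And>s t. (s, t) \<in> rstep T X \<Longrightarrow> Q s t"
  shows "Q s t"
  using assms(1) unfolding eqth_def conversion_def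
proof (induction rule: rtrancl_induct)
  case (step u v)
  then have "Q u v" using assms(3,5) by auto
  then show ?case by (rule assms(4)[OF step.IH])
qed (rule assms(2))

section \<open>Equality modulo permutation equations\<close>

text \<open>Permutations act on argument positions counted from \<open>0\<close>, unlike in \<open>perm_eqn\<close>.\<close>

definition arg_perms :: "(nat \<Rightarrow> nat) \<Rightarrow> nat set \<Rightarrow> eqn set \<Rightarrow> nat \<Rightarrow> nat \<Rightarrow> (nat \<Rightarrow> nat) set" where
  "arg_perms ar F E f n = {\<pi>. \<pi> permutes {..<n} \<and>
     (\<forall>K ts. length ts = n \<and> Fun f ts \<in> terms ar F K \<longrightarrow>
        (Fun f ts, Fun f (permute_list \<pi> ts)) \<in> eqth (terms ar F K) E)}"

lemma finite_arg_perms: "finite (arg_perms ar F E f n)"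
  by (rule finite_subset[OF _ finite_permutations[of "{..<n}"]]) (auto simp: arg_perms_def)

lemma arg_perms_permutes: "\<pi> \<in> arg_perms ar F E f n \<Longrightarrow> \<pi> permutes {..<n}"
  by (simp add: arg_perms_def)

lemma arg_perms_less: "\<pi> \<in> arg_perms ar F E f n \<Longrightarrow> i < n \<Longrightarrow> \<pi> i < n"
  using permutes_in_image[OF arg_perms_permutes, of \<pi> ar F E f n i] by simp

lemma permute_list_in_terms:
  "\<pi> permutes {..<length ts} \<Longrightarrow>
     Fun f (permute_list \<pi> ts) \<in> terms ar F K \<longleftrightarrow> Fun f ts \<in> terms ar F K"
  using set_permute_list[of \<pi> ts] length_0_conv[of "permute_list \<pi> ts"]
  by (auto simp: Fun_in_terms_iff simp del: length_0_conv)

lemma arg_perms_id: "id \<in> arg_perms ar F E f n"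
  by (auto simp: arg_perms_def permutes_id)

text \<open>Together with the inverse this makes \<open>arg_perms\<close> a group, which yields
  transitivity and symmetry of \<open>eqv\<close>. Since membership is defined by provability, no
  generated subgroup has to be constructed.\<close>

lemma arg_perms_comp:
  assumes "\<pi> \<in> arg_perms ar F E f n" and "\<rho> \<in> arg_perms ar F E f n"
  shows "\<pi> \<circ> \<rho> \<in> arg_perms ar F E f n"
proof -
  have p: "\<pi> permutes {..<n}" "\<rho> permutes {..<n}" using assms by (auto simp: arg_perms_def)
  have "(Fun f ts, Fun f (permute_list (\<pi> \<circ> \<rho>) ts)) \<in> eqth (terms ar F K) E"
    if "length ts = n" "Fun f ts \<in> terms ar F K" for K ts
  proof -
    have a: "(Fun f ts, Fun f (permute_list \<pi> ts)) \<in> eqth (terms ar F K) E"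
      using assms(1) that by (auto simp: arg_perms_def)
    have "(Fun f (permute_list \<pi> ts), Fun f (permute_list \<rho> (permute_list \<pi> ts)))
        \<in> eqth (terms ar F K) E"
      using assms(2) that eqth_in[OF a] by (auto simp: arg_perms_def)
    with a show ?thesis using p that permute_list_compose[of \<rho> ts \<pi>] by (auto intro: eqth_trans)
  qed
  then show ?thesis using p by (auto simp: arg_perms_def intro: permutes_compose)
qed

lemma arg_perms_inv:
  assumes "\<pi> \<in> arg_perms ar F E f n"
  shows "inv \<pi> \<in> arg_perms ar F E f n"
proof -
  have p: "\<pi> permutes {..<n}" "inv \<pi> permutes {..<n}"
    using assms by (auto simp: arg_perms_def permutes_inv)
  have "(Fun f ts, Fun f (permute_list (inv \<pi>) ts)) \<in> eqth (terms ar F K) E"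
    if "length ts = n" "Fun f ts \<in> terms ar F K" for K ts
  proof -
    have "Fun f (permute_list (inv \<pi>) ts) \<in> terms ar F K"
      using that p permute_list_in_terms by blast
    then have "(Fun f (permute_list (inv \<pi>) ts), Fun f (permute_list \<pi> (permute_list (inv \<pi>) ts)))
        \<in> eqth (terms ar F K) E"
      using assms that by (auto simp: arg_perms_def)
    moreover have "permute_list \<pi> (permute_list (inv \<pi>) ts) = ts"
      using p that permute_list_compose[of \<pi> ts "inv \<pi>"]
      by (simp add: permutes_inv_o)
    ultimately show ?thesis by (simp add: eqth_sym)
  qed
  then show ?thesis using p by (auto simp: arg_perms_def)
qed

text \<open>This is \<open>\<rho>\<close> conjugated by the shift from \<open>k\<close> to
  \<open>k + 1\<close>. Injectivity suffices, because an injective self-map of a finite set is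
  onto.\<close>

lemma perm_eqn_shift:
  assumes "\<rho> permutes {1..n}"
  shows "(\<lambda>k. if k < n then \<rho> (Suc k) - 1 else k) permutes {..<n}"
proof (rule bij_imp_permutes)
  have mem: "\<rho> (Suc k) \<in> {1..n}" if "k < n" for k using permutes_in_image[OF assms] that by auto
  have "inj_on (\<lambda>k. \<rho> (Suc k) - 1) {..<n}"
  proof (rule inj_onI)
    fix x y assume "x \<in> {..<n}" "y \<in> {..<n}" "\<rho> (Suc x) - 1 = \<rho> (Suc y) - 1"
    with mem[of x] mem[of y] have "\<rho> (Suc x) = \<rho> (Suc y)" by auto
    then show "x = y" using permutes_inj[OF assms] by (auto dest: injD)
  qed
  then have inj: "inj_on (\<lambda>k. if k < n then \<rho> (Suc k) - 1 else k) {..<n}"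
    by (rule inj_on_cong[THEN iffD1, rotated]) auto
  have "(\<lambda>k. if k < n then \<rho> (Suc k) - 1 else k) ` {..<n} \<subseteq> {..<n}"
    using mem by fastforce
  then have "(\<lambda>k. if k < n then \<rho> (Suc k) - 1 else k) ` {..<n} = {..<n}"
    using inj by (intro endo_inj_surj) auto
  with inj show "bij_betw (\<lambda>k. if k < n then \<rho> (Suc k) - 1 else k) {..<n} {..<n}"
    by (simp only: bij_betw_def)
qed auto

text \<open>A structural description of equality modulo \<open>E\<close>. It is available because
  permutation equations keep the root symbol and only rearrange the arguments below it; the
  permutations at different positions are then independent. Conversions modulo \<open>E\<close> can
  thereby be replaced by induction on terms.\<close>

inductive eqv :: "(nat \<Rightarrow> nat) \<Rightarrow> nat set \<Rightarrow> eqn set \<Rightarrow> trm \<Rightarrow> trm \<Rightarrow> bool" for ar F E where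
  Var: "eqv ar F E (Var x) (Var x)"
| Fun: "\<pi> \<in> arg_perms ar F E f (length ts) \<Longrightarrow> length us = length ts \<Longrightarrow>
    (\<And>i. i < length ts \<Longrightarrow> eqv ar F E (ts ! i) (us ! \<pi> i)) \<Longrightarrow> eqv ar F E (Fun f ts) (Fun f us)"

inductive_cases eqv_FunE: "eqv ar F E (Fun f ts) t"
inductive_cases eqv_VarE: "eqv ar F E (Var x) t"

lemma eqv_refl: "eqv ar F E t t"
proof (induction t)
  case (Fun f ts)
  then show ?case by (intro eqv.Fun[of id]) (auto simp: arg_perms_id)
qed (rule eqv.Var)

lemma eqv_sym: "eqv ar F E s t \<Longrightarrow> eqv ar F E t s"
proof (induction rule: eqv.induct)
  case (Fun \<pi> f ts us)
  show ?case
  proof (rule eqv.Fun)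
    show "inv \<pi> \<in> arg_perms ar F E f (length us)" using Fun.hyps arg_perms_inv by simp
    fix i assume i: "i < length us"
    have "inv \<pi> i < length ts" using i Fun.hyps arg_perms_less[OF arg_perms_inv[OF Fun.hyps(1)]] by simp
    moreover have "\<pi> (inv \<pi> i) = i" using permutes_inverses(1)[OF arg_perms_permutes[OF Fun.hyps(1)]] .
    ultimately show "eqv ar F E (us ! i) (ts ! inv \<pi> i)" using Fun.IH by metis
  qed (use Fun in auto)
qed (rule eqv.Var)

lemma eqv_trans: "eqv ar F E s t \<Longrightarrow> eqv ar F E t u \<Longrightarrow> eqv ar F E s u"
proof (induction arbitrary: u rule: eqv.induct)
  case (Fun \<pi> f ts us)
  from Fun.prems obtain \<rho> vs where v: "u = Fun f vs" "\<rho> \<in> arg_perms ar F E f (length us)"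
    "length vs = length us" "\<And>i. i < length us \<Longrightarrow> eqv ar F E (us ! i) (vs ! \<rho> i)"
    by (elim eqv_FunE) auto
  have "eqv ar F E (ts ! i) (vs ! (\<rho> \<circ> \<pi>) i)" if "i < length ts" for i
    using Fun.IH[OF that] v(4) Fun.hyps arg_perms_less[OF Fun.hyps(1) that] by simp
  then show ?case unfolding v(1) using Fun.hyps v by (intro eqv.Fun[of "\<rho> \<circ> \<pi>"] arg_perms_comp) auto
qed

lemma eqv_args:
  "length us = length ts \<Longrightarrow> (\<And>i. i < length ts \<Longrightarrow> eqv ar F E (ts ! i) (us ! i)) \<Longrightarrow>
     eqv ar F E (Fun f ts) (Fun f us)"
  by (rule eqv.Fun[of id]) (auto simp: arg_perms_id)

lemma eqv_update:
  "i < length ts \<Longrightarrow> eqv ar F E (ts ! i) v \<Longrightarrow> eqv ar F E (Fun f ts) (Fun f (ts[i := v]))"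
  by (rule eqv_args) (auto simp: nth_list_update eqv_refl)

lemma eqv_Cst_iff [simp]: "eqv ar F E (Cst c) t \<longleftrightarrow> t = Cst c"
  by (auto elim: eqv_FunE intro: eqv_refl)

lemma eqv_Cst_iff' [simp]: "eqv ar F E t (Cst c) \<longleftrightarrow> t = Cst c"
  using eqv_sym eqv_Cst_iff by metis

lemma eqv_in_terms: "eqv ar F E s t \<Longrightarrow> s \<in> terms ar F K \<Longrightarrow> t \<in> terms ar F K"
proof (induction rule: eqv.induct)
  case (Fun \<pi> f ts us)
  have "us ! j \<in> terms ar F K" if "j < length us" for j
  proof -
    have "inv \<pi> j < length ts" using that Fun.hyps arg_perms_less[OF arg_perms_inv[OF Fun.hyps(1)]] by simp
    moreover have "\<pi> (inv \<pi> j) = j" using permutes_inverses(1)[OF arg_perms_permutes[OF Fun.hyps(1)]] .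
    ultimately show ?thesis using Fun.IH[of "inv \<pi> j"] nth_in_terms[OF Fun.prems]
      by simp
  qed
  then have "set us \<subseteq> terms ar F K" by (auto simp: in_set_conv_nth)
  then show ?case using Fun.prems Fun.hyps by (auto simp: Fun_in_terms_iff)
qed

text \<open>Stated for every \<open>X\<close> above \<open>E\<close> since it serves
  \<open>E\<close> itself as well as the theory of \<open>P\<close>, \<open>B\<close> and
  \<open>E\<close>. The arguments \<open>ts\<close> are equated one by one with \<open>us\<close>
  rearranged by \<open>\<pi>\<close>; that rearrangement is in turn equal to \<open>us\<close>
  modulo \<open>E\<close>.\<close>

lemma eqv_imp_eqth:
  assumes "E \<subseteq> X"
  shows "eqv ar F E s t \<Longrightarrow> s \<in> terms ar F K \<Longrightarrow> (s, t) \<in> eqth (terms ar F K) X"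
proof (induction rule: eqv.induct)
  case (Fun \<pi> f ts us)
  have "eqv ar F E (Fun f ts) (Fun f us)" using Fun by (intro eqv.Fun)
  then have us: "Fun f us \<in> terms ar F K" using eqv_in_terms Fun.prems by blast
  have p: "\<pi> permutes {..<length us}" using Fun.hyps arg_perms_permutes by metis
  have "(ts ! i, us ! \<pi> i) \<in> eqth (terms ar F K) X" if "i < length ts" for i
    using Fun.IH[OF that nth_in_terms[OF Fun.prems that]] .
  then have "(Fun f ts, Fun f (permute_list \<pi> us)) \<in> eqth (terms ar F K) X"
    using Fun p by (intro eqth_args) (auto simp: permute_list_nth)
  moreover have "(Fun f us, Fun f (permute_list \<pi> us)) \<in> eqth (terms ar F K) E"
    using us Fun.hyps by (auto simp: arg_perms_def)
  then have "(Fun f us, Fun f (permute_list \<pi> us)) \<in> eqth (terms ar F K) X"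
    using eqth_mono[OF assms] by (rule subsetD[rotated])
  ultimately show ?case by (rule eqth_trans[OF _ eqth_sym])
qed simp

text \<open>Every equation of \<open>E\<close> contributes its permutation to
  \<open>arg_perms\<close>, because a suitable instance of it permutes an arbitrary argument
  list.\<close>

lemma eqv_perm_eqn:
  assumes "is_perm_eqn ar F (l, r)" and "(l, r) \<in> E"
  shows "eqv ar F E (subst l \<sigma>) (subst r \<sigma>)"
proof -
  from assms obtain f \<rho> where f: "\<rho> permutes {1..ar f}" "(l, r) = perm_eqn ar f \<rho>"
    unfolding is_perm_eqn_def by blast
  define \<pi> where "\<pi> = (\<lambda>k. if k < ar f then \<rho> (Suc k) - 1 else k)"
  have p: "\<pi> permutes {..<ar f}" unfolding \<pi>_def using f(1) by (rule perm_eqn_shift)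
  have nth: "[Suc 0..<Suc (ar f)] ! k = Suc k" if "k < ar f" for k
    using that by (simp del: upt_Suc)
  have rho: "\<rho> (Suc k) = Suc (\<pi> k)" if "k < ar f" for k
    using permutes_in_image[OF f(1), of "Suc k"] that by (auto simp: \<pi>_def)
  have inst: "subst l \<tau> = Fun f (map \<tau> [1..<Suc (ar f)])"
    "subst r \<tau> = Fun f (permute_list \<pi> (map \<tau> [1..<Suc (ar f)]))" for \<tau>
  proof -
    have lr: "l = Fun f (map Var [1..<Suc (ar f)])" "r = Fun f (map (\<lambda>i. Var (\<rho> i)) [1..<Suc (ar f)])"
      using f(2) by (auto simp: perm_eqn_def simp del: upt_Suc)
    show "subst l \<tau> = Fun f (map \<tau> [1..<Suc (ar f)])"
      by (simp only: lr subst.simps map_map comp_def)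
    have "subst r \<tau> = Fun f (map (\<lambda>i. \<tau> (\<rho> i)) [1..<Suc (ar f)])"
      by (simp only: lr subst.simps map_map comp_def)
    moreover have "map (\<lambda>i. \<tau> (\<rho> i)) [1..<Suc (ar f)] = permute_list \<pi> (map \<tau> [1..<Suc (ar f)])"
    proof (rule nth_equalityI)
      fix k assume "k < length (map (\<lambda>i. \<tau> (\<rho> i)) [1..<Suc (ar f)])"
      then have k: "k < ar f" by (simp del: upt_Suc)
      then have k': "\<pi> k < ar f" using permutes_in_image[OF p, of k] by simp
      have "map (\<lambda>i. \<tau> (\<rho> i)) [1..<Suc (ar f)] ! k = \<tau> (\<rho> (Suc k))"
        using k by (simp add: nth del: upt_Suc)
      also have "\<dots> = map \<tau> [1..<Suc (ar f)] ! \<pi> k"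
        using k' by (simp add: nth rho[OF k] del: upt_Suc)
      also have "\<dots> = permute_list \<pi> (map \<tau> [1..<Suc (ar f)]) ! k"
        using p k by (simp add: permute_list_nth del: upt_Suc)
      finally show "map (\<lambda>i. \<tau> (\<rho> i)) [1..<Suc (ar f)] ! k = permute_list \<pi> (map \<tau> [1..<Suc (ar f)]) ! k" .
    qed simp
    ultimately show "subst r \<tau> = Fun f (permute_list \<pi> (map \<tau> [1..<Suc (ar f)]))" by simp
  qed
  have "\<pi> \<in> arg_perms ar F E f (ar f)"
  proof -
    have "(Fun f ts, Fun f (permute_list \<pi> ts)) \<in> eqth (terms ar F K) E"
      if "length ts = ar f" "Fun f ts \<in> terms ar F K" for K ts
    proof -
      \<comment> \<open>Variables count from 1 and list positions from 0, so this substitution turns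
        the left-hand side into \<open>Fun f ts\<close>.\<close>
      have "map (\<lambda>i. ts ! (i - 1)) [1..<Suc (ar f)] = ts"
        using that by (intro nth_equalityI) (simp_all add: nth del: upt_Suc)
      then have "subst l (\<lambda>i. ts ! (i - 1)) = Fun f ts"
        "subst r (\<lambda>i. ts ! (i - 1)) = Fun f (permute_list \<pi> ts)" by (simp_all only: inst)
      moreover have "Fun f (permute_list \<pi> ts) \<in> terms ar F K"
        using that p permute_list_in_terms[of \<pi> ts] by simp
      ultimately show ?thesis
        using eqth_rule[OF assms(2), of "\<lambda>i. ts ! (i - 1)" "terms ar F K"] that by simp
    qed
    then show ?thesis using p by (auto simp: arg_perms_def)
  qed
  \<comment> \<open>From right to left, because \<open>permute_list\<close> places the entry with
    index \<open>\<pi> i\<close> at position \<open>i\<close>, just as \<open>eqv.Fun\<close>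
    expects.\<close>
  then have "eqv ar F E (subst r \<sigma>) (subst l \<sigma>)"
    unfolding inst using p
    by (intro eqv.Fun[of \<pi>])
      (simp_all add: permute_list_nth eqv_refl del: upt_Suc)
  then show ?thesis by (rule eqv_sym)
qed

lemma eqth_imp_eqv:
  assumes "\<And>e. e \<in> E \<Longrightarrow> is_perm_eqn ar F e" and "(s, t) \<in> eqth T E"
  shows "eqv ar F E s t"
proof (rule eqth_induct_steps[where Q = "eqv ar F E", OF assms(2)])
  fix s t assume "(s, t) \<in> rstep T E"
  then obtain p l r \<sigma> where h: "p \<in> poss s" "(l, r) \<in> E" "subt_at s p = subst l \<sigma>"
    "t = replace_at s p (subst r \<sigma>)" unfolding rstep_def by blast
  then have "eqv ar F E (subt_at s p) (subst r \<sigma>)" using eqv_perm_eqn[OF assms(1)[OF h(2)] h(2)] by simp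
  then show "eqv ar F E s t" unfolding h(4)
    by (rule replace_at_induct[where Q = "eqv ar F E", OF h(1)]) (rule eqv_update)
qed (rule eqv_refl, erule eqv_sym, erule (1) eqv_trans)

section \<open>Congruence closures from closed labellings\<close>

lemma terms_mono: "t \<in> terms ar F K \<Longrightarrow> K \<subseteq> K' \<Longrightarrow> t \<in> terms ar F K'"
  by (induction rule: terms.induct) (auto simp: Fun_in_terms_iff)

lemma root_rstep_mod:
  assumes "(l, r) \<in> X" and "eqv ar F E (Fun f ts) (subst l \<sigma>)"
    and "Fun f ts \<in> terms ar F K" and "subst r \<sigma> \<in> terms ar F K"
  shows "(Fun f ts, subst r \<sigma>) \<in> rstep_mod (terms ar F K) X E"
proof -
  have "[] \<in> poss (Fun f ts)" "\<nexists>x. subt_at (Fun f ts) [] = Var x"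
    "subst r \<sigma> = replace_at (Fun f ts) [] (subst r \<sigma>)" by auto
  moreover have "(subt_at (Fun f ts) [], subst l \<sigma>) \<in> eqth (terms ar F K) E"
    using eqv_imp_eqth[OF subset_refl assms(2,3)] by simp
  ultimately show ?thesis using assms(1,3,4) unfolding rstep_mod_def by blast
qed

datatype rule_kind = Idem | Nilp | Unit

text \<open>A set of kinds covers the five shapes of \<open>B\<close> and the empty set uniformly,
  and the program is assembled from the same set.\<close>

definition kind_rules :: "nat \<Rightarrow> nat \<Rightarrow> rule_kind set \<Rightarrow> eqn set" where
  "kind_rules g z rs = (if Idem \<in> rs then idem_rules g else {}) \<union>
     (if Nilp \<in> rs then nilp_rules g z else {}) \<union> (if Unit \<in> rs then unit_rules g z else {})"

text \<open>All closure conditions speak about nodes only. \<open>P_lab\<close> and the conditions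
  from \<open>cong\<close> to \<open>unit_l\<close> force identifications, while
  \<open>sound\<close> limits them to provable ones. By \<open>lab_F\<close> the only symbol of
  \<open>F\<close> that can occur as a label is the constant \<open>0\<close>, and only in presence
  of the unit rules.\<close>

locale closed_labelling =
  fixes ar :: "nat \<Rightarrow> nat" and F :: "nat set" and E P B :: "eqn set" and g z zn :: nat
    and rs :: "rule_kind set" and I :: "nat set" and sy :: "nat \<Rightarrow> nat" and ch :: "nat \<Rightarrow> nat list"
    and tm :: "nat \<Rightarrow> trm" and lab :: "nat \<Rightarrow> nat"
  assumes E_perm: "\<And>e. e \<in> E \<Longrightarrow> is_perm_eqn ar F e"
    and B_eq: "B = kind_rules g z rs"
    and g: "rs \<noteq> {} \<Longrightarrow> g \<in> F \<and> ar g = 2"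
    and z: "Nilp \<in> rs \<or> Unit \<in> rs \<Longrightarrow> z \<in> F \<and> ar z = 0 \<and> zn \<in> I \<and> sy zn = z"
    and bin: "\<not> (Idem \<in> rs \<and> Nilp \<in> rs)"
    and fin: "finite I"
    and node: "\<And>i. i \<in> I \<Longrightarrow> sy i \<in> F \<and> length (ch i) = ar (sy i) \<and> set (ch i) \<subseteq> I \<and>
      tm i = Fun (sy i) (map tm (ch i))"
    and lab_z: "Unit \<in> rs \<Longrightarrow> lab zn = z"
    and lab_F: "\<And>i. i \<in> I \<Longrightarrow> lab i \<in> F \<Longrightarrow> Unit \<in> rs \<and> lab i = z"
    and P_lab: "\<And>l r. (l, r) \<in> P \<Longrightarrow> \<exists>i\<in>I. \<exists>j\<in>I. tm i = l \<and> tm j = r \<and> lab i = lab j"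
    and cong: "\<And>i j \<pi>. i \<in> I \<Longrightarrow> j \<in> I \<Longrightarrow> sy i = sy j \<Longrightarrow>
      \<pi> \<in> arg_perms ar F E (sy i) (ar (sy i)) \<Longrightarrow>
      (\<And>k. k < ar (sy i) \<Longrightarrow> lab (ch i ! k) = lab (ch j ! \<pi> k)) \<Longrightarrow> lab i = lab j"
    and idem: "\<And>i. Idem \<in> rs \<Longrightarrow> i \<in> I \<Longrightarrow> sy i = g \<Longrightarrow> lab (ch i ! 0) = lab (ch i ! 1) \<Longrightarrow>
      lab i = lab (ch i ! 0)"
    and nilp: "\<And>i. Nilp \<in> rs \<Longrightarrow> i \<in> I \<Longrightarrow> sy i = g \<Longrightarrow> lab (ch i ! 0) = lab (ch i ! 1) \<Longrightarrow>
      lab i = lab zn"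
    and unit_r: "\<And>i. Unit \<in> rs \<Longrightarrow> i \<in> I \<Longrightarrow> sy i = g \<Longrightarrow> lab (ch i ! 1) = z \<Longrightarrow> lab i = lab (ch i ! 0)"
    and unit_l: "\<And>i. Unit \<in> rs \<Longrightarrow> i \<in> I \<Longrightarrow> sy i = g \<Longrightarrow> lab (ch i ! 0) = z \<Longrightarrow> lab i = lab (ch i ! 1)"
    and sound: "\<And>i j. i \<in> I \<Longrightarrow> j \<in> I \<Longrightarrow> lab i = lab j \<Longrightarrow>
      (tm i, tm j) \<in> eqth (terms ar F {}) (P \<union> B \<union> E)"
begin

definition K :: "nat set" where "K = lab ` I"

abbreviation T :: "trm set" where "T \<equiv> terms ar F K"
abbreviation T0 :: "trm set" where "T0 \<equiv> terms ar F {}"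
abbreviation eq :: "trm \<Rightarrow> trm \<Rightarrow> bool" where "eq \<equiv> eqv ar F E"

definition lhs :: "nat \<Rightarrow> trm" where
  "lhs i = Fun (sy i) (map (\<lambda>j. Cst (lab j)) (ch i))"

text \<open>The side condition removes the looping rule from \<open>0\<close> to \<open>0\<close>
  that would arise when \<open>0\<close> is its own label.\<close>

definition D :: "eqn set" where
  "D = {(lhs i, Cst (lab i)) | i. i \<in> I \<and> sy i \<noteq> lab i}"

lemma node_sy: "i \<in> I \<Longrightarrow> sy i \<in> F"
  and node_len: "i \<in> I \<Longrightarrow> length (ch i) = ar (sy i)"
  and node_ch: "i \<in> I \<Longrightarrow> set (ch i) \<subseteq> I"
  and node_tm: "i \<in> I \<Longrightarrow> tm i = Fun (sy i) (map tm (ch i))"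
  using node by auto

text \<open>Children denote proper subterms, so the size of the denoted term is a measure and no
  order on the nodes is required.\<close>

lemma node_induct [consumes 1, case_names node]:
  assumes "i \<in> I" and step: "\<And>i. i \<in> I \<Longrightarrow> (\<And>j. j \<in> set (ch i) \<Longrightarrow> Q j) \<Longrightarrow> Q i"
  shows "Q i"
  using assms(1)
proof (induction "size (tm i)" arbitrary: i rule: less_induct)
  case less
  show ?case
  proof (rule step[OF less.prems])
    fix j assume j: "j \<in> set (ch i)"
    then have "tm j \<in> set (map tm (ch i))" by simp
    then have "size (tm j) < size (Fun (sy i) (map tm (ch i)))"
      using size_list_estimation'[of "tm j" "map tm (ch i)" "size (tm j)" size] by simp
    then have "size (tm j) < size (tm i)" using node_tm[OF less.prems] by simp
    then show "Q j" using less.hyps j node_ch[OF less.prems] by blast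
  qed
qed

lemma tm_in_T0: "i \<in> I \<Longrightarrow> tm i \<in> T0"
proof (induction i rule: node_induct)
  case (node i)
  then show ?case using node_sy[of i] node_len[of i] node_tm[of i] by (auto simp: Fun_in_terms_iff)
qed

lemma tm_ground: "i \<in> I \<Longrightarrow> vars (tm i) = {}"
proof (induction i rule: node_induct)
  case (node i)
  then show ?case using node_tm[of i] by auto
qed

lemma tm_in_T: "i \<in> I \<Longrightarrow> tm i \<in> T"
  using terms_mono[OF tm_in_T0] by blast

lemma K_F: "c \<in> K \<Longrightarrow> c \<in> F \<Longrightarrow> Unit \<in> rs \<and> c = z"
  using lab_F by (auto simp: K_def)

lemma lhs_in_T: "i \<in> I \<Longrightarrow> lhs i \<in> T"
  using node_sy[of i] node_len[of i] node_ch[of i]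
  by (auto simp: lhs_def K_def Fun_in_terms_iff)

text \<open>Determinism of \<open>D\<close> modulo \<open>E\<close>, by closure under congruence. It
  makes the choice in \<open>red\<close> immaterial.\<close>

lemma eq_lhs_imp_lab:
  assumes i: "i \<in> I" and j: "j \<in> I" and eq: "eq (lhs i) (lhs j)"
  shows "lab i = lab j"
proof -
  from eq obtain \<pi> where p: "sy i = sy j" "\<pi> \<in> arg_perms ar F E (sy i) (length (ch i))"
    "length (ch j) = length (ch i)"
    "\<And>k. k < length (ch i) \<Longrightarrow> eq (map (\<lambda>j. Cst (lab j)) (ch i) ! k) (map (\<lambda>j. Cst (lab j)) (ch j) ! \<pi> k)"
    unfolding lhs_def by (elim eqv_FunE) auto
  show ?thesis
  proof (rule cong[OF i j p(1)])
    show "\<pi> \<in> arg_perms ar F E (sy i) (ar (sy i))" using p(2) node_len[OF i] by simp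
    fix k assume "k < ar (sy i)"
    then have "k < length (ch i)" using node_len[OF i] by simp
    then show "lab (ch i ! k) = lab (ch j ! \<pi> k)"
      using p(4)[of k] arg_perms_less[OF p(2), of k] p(3) by simp
  qed
qed

text \<open>The operation of \<open>f\<close> in the algebra. Node matches come first; the laws of
  \<open>B\<close> proved below show that this priority does no harm. Comparing with
  \<open>Cst z\<close> literally is enough for the unit clauses, since a constant is
  \<open>E\<close>-equal only to itself and \<open>0\<close> has the value \<open>Cst z\<close> when
  these clauses apply.\<close>

definition red :: "nat \<Rightarrow> trm list \<Rightarrow> trm" where
  "red f us =
     (if \<exists>i\<in>I. eq (Fun f us) (lhs i) then Cst (lab (SOME i. i \<in> I \<and> eq (Fun f us) (lhs i)))
      else if f = g \<and> length us = 2 then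
        (if Idem \<in> rs \<and> eq (us ! 0) (us ! 1) then us ! 0
         else if Nilp \<in> rs \<and> eq (us ! 0) (us ! 1) then Cst (lab zn)
         else if Unit \<in> rs \<and> us ! 1 = Cst z then us ! 0
         else if Unit \<in> rs \<and> us ! 0 = Cst z then us ! 1
         else Fun f us)
      else Fun f us)"

lemma red_node:
  assumes "i \<in> I" and "eq (Fun f us) (lhs i)"
  shows "red f us = Cst (lab i)"
proof -
  define j where "j = (SOME i. i \<in> I \<and> eq (Fun f us) (lhs i))"
  have j: "j \<in> I \<and> eq (Fun f us) (lhs j)"
    unfolding j_def by (rule someI[of _ i]) (use assms in simp)
  have "eq (lhs i) (lhs j)" by (rule eqv_trans[OF eqv_sym[OF assms(2)]]) (use j in simp)
  then have "lab i = lab j" using eq_lhs_imp_lab assms(1) j by simp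
  then show ?thesis using assms unfolding red_def j_def by auto
qed

text \<open>Node matches are invariant by transitivity of \<open>eqv\<close>. For the clauses of
  \<open>g\<close>, a permutation of two positions is the identity or the swap, and the list of
  clauses is symmetric up to \<open>E\<close>.\<close>

lemma red_cong:
  assumes p: "\<pi> \<in> arg_perms ar F E f (length us)" and len: "length vs = length us"
    and args: "\<And>i. i < length us \<Longrightarrow> eq (us ! i) (vs ! \<pi> i)"
  shows "eq (red f us) (red f vs)"
proof (cases "\<exists>i\<in>I. eq (Fun f us) (lhs i)")
  case True
  then obtain i where i: "i \<in> I" "eq (Fun f us) (lhs i)" by blast
  have "eq (Fun f vs) (Fun f us)" by (rule eqv_sym[OF eqv.Fun[OF p len args]])
  then have "eq (Fun f vs) (lhs i)" using i(2) by (rule eqv_trans)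
  then show ?thesis using red_node[OF i] red_node[OF i(1)] by simp
next
  case False
  have uv: "eq (Fun f us) (Fun f vs)" by (rule eqv.Fun[OF p len args])
  have nv: "\<not> (\<exists>i\<in>I. eq (Fun f vs) (lhs i))"
    using False eqv_trans[OF uv] by blast
  show ?thesis
  proof (cases "f = g \<and> length us = 2")
    case True
    have inj: "\<pi> 0 \<noteq> \<pi> 1" using permutes_inj[OF arg_perms_permutes[OF p]] by (auto dest: injD)
    have lt: "\<pi> 0 < 2" "\<pi> 1 < 2" using arg_perms_less[OF p] True by auto
    have ab: "eq (us ! 0) (vs ! \<pi> 0)" "eq (us ! 1) (vs ! \<pi> 1)" using args True by auto
    have c: "\<pi> 0 = 0 \<and> \<pi> 1 = 1 \<or> \<pi> 0 = 1 \<and> \<pi> 1 = 0" using inj lt by linarith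
    have e: "eq (us ! 0) (us ! 1) \<longleftrightarrow> eq (vs ! \<pi> 0) (vs ! \<pi> 1)"
      using ab eqv_sym eqv_trans by meson
    have e': "eq (vs ! 0) (vs ! 1) \<longleftrightarrow> eq (us ! 0) (us ! 1)"
      using c e eqv_sym[of ar F E "vs ! 0" "vs ! 1"] eqv_sym[of ar F E "vs ! 1" "vs ! 0"] by auto
    have zz: "us ! 0 = Cst z \<longleftrightarrow> vs ! \<pi> 0 = Cst z" "us ! 1 = Cst z \<longleftrightarrow> vs ! \<pi> 1 = Cst z"
      using ab by auto
    have R: "red f us = (if Idem \<in> rs \<and> eq (us ! 0) (us ! 1) then us ! 0
         else if Nilp \<in> rs \<and> eq (us ! 0) (us ! 1) then Cst (lab zn)
         else if Unit \<in> rs \<and> us ! 1 = Cst z then us ! 0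
         else if Unit \<in> rs \<and> us ! 0 = Cst z then us ! 1
         else Fun f us)"
      using False True by (simp_all add: red_def)
    have "red f vs = (if Idem \<in> rs \<and> eq (vs ! 0) (vs ! 1) then vs ! 0
         else if Nilp \<in> rs \<and> eq (vs ! 0) (vs ! 1) then Cst (lab zn)
         else if Unit \<in> rs \<and> vs ! 1 = Cst z then vs ! 0
         else if Unit \<in> rs \<and> vs ! 0 = Cst z then vs ! 1
         else Fun f vs)"
      using nv True len by (simp add: red_def)
    note R = R this[unfolded e']
    show ?thesis
    \<comment> \<open>If the arguments are \<open>E\<close>-equal, it does not matter which of them
      a clause returns; otherwise at most one of them is \<open>0\<close>, and the two unit clauses
      do not overlap.\<close>
    proof (cases "eq (us ! 0) (us ! 1)")
      case True
      have u0: "eq (us ! 0) (vs ! 0)" using c ab True by (auto intro: eqv_trans)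
      have u1: "eq (us ! 1) (vs ! 1)" using c ab eqv_trans[OF eqv_sym[OF True]] by auto
      show ?thesis unfolding R
        using u0 u1 uv zz c by (auto simp: eqv_refl)
    next
      case False
      then show ?thesis unfolding R using c ab uv zz by (auto simp: eqv_refl)
    qed
  next
    case f: False
    have "red f us = Fun f us" "red f vs = Fun f vs"
      unfolding red_def using False nv f len by auto
    then show ?thesis using uv by simp
  qed
qed

fun nf :: "trm \<Rightarrow> trm" where
  "nf (Var x) = Var x"
| "nf (Fun f ts) = red f (map nf ts)"

lemma nf_eqv: "eq s t \<Longrightarrow> eq (nf s) (nf t)"
proof (induction rule: eqv.induct)
  case (Fun \<pi> f ts us)
  then show ?case using arg_perms_less[OF Fun.hyps(1)] by (auto intro!: red_cong[of \<pi>])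
qed (simp add: eqv_refl)

lemma lhs_zn: "Nilp \<in> rs \<or> Unit \<in> rs \<Longrightarrow> lhs zn = Cst z"
  using z node_len[of zn] by (auto simp: lhs_def)

text \<open>Left-hand sides start with symbols of \<open>F\<close>, so a label outside
  \<open>F\<close> matches no node. The only label inside \<open>F\<close> is \<open>0\<close>, and
  its node has the label \<open>0\<close> again.\<close>

lemma nf_lab: assumes "i \<in> I" shows "nf (Cst (lab i)) = Cst (lab i)"
proof (cases "lab i \<in> F")
  case True
  then have "Unit \<in> rs" "lab i = z" using lab_F assms by auto
  then show ?thesis using red_node[of zn z "[]"] lhs_zn z lab_z by (simp add: eqv_refl)
next
  case False
  have "\<not> eq (Cst (lab i)) (lhs j)" if "j \<in> I" for j
    using False node_sy[OF that] by (auto simp: lhs_def)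
  then show ?thesis by (auto simp: red_def)
qed

lemma nf_zero: "Nilp \<in> rs \<or> Unit \<in> rs \<Longrightarrow> nf (Cst z) = Cst (lab zn)"
  using red_node[of zn z "[]"] lhs_zn z by (simp add: eqv_refl)

lemma map_nf_lab: "i \<in> I \<Longrightarrow> map nf (map (\<lambda>j. Cst (lab j)) (ch i)) = map (\<lambda>j. Cst (lab j)) (ch i)"
  unfolding map_map using node_ch[of i] nf_lab by (intro map_cong) (auto simp del: nf.simps)

lemma nf_lhs: "i \<in> I \<Longrightarrow> nf (lhs i) = Cst (lab i)"
  using red_node[of i "sy i" "map (\<lambda>j. Cst (lab j)) (ch i)"]
  by (simp only: lhs_def eqv_refl nf.simps map_nf_lab)

lemma nf_tm: "i \<in> I \<Longrightarrow> nf (tm i) = Cst (lab i)"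
proof (induction i rule: node_induct)
  case (node i)
  have "map nf (map tm (ch i)) = map (\<lambda>j. Cst (lab j)) (ch i)" using node by simp
  then have "nf (tm i) = nf (lhs i)"
    by (simp only: node_tm[OF node(1)] map_nf_lab[OF node(1)] lhs_def nf.simps)
  then show ?case using nf_lhs[OF node(1)] by simp
qed

section \<open>The laws of the interpreted symbol in the algebra\<close>

lemma eq_lhs_pair:
  assumes "i \<in> I" and "eq (Fun g [u, v]) (lhs i)"
  shows "sy i = g \<and> (u = Cst (lab (ch i ! 0)) \<and> v = Cst (lab (ch i ! 1)) \<or>
    u = Cst (lab (ch i ! 1)) \<and> v = Cst (lab (ch i ! 0)))"
proof -
  from assms(2) obtain \<pi> where p: "sy i = g" "\<pi> \<in> arg_perms ar F E g 2" "length (ch i) = 2"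
    "\<And>k. k < 2 \<Longrightarrow> eq ([u, v] ! k) (map (\<lambda>j. Cst (lab j)) (ch i) ! \<pi> k)"
    unfolding lhs_def by (elim eqv_FunE) (auto simp: numeral_2_eq_2)
  have inj: "\<pi> 0 \<noteq> \<pi> 1" using permutes_inj[OF arg_perms_permutes[OF p(2)]] by (auto dest: injD)
  have lt: "\<pi> 0 < 2" "\<pi> 1 < 2" using arg_perms_less[OF p(2)] by auto
  have c: "\<pi> 0 = 0 \<and> \<pi> 1 = 1 \<or> \<pi> 0 = 1 \<and> \<pi> 1 = 0" using inj lt by linarith
  then show ?thesis using p(1) p(4)[of 0] p(4)[of 1] p(3) by auto
qed

text \<open>If the application matches a node, then \<open>a\<close> is the common label of both
  children, and the condition \<open>idem\<close> assigns the node that same label.\<close>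

lemma red_idem: assumes "Idem \<in> rs" shows "red g [a, a] = a"
proof (cases "\<exists>i\<in>I. eq (Fun g [a, a]) (lhs i)")
  case True
  then obtain i where i: "i \<in> I" "eq (Fun g [a, a]) (lhs i)" by blast
  then show ?thesis using eq_lhs_pair[OF i] red_node[OF i] idem[OF assms i(1)] by auto
next
  case False
  then show ?thesis using assms by (simp add: red_def eqv_refl)
qed

lemma red_nilp: assumes "Nilp \<in> rs" shows "red g [a, a] = Cst (lab zn)"
proof (cases "\<exists>i\<in>I. eq (Fun g [a, a]) (lhs i)")
  case True
  then obtain i where i: "i \<in> I" "eq (Fun g [a, a]) (lhs i)" by blast
  then show ?thesis using eq_lhs_pair[OF i] red_node[OF i] nilp[OF assms i(1)] by auto
next
  case False
  then show ?thesis using assms bin by (simp add: red_def eqv_refl)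
qed

text \<open>A matching node has a child labelled \<open>z\<close>, so \<open>unit_r\<close> or
  \<open>unit_l\<close> fixes its label. Without a match and with \<open>a\<close> equal to
  \<open>0\<close>, an earlier clause may apply; \<open>lab_z\<close> makes its result
  \<open>0\<close> as well.\<close>

lemma red_unit:
  assumes "Unit \<in> rs"
  shows "red g [a, Cst z] = a" and "red g [Cst z, a] = a"
proof -
  show "red g [a, Cst z] = a"
  proof (cases "\<exists>i\<in>I. eq (Fun g [a, Cst z]) (lhs i)")
    case True
    then obtain i where i: "i \<in> I" "eq (Fun g [a, Cst z]) (lhs i)" by blast
    then show ?thesis
      using eq_lhs_pair[OF i] red_node[OF i] unit_r[OF assms i(1)] unit_l[OF assms i(1)] by auto
  next
    case False
    then show ?thesis using assms lab_z by (simp add: red_def eqv_refl)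
  qed
  show "red g [Cst z, a] = a"
  proof (cases "\<exists>i\<in>I. eq (Fun g [Cst z, a]) (lhs i)")
    case True
    then obtain i where i: "i \<in> I" "eq (Fun g [Cst z, a]) (lhs i)" by blast
    then show ?thesis
      using eq_lhs_pair[OF i] red_node[OF i] unit_r[OF assms i(1)] unit_l[OF assms i(1)] by auto
  next
    case False
    then show ?thesis using assms lab_z by (simp add: red_def eqv_refl)
  qed
qed

lemma B_cases [consumes 1, case_names idem nilp unit_r unit_l]:
  assumes "(l, r) \<in> B"
  obtains "Idem \<in> rs" "l = Fun g [Var 1, Var 1]" "r = Var 1"
  | "Nilp \<in> rs" "l = Fun g [Var 1, Var 1]" "r = Cst z"
  | "Unit \<in> rs" "l = Fun g [Var 1, Cst z]" "r = Var 1"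
  | "Unit \<in> rs" "l = Fun g [Cst z, Var 1]" "r = Var 1"
  using assms unfolding B_eq kind_rules_def
  by (auto simp: idem_rules_def nilp_rules_def unit_rules_def split: if_splits)

lemma idem_in_B: "Idem \<in> rs \<Longrightarrow> (Fun g [Var 1, Var 1], Var 1) \<in> B"
  and nilp_in_B: "Nilp \<in> rs \<Longrightarrow> (Fun g [Var 1, Var 1], Cst z) \<in> B"
  and unit_r_in_B: "Unit \<in> rs \<Longrightarrow> (Fun g [Var 1, Cst z], Var 1) \<in> B"
  and unit_l_in_B: "Unit \<in> rs \<Longrightarrow> (Fun g [Cst z, Var 1], Var 1) \<in> B"
  by (auto simp: B_eq kind_rules_def idem_rules_def nilp_rules_def unit_rules_def)

lemma B_g: "(l, r) \<in> B \<Longrightarrow> g \<in> F \<and> ar g = 2"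
  using g by (elim B_cases) auto

text \<open>The algebra is a model up to \<open>E\<close>: variables enter only through the values
  of \<open>\<sigma>\<close>, so overlaps of rules with each other or with \<open>E\<close> need no
  separate treatment.\<close>

lemma nf_rule:
  assumes "(l, r) \<in> P \<union> D \<union> B \<union> E"
  shows "eq (nf (subst l \<sigma>)) (nf (subst r \<sigma>))"
proof -
  consider "(l, r) \<in> P" | "(l, r) \<in> D" | "(l, r) \<in> B" | "(l, r) \<in> E" using assms by blast
  then show ?thesis
  proof cases
    case 1
    then obtain i j where "i \<in> I" "j \<in> I" "tm i = l" "tm j = r" "lab i = lab j"
      using P_lab by blast
    then show ?thesis using nf_tm subst_ground[OF tm_ground] by (auto simp: eqv_refl)
  next
    case 2
    then obtain i where i: "i \<in> I" "l = lhs i" "r = Cst (lab i)" by (auto simp: D_def)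
    have "subst (lhs i) \<sigma> = lhs i" by (rule subst_ground) (auto simp: lhs_def)
    then show ?thesis using nf_lhs[OF i(1)] nf_lab[OF i(1)] i by (simp add: eqv_refl)
  next
    case 3
    then show ?thesis
    proof (cases rule: B_cases)
      case idem
      then show ?thesis by (simp add: red_idem eqv_refl)
    next
      case nilp
      then show ?thesis using red_nilp nf_zero by (simp add: eqv_refl)
    next
      case unit_r
      then show ?thesis using red_unit nf_zero lab_z by (simp add: eqv_refl)
    next
      case unit_l
      then show ?thesis using red_unit nf_zero lab_z by (simp add: eqv_refl)
    qed
  next
    case 4
    then show ?thesis using nf_eqv eqv_perm_eqn E_perm by blast
  qed
qed

text \<open>With \<open>D\<close>, \<open>B\<close> and \<open>E\<close> this gives convergence,
  with \<open>P\<close>, \<open>B\<close> and \<open>E\<close> completeness.\<close>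

lemma nf_eqth:
  assumes "(s, t) \<in> eqth U X" and "X \<subseteq> P \<union> D \<union> B \<union> E"
  shows "eq (nf s) (nf t)"
proof (rule eqth_induct_steps[where Q = "\<lambda>s t. eq (nf s) (nf t)", OF assms(1)])
  fix s t assume "(s, t) \<in> rstep U X"
  then obtain p l r \<sigma> where h: "p \<in> poss s" "(l, r) \<in> X" "subt_at s p = subst l \<sigma>"
    "t = replace_at s p (subst r \<sigma>)" unfolding rstep_def by blast
  have "eq (nf (subt_at s p)) (nf (subst r \<sigma>))" using nf_rule[of l r] h assms(2) by auto
  then show "eq (nf s) (nf t)" unfolding h(4)
  proof (rule replace_at_induct[where Q = "\<lambda>s t. eq (nf s) (nf t)", OF h(1)])
    fix f ts i v
    assume "i < length ts" "eq (nf (ts ! i)) (nf v)"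
    then show "eq (nf (Fun f ts)) (nf (Fun f (ts[i := v])))"
      by (auto intro!: red_cong[of id] arg_perms_id simp: nth_list_update eqv_refl)
  qed
qed (rule eqv_refl, erule eqv_sym, erule (1) eqv_trans)

section \<open>Values in the algebra are reached by rewriting\<close>

lemma D_in: "i \<in> I \<Longrightarrow> sy i \<noteq> lab i \<Longrightarrow> (lhs i, Cst (lab i)) \<in> D"
  by (auto simp: D_def)

lemma lab_in_T: "i \<in> I \<Longrightarrow> Cst (lab i) \<in> T"
  by (auto simp: K_def Fun_in_terms_iff)

text \<open>One step, or none if the node is \<open>0\<close> labelled by itself and therefore has
  no rule.\<close>

lemma lhs_step:
  assumes "i \<in> I" and "eq (Fun f us) (lhs i)" and "Fun f us \<in> T" and "D \<subseteq> X"
  shows "(Fun f us, Cst (lab i)) \<in> (rstep_mod T X E)\<^sup>*"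
proof (cases "sy i = lab i")
  case True
  then have "sy i = z" "Unit \<in> rs" using lab_F[OF assms(1)] node_sy[OF assms(1)] by auto
  then have "lhs i = Cst (lab i)" using True z node_len[OF assms(1)] by (auto simp: lhs_def)
  then show ?thesis using assms(2) by simp
next
  case False
  have "subst (lhs i) \<sigma> = lhs i" for \<sigma> by (rule subst_ground) (auto simp: lhs_def)
  then have "(Fun f us, subst (Cst (lab i)) Var) \<in> rstep_mod T X E"
    using assms D_in[OF assms(1) False] lab_in_T[OF assms(1)] by (intro root_rstep_mod[of "lhs i"]) auto
  then show ?thesis by auto
qed

text \<open>Joinability requires the values to be reachable, not merely convertible, so each clause
  of \<open>red\<close> is realised by steps of \<open>R,E\<close>.\<close>

lemma red_step:
  assumes T: "Fun f us \<in> T"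
  shows "(Fun f us, red f us) \<in> (rstep_mod T (D \<union> B) E)\<^sup>*"
proof (cases "\<exists>i\<in>I. eq (Fun f us) (lhs i)")
  case True
  then obtain i where i: "i \<in> I" "eq (Fun f us) (lhs i)" by blast
  then show ?thesis using lhs_step[OF i T] red_node[OF i] by simp
next
  case False
  show ?thesis
  proof (cases "f = g \<and> length us = 2")
    case True
    then obtain u v where us: "us = [u, v]" by (auto simp: numeral_2_eq_2 length_Suc_conv)
    have uv: "u \<in> T" "v \<in> T" using nth_in_terms[OF T, of 0] nth_in_terms[OF T, of 1] us by auto
    have R: "red f us = (if Idem \<in> rs \<and> eq u v then u
         else if Nilp \<in> rs \<and> eq u v then Cst (lab zn)
         else if Unit \<in> rs \<and> v = Cst z then u
         else if Unit \<in> rs \<and> u = Cst z then v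
         else Fun f us)"
      using False True us by (simp add: red_def)
    have step: "(Fun f us, subst r \<sigma>) \<in> (rstep_mod T (D \<union> B) E)\<^sup>*"
      if "(l, r) \<in> B" "eq (Fun f us) (subst l \<sigma>)" "subst r \<sigma> \<in> T" for l r \<sigma>
      using root_rstep_mod[of l r "D \<union> B"] that T by auto
    \<comment> \<open>The left-hand sides for idempotency and nilpotency are non-linear; matching
      modulo \<open>E\<close> lets them apply to arguments that are only
      \<open>E\<close>-equal.\<close>
    have e: "eq (Fun g [u, v]) (Fun g [u, u])" if "eq u v"
      using that by (intro eqv_args) (auto simp: less_Suc_eq eqv_refl intro: eqv_sym)
    consider "Idem \<in> rs" "eq u v" | "Idem \<notin> rs" "Nilp \<in> rs" "eq u v" | "\<not> (Idem \<in> rs \<and> eq u v)" "\<not> (Nilp \<in> rs \<and> eq u v)" "Unit \<in> rs" "v = Cst z"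
      | "\<not> (Idem \<in> rs \<and> eq u v)" "\<not> (Nilp \<in> rs \<and> eq u v)" "\<not> (Unit \<in> rs \<and> v = Cst z)" "Unit \<in> rs" "u = Cst z"
      | "\<not> (Idem \<in> rs \<and> eq u v)" "\<not> (Nilp \<in> rs \<and> eq u v)" "\<not> (Unit \<in> rs \<and> v = Cst z)" "\<not> (Unit \<in> rs \<and> u = Cst z)" by blast
    then show ?thesis
    proof cases
      case 1
      then have "red f us = u" by (simp add: R)
      with 1 show ?thesis
        using step[OF idem_in_B, of "\<lambda>_. u"] e uv True us by simp
    next
      case 2
      then have red: "red f us = Cst (lab zn)" by (simp add: R)
      have zT: "Cst z \<in> T" using z 2 by (auto simp: Fun_in_terms_iff)
      have "(Fun f us, Cst z) \<in> (rstep_mod T (D \<union> B) E)\<^sup>*"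
        using 2 step[OF nilp_in_B, of "\<lambda>_. u"] e zT True us by simp
      \<comment> \<open>The rule of \<open>B\<close> ends in \<open>0\<close>, whereas the value is
        the label of the node of \<open>0\<close>.\<close>
      moreover have "(Cst z, Cst (lab zn)) \<in> (rstep_mod T (D \<union> B) E)\<^sup>*"
        using lhs_step[of zn z "[]"] z lhs_zn 2 zT by (simp add: eqv_refl)
      ultimately show ?thesis using red by simp
    next
      case 3
      then have "red f us = u" using lab_z by (simp add: R)
      with 3 show ?thesis
        using step[OF unit_r_in_B, of "\<lambda>_. u"] uv True us by (simp add: eqv_refl)
    next
      case 4
      then have "red f us = v" using lab_z by (simp add: R)
      with 4 show ?thesis
        using step[OF unit_l_in_B, of "\<lambda>_. v"] uv True us by (simp add: eqv_refl)
    next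
      case 5
      then show ?thesis by (auto simp: R)
    qed
  next
    case f: False
    then have "red f us = Fun f us" unfolding red_def using False by auto
    then show ?thesis by simp
  qed
qed

lemma nf_steps: "t \<in> T \<Longrightarrow> (t, nf t) \<in> (rstep_mod T (D \<union> B) E)\<^sup>*"
proof (induction t)
  case (Fun f ts)
  have "(ts ! i, map nf ts ! i) \<in> (rstep_mod T (D \<union> B) E)\<^sup>*" if "i < length ts" for i
    using Fun.IH[of "ts ! i"] nth_in_terms[OF Fun.prems that] that by auto
  then have a: "(Fun f ts, Fun f (map nf ts)) \<in> (rstep_mod T (D \<union> B) E)\<^sup>*"
    using Fun.prems by (intro ctx_closed_rtrancl_args[OF rstep_mod_ctx_closed]) auto
  have "Fun f (map nf ts) \<in> T" using ctx_closed_rtrancl_in[OF rstep_mod_ctx_closed a Fun.prems] .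
  from rtrancl_trans[OF a red_step[OF this]] show ?case by simp
qed simp

lemma nf_in_T: "t \<in> T \<Longrightarrow> nf t \<in> T"
  using ctx_closed_rtrancl_in[OF rstep_mod_ctx_closed nf_steps] by blast

lemma nf_joinable:
  assumes "s \<in> T" and "t \<in> T" and "eq (nf s) (nf t)"
  shows "(s, nf s) \<in> (rstep_mod T (D \<union> B) E)\<^sup>* \<and> (nf s, nf t) \<in> eqth T E \<and>
    (t, nf t) \<in> (rstep_mod T (D \<union> B) E)\<^sup>*"
  using nf_steps assms eqv_imp_eqth[OF subset_refl assms(3) nf_in_T[OF assms(1)]] by blast

lemma vars_red: "vars (red f us) \<subseteq> vars (Fun f us)"
  by (auto simp: red_def numeral_2_eq_2 length_Suc_conv split: if_splits)

lemma vars_nf: "vars (nf t) \<subseteq> vars t"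
proof (induction t)
  case (Fun f ts)
  then show ?case using vars_red[of f "map nf ts"] by fastforce
qed simp

text \<open>Uses \<open>D\<close> alone, because the condition that every constant stands for a term
  refers to \<open>R\<close> without \<open>B\<close>.\<close>

lemma tm_steps: "i \<in> I \<Longrightarrow> (tm i, Cst (lab i)) \<in> (rstep_mod T D E)\<^sup>*"
proof (induction i rule: node_induct)
  case (node i)
  have "(Fun (sy i) (map tm (ch i)), lhs i) \<in> (rstep_mod T D E)\<^sup>*"
    unfolding lhs_def using node tm_in_T[OF node(1)] node_tm[OF node(1)]
    by (intro ctx_closed_rtrancl_args[OF rstep_mod_ctx_closed]) auto
  moreover have "(lhs i, Cst (lab i)) \<in> (rstep_mod T D E)\<^sup>*"
    using lhs_step[OF node(1) _ _ subset_refl] lhs_in_T[OF node(1)] eqv_refl by (auto simp: lhs_def)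
  ultimately show ?case using node_tm[OF node(1)] by simp
qed

subsection \<open>Termination\<close>

text \<open>Elements of \<open>K\<close> weigh less than other symbols, so that
  \<open>D\<close>-rules for constants decrease as well.\<close>

fun wt :: "trm \<Rightarrow> nat" where
  "wt (Var x) = 1"
| "wt (Fun f ts) = (if f \<in> K then 1 else 2) + (\<Sum>t\<leftarrow>ts. wt t)"

lemma wt_pos: "wt t > 0"
  by (cases t) auto

text \<open>Termination is demanded on classes modulo \<open>E\<close>; permuting arguments only
  rearranges the summands.\<close>

lemma wt_eqv: "eq s t \<Longrightarrow> wt s = wt t"
proof (induction rule: eqv.induct)
  case (Fun \<pi> f ts us)
  have "(\<Sum>t\<leftarrow>ts. wt t) = (\<Sum>i<length ts. wt (us ! \<pi> i))"
    using Fun.IH by (simp add: sum_list_sum_nth atLeast0LessThan)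
  also have "\<dots> = (\<Sum>i<length ts. wt (us ! i))"
    using sum.permute[OF arg_perms_permutes[OF Fun.hyps(1)], of "\<lambda>i. wt (us ! i)"] by (simp add: comp_def)
  also have "\<dots> = (\<Sum>t\<leftarrow>us. wt t)"
    using Fun.hyps by (simp add: sum_list_sum_nth atLeast0LessThan)
  finally show ?case by simp
qed simp

lemma wt_update:
  assumes "i < length ts" and "wt v < wt (ts ! i)"
  shows "wt (Fun f (ts[i := v])) < wt (Fun f ts)"
proof -
  have "ts ! i \<in> set ts" using assms by simp
  then have "wt (ts ! i) \<le> (\<Sum>t\<leftarrow>ts. wt t)" by (intro member_le_sum_list) auto
  then show ?thesis using assms by (simp add: map_update sum_list_update)
qed

lemma wt_rule:
  assumes "(l, r) \<in> D \<union> B"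
  shows "wt (subst r \<sigma>) < wt (subst l \<sigma>)"
proof (cases "(l, r) \<in> D")
  case True
  then obtain i where i: "i \<in> I" "sy i \<noteq> lab i" "l = lhs i" "r = Cst (lab i)" by (auto simp: D_def)
  \<comment> \<open>A symbol in both \<open>F\<close> and \<open>K\<close> is \<open>0\<close>; then
    node \<open>i\<close> is congruent to \<open>zn\<close> and has the label \<open>z\<close>,
    which the side condition of \<open>D\<close> excludes.\<close>
  have "sy i \<notin> K"
  proof
    assume "sy i \<in> K"
    then have bz: "Unit \<in> rs" "sy i = z" using K_F node_sy[OF i(1)] by auto
    then have "lab i = lab zn" using z i by (intro cong[of i zn id]) (auto simp: arg_perms_id)
    then show False using lab_z bz i(2) by simp
  qed
  moreover have "lab i \<in> K" using i(1) by (simp add: K_def)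
  ultimately show ?thesis using i by (simp add: lhs_def)
next
  case False
  then have B: "(l, r) \<in> B" using assms by simp
  \<comment> \<open>The only symbol of \<open>F\<close> that can lie in \<open>K\<close> is the
    constant \<open>0\<close>, but \<open>g\<close> is binary.\<close>
  have g': "g \<notin> K" using B_g[OF B] K_F[of g] z by auto
  from B show ?thesis
  proof (cases rule: B_cases)
    case nilp
    \<comment> \<open>\<open>g\<close> contributes 2 and its arguments at least 2, while
      \<open>0\<close> weighs at most 2.\<close>
    then show ?thesis using wt_pos[of "\<sigma> 1"] g' by simp
  qed (use g' in simp_all)
qed

lemma wt_rstep:
  assumes "(s, t) \<in> rstep U (D \<union> B)"
  shows "wt t < wt s"
proof -
  from assms obtain p l r \<sigma> where h: "p \<in> poss s" "(l, r) \<in> D \<union> B" "subt_at s p = subst l \<sigma>"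
    "t = replace_at s p (subst r \<sigma>)" unfolding rstep_def by blast
  have "wt (subst r \<sigma>) < wt (subt_at s p)" using wt_rule[OF h(2)] h(3) by simp
  then show ?thesis unfolding h(4)
    by (rule replace_at_induct[where Q = "\<lambda>s t. wt t < wt s", OF h(1)]) (rule wt_update)
qed

lemma wf_rstep_class: "wf ((rstep_class T (D \<union> B) E)\<inverse>)"
proof (rule wf_subset[OF wf_measure[of wt]], clarify)
  fix t s assume "(s, t) \<in> rstep_class T (D \<union> B) E"
  then obtain s' t' where st: "(s, s') \<in> eqth T E" "(s', t') \<in> rstep T (D \<union> B)" "(t', t) \<in> eqth T E"
    unfolding rstep_class_def by blast
  have "wt s = wt s'" "wt t' = wt t"
    using wt_eqv eqth_imp_eqv[OF E_perm st(1)] eqth_imp_eqv[OF E_perm st(3)] by auto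
  then show "(t, s) \<in> measure wt" using wt_rstep[OF st(2)] by simp
qed

subsection \<open>Soundness\<close>

text \<open>Replacing every new constant by a term it stands for turns rewrite steps into equations
  that follow from \<open>P\<close>, \<open>B\<close> and \<open>E\<close>.\<close>

abbreviation Q :: "trm rel" where "Q \<equiv> eqth T0 (P \<union> B \<union> E)"

definition rep :: "nat \<Rightarrow> nat" where "rep c = (SOME i. i \<in> I \<and> lab i = c)"

lemma rep: "c \<in> K \<Longrightarrow> rep c \<in> I \<and> lab (rep c) = c"
  unfolding rep_def K_def by (rule someI_ex) auto

text \<open>Only constants outside \<open>F\<close> are replaced, so a \<open>0\<close> shared by
  \<open>F\<close> and \<open>K\<close> is kept and terms over \<open>F\<close> are fixed.\<close>

fun ext :: "trm \<Rightarrow> trm" where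
  "ext (Var x) = Var x"
| "ext (Fun f ts) = (if ts = [] \<and> f \<in> K - F then tm (rep f) else Fun f (map ext ts))"

lemma ext_in_T0: "t \<in> T \<Longrightarrow> ext t \<in> T0"
proof (induction t)
  case (Fun f ts)
  show ?case
  proof (cases "ts = [] \<and> f \<in> K - F")
    case True
    then show ?thesis using tm_in_T0 rep by auto
  next
    case False
    with Fun.prems have a: "f \<in> F" "length ts = ar f" "set ts \<subseteq> T" if "ts \<noteq> []"
      using that by (auto simp: Fun_in_terms_iff)
    have b: "f \<in> F \<and> ar f = 0" if "ts = []"
      using that False Fun.prems K_F[of f] z by (auto simp: Fun_in_terms_iff)
    have "t \<in> T" if "t \<in> set ts" for t using a that by (cases "ts = []") auto
    then have "set (map ext ts) \<subseteq> T0" using Fun.IH by auto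
    then show ?thesis using False a b by (cases "ts = []") (auto simp: Fun_in_terms_iff)
  qed
qed simp

lemma ext_id: "t \<in> T0 \<Longrightarrow> ext t = t"
proof (induction t)
  case (Fun f ts)
  have "map ext ts = ts" using Fun.IH nth_in_terms[OF Fun.prems] by (intro nth_equalityI) auto
  then show ?case using Fun.prems by (auto simp: Fun_in_terms_iff)
qed simp

lemma ext_lab:
  assumes "i \<in> I"
  shows "(ext (Cst (lab i)), tm i) \<in> Q"
proof (cases "lab i \<in> F")
  case True
  then have bz: "Unit \<in> rs" "lab i = z" using lab_F assms by auto
  then have "ch zn = []" using z node_len[of zn] by simp
  then have "tm zn = Cst z" using node_tm[of zn] z bz by simp
  moreover have "(tm zn, tm i) \<in> Q" using sound[of zn i] assms bz lab_z z by simp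
  ultimately show ?thesis using bz z by simp
next
  case False
  have "lab i \<in> K" using assms by (simp add: K_def)
  then show ?thesis using False sound[of "rep (lab i)" i] rep[of "lab i"] assms by simp
qed

lemma ext_lhs:
  assumes "i \<in> I"
  shows "(ext (lhs i), tm i) \<in> Q"
proof -
  have "ext (lhs i) = Fun (sy i) (map (\<lambda>j. ext (Cst (lab j))) (ch i))"
    using node_sy[OF assms] by (auto simp: lhs_def)
  moreover have "(Fun (sy i) (map (\<lambda>j. ext (Cst (lab j))) (ch i)), Fun (sy i) (map tm (ch i))) \<in> Q"
  proof (rule eqth_args)
    show "Fun (sy i) (map (\<lambda>j. ext (Cst (lab j))) (ch i)) \<in> T0"
      using ext_in_T0[OF lhs_in_T[OF assms]] calculation by simp
    fix k assume "k < length (map (\<lambda>j. ext (Cst (lab j))) (ch i))"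
    then have k: "k < length (ch i)" by simp
    then have "ch i ! k \<in> I" using node_ch[OF assms] nth_mem by blast
    then show "(map (\<lambda>j. ext (Cst (lab j))) (ch i) ! k, map tm (ch i) ! k) \<in> Q"
      using ext_lab[of "ch i ! k"] k by simp
  qed simp
  ultimately show ?thesis using node_tm[OF assms] by simp
qed

lemma ext_eqv: "eq s t \<Longrightarrow> eq (ext s) (ext t)"
proof (induction rule: eqv.induct)
  case (Fun \<pi> f ts us)
  show ?case
  proof (cases "ts = [] \<and> f \<in> K - F")
    case True
    then show ?thesis using Fun.hyps by (simp add: eqv_refl)
  next
    case False
    then have "\<not> (us = [] \<and> f \<in> K - F)" using Fun.hyps by auto
    moreover have "eq (Fun f (map ext ts)) (Fun f (map ext us))"
      using Fun.hyps Fun.IH arg_perms_less[OF Fun.hyps(1)] by (intro eqv.Fun[of \<pi>]) auto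
    moreover have "ext (Fun f ts) = Fun f (map ext ts)" "ext (Fun f us) = Fun f (map ext us)"
      using False calculation(1) by auto
    ultimately show ?thesis by simp
  qed
qed (simp add: eqv_refl)

lemma ext_eqv_Q: "eq s t \<Longrightarrow> s \<in> T \<Longrightarrow> (ext s, ext t) \<in> Q"
  by (rule eqv_imp_eqth[OF _ ext_eqv ext_in_T0]) auto

lemma ext_rule:
  assumes "(l, r) \<in> D \<union> B" and T: "subst l \<sigma> \<in> T" "subst r \<sigma> \<in> T"
  shows "(ext (subst l \<sigma>), ext (subst r \<sigma>)) \<in> Q"
proof (cases "(l, r) \<in> D")
  case True
  then obtain i where i: "i \<in> I" "l = lhs i" "r = Cst (lab i)" by (auto simp: D_def)
  have "subst (lhs i) \<sigma> = lhs i" by (rule subst_ground) (auto simp: lhs_def)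
  then have "subst l \<sigma> = lhs i" "subst r \<sigma> = Cst (lab i)" using i by auto
  then show ?thesis using eqth_trans[OF ext_lhs[OF i(1)] eqth_sym[OF ext_lab[OF i(1)]]] by simp
next
  case False
  then have B: "(l, r) \<in> B" using assms by simp
  \<comment> \<open>The only constant occurring in rules of \<open>B\<close> is \<open>0\<close>,
    which \<open>ext\<close> leaves alone, so \<open>ext\<close> commutes with
    instantiation.\<close>
  then have "ext (subst l \<sigma>) = subst l (ext \<circ> \<sigma>) \<and> ext (subst r \<sigma>) = subst r (ext \<circ> \<sigma>)"
    by (cases rule: B_cases) (use z in auto)
  moreover have "ext (subst l \<sigma>) \<in> T0" "ext (subst r \<sigma>) \<in> T0" using T ext_in_T0 by auto
  ultimately show ?thesis using eqth_rule[of l r "P \<union> B \<union> E" "ext \<circ> \<sigma>" T0] B by simp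
qed

lemma ext_step:
  assumes "(s, t) \<in> rstep_mod T (D \<union> B) E"
  shows "(ext s, ext t) \<in> Q"
proof -
  from assms obtain p l r \<sigma> where h: "p \<in> poss s" "(l, r) \<in> D \<union> B"
    "(subt_at s p, subst l \<sigma>) \<in> eqth T E" "t = replace_at s p (subst r \<sigma>)" "s \<in> T" "t \<in> T"
    unfolding rstep_mod_def by blast
  have sub: "subt_at s p \<in> T" using subt_at_in_terms h by blast
  have l: "subst l \<sigma> \<in> T" using eqth_in[OF h(3) sub] .
  have r: "subst r \<sigma> \<in> T" using replace_at_in_terms_iff[OF h(5,1)] h by blast
  have "(ext (subt_at s p), ext (subst r \<sigma>)) \<in> Q"
    using ext_eqv_Q[OF eqth_imp_eqv[OF E_perm h(3)] sub] ext_rule[OF h(2) l r] by (rule eqth_trans)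
  then have "s \<in> T \<longrightarrow> t \<in> T \<longrightarrow> (ext s, ext t) \<in> Q"
    unfolding h(4)
  proof (intro replace_at_induct[where Q = "\<lambda>s t. s \<in> T \<longrightarrow> t \<in> T \<longrightarrow> (ext s, ext t) \<in> Q", OF h(1)])
    fix f ts i v
    assume i: "i < length ts" and IH: "ts ! i \<in> T \<longrightarrow> v \<in> T \<longrightarrow> (ext (ts ! i), ext v) \<in> Q"
    show "Fun f ts \<in> T \<longrightarrow> Fun f (ts[i := v]) \<in> T \<longrightarrow> (ext (Fun f ts), ext (Fun f (ts[i := v]))) \<in> Q"
    proof (intro impI)
      assume T: "Fun f ts \<in> T" "Fun f (ts[i := v]) \<in> T"
      have "(ext (ts ! i), ext v) \<in> Q"
        using IH nth_in_terms[OF T(1) i] nth_in_terms[OF T(2), of i] i by simp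
      moreover have "ext (Fun f ts) = Fun f (map ext ts)"
        "ext (Fun f (ts[i := v])) = Fun f (map ext (ts[i := v]))" using i by auto
      moreover have "Fun f (map ext ts) \<in> T0" using ext_in_T0[OF T(1)] calculation by simp
      ultimately show "(ext (Fun f ts), ext (Fun f (ts[i := v]))) \<in> Q"
        using i by (auto intro!: eqth_args simp: nth_list_update)
    qed
  qed simp
  then show ?thesis using h by blast
qed

lemma ext_steps: "(s, t) \<in> (rstep_mod T (D \<union> B) E)\<^sup>* \<Longrightarrow> (ext s, ext t) \<in> Q"
  by (induction rule: rtrancl_induct) (auto intro: eqth_trans ext_step)

text \<open>\<open>nf s\<close> and \<open>nf t\<close> are the joining terms for both convergence
  and completeness; soundness translates the joining steps back by \<open>ext\<close>, which fixes
  \<open>s\<close> and \<open>t\<close>.\<close>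

theorem closure: "cong_closure_mod ar F E B P K D {}"
proof -
  have K_unit: "K \<inter> F \<subseteq> unit_consts B"
    using K_F by (fastforce simp: unit_consts_def B_eq kind_rules_def)
  have D_rules: "D \<subseteq> D_rules ar F K"
  proof
    fix e assume "e \<in> D"
    then obtain i where i: "i \<in> I" "e = (lhs i, Cst (lab i))" by (auto simp: D_def)
    have "e = (Fun (sy i) (map Cst (map lab (ch i))), Cst (lab i))"
      using i by (simp add: lhs_def comp_def)
    moreover have "sy i \<in> F" "length (map lab (ch i)) = ar (sy i)" "set (map lab (ch i)) \<subseteq> K"
      "lab i \<in> K" using i node[of i] by (auto simp: K_def)
    ultimately show "e \<in> D_rules ar F K" unfolding D_rules_def by blast
  qed
  have reach: "\<exists>t\<in>gterms ar F {}. (t, Cst c) \<in> conversion (rstep_mod T (D \<union> {}) E)" if c: "c \<in> K" for c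
  proof -
    obtain i where i: "i \<in> I" "c = lab i" using c by (auto simp: K_def)
    have "(tm i, Cst c) \<in> conversion (rstep_mod T (D \<union> {}) E)"
      using tm_steps[OF i(1)] i(2) rtrancl_mono[OF Un_upper1]
      unfolding conversion_def by auto
    moreover have "tm i \<in> gterms ar F {}" using tm_in_T0[OF i(1)] tm_ground[OF i(1)] by (simp add: gterms_def)
    ultimately show ?thesis by blast
  qed
  have conv: "convergent_mod T (D \<union> {} \<union> B) E"
    unfolding convergent_mod_def
  proof (intro conjI ballI impI)
    show "wf ((rstep_class T (D \<union> {} \<union> B) E)\<inverse>)" using wf_rstep_class by simp
    fix s t assume st: "s \<in> T" "t \<in> T" "(s, t) \<in> eqth T (D \<union> {} \<union> B \<union> E)"
    then have "eq (nf s) (nf t)" by (elim nf_eqth) auto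
    from nf_joinable[OF st(1,2) this]
    show "\<exists>u v. (s, u) \<in> (rstep_mod T (D \<union> {} \<union> B) E)\<^sup>* \<and> (u, v) \<in> eqth T E \<and>
        (t, v) \<in> (rstep_mod T (D \<union> {} \<union> B) E)\<^sup>*" by auto
  qed
  have "(s, t) \<in> Q \<longleftrightarrow> (\<exists>u\<in>gterms ar F K. \<exists>v\<in>gterms ar F K.
      (s, u) \<in> (rstep_mod T (D \<union> {} \<union> B) E)\<^sup>* \<and> (u, v) \<in> eqth T E \<and>
      (t, v) \<in> (rstep_mod T (D \<union> {} \<union> B) E)\<^sup>*)" (is "_ \<longleftrightarrow> ?R")
    if st: "s \<in> gterms ar F {}" "t \<in> gterms ar F {}" for s t
  proof
    have T0: "s \<in> T0" "t \<in> T0" and gr: "vars s = {}" "vars t = {}" using st by (auto simp: gterms_def)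
    then have T: "s \<in> T" "t \<in> T" using terms_mono by blast+
    show ?R if "(s, t) \<in> Q"
    proof -
      have "eq (nf s) (nf t)" using that by (rule nf_eqth) auto
      note j = nf_joinable[OF T this]
      have "nf s \<in> gterms ar F K" "nf t \<in> gterms ar F K"
        using nf_in_T T vars_nf[of s] vars_nf[of t] gr by (auto simp: gterms_def)
      with j show ?thesis by auto
    qed
    show "(s, t) \<in> Q" if ?R
    proof -
      from that obtain u v where uv: "u \<in> gterms ar F K" "(s, u) \<in> (rstep_mod T (D \<union> B) E)\<^sup>*"
        "(u, v) \<in> eqth T E" "(t, v) \<in> (rstep_mod T (D \<union> B) E)\<^sup>*" by auto
      have "(ext s, ext u) \<in> Q" "(ext t, ext v) \<in> Q" using ext_steps uv by auto
      moreover have "(ext u, ext v) \<in> Q"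
        using ext_eqv_Q[OF eqth_imp_eqv[OF E_perm uv(3)]] uv(1) by (simp add: gterms_def)
      ultimately have "(ext s, ext t) \<in> Q" by (meson eqth_sym eqth_trans)
      then show ?thesis using ext_id T0 by simp
    qed
  qed
  then show ?thesis
    unfolding cong_closure_mod_def Let_def
    using fin K_unit D_rules reach conv by (auto simp: K_def[symmetric]) (simp add: K_def)
qed

end

section \<open>Running programs\<close>

text \<open>Total correctness with a time bound. As \<open>n\<close> need not be exact, both
  branches of a conditional can be given the same bound.\<close>

definition runs :: "cmd \<Rightarrow> state \<Rightarrow> nat \<Rightarrow> (state \<Rightarrow> bool) \<Rightarrow> bool" where
  "runs c s n Q \<longleftrightarrow> (\<exists>t s'. exec c s t s' \<and> t \<le> n \<and> Q s')"

lemma runs_exec: "exec c s t s' \<Longrightarrow> t \<le> n \<Longrightarrow> Q s' \<Longrightarrow> runs c s n Q"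
  unfolding runs_def by blast

lemma runs_Seq:
  assumes "runs c1 s n1 Q1" and "\<And>s'. Q1 s' \<Longrightarrow> runs c2 s' n2 Q"
  shows "runs (Seq c1 c2) s (n1 + n2) Q"
  using assms unfolding runs_def by (meson add_mono exec.Seq)

lemma runs_conseq: "runs c s n Q \<Longrightarrow> n \<le> n' \<Longrightarrow> (\<And>s'. Q s' \<Longrightarrow> Q' s') \<Longrightarrow> runs c s n' Q'"
  unfolding runs_def using le_trans by blast

lemma runs_Cond:
  assumes "val b s \<noteq> 0 \<Longrightarrow> runs c1 s n Q" and "val b s = 0 \<Longrightarrow> runs c2 s n Q"
  shows "runs (Cond b c1 c2) s (1 + cost b + n) Q"
proof (cases "val b s = 0")
  case True
  with assms(2) obtain t s' where "exec c2 s t s'" "t \<le> n" "Q s'" unfolding runs_def by blast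
  then show ?thesis using CondFalse[OF True] unfolding runs_def by (meson add_left_mono)
next
  case False
  with assms(1) obtain t s' where "exec c1 s t s'" "t \<le> n" "Q s'" unfolding runs_def by blast
  then show ?thesis using CondTrue[OF False] unfolding runs_def by (meson add_left_mono)
qed

text \<open>The method of potentials: an iteration pays for its test and body out of the drop of
  \<open>\<Phi>\<close>, which also proves termination. The cost \<open>n\<close> may vary between
  iterations, as it does in saturation with its cheap advances and expensive merges.\<close>

lemma runs_While:
  assumes "Inv s"
    and step: "\<And>s. Inv s \<Longrightarrow> val b s \<noteq> 0 \<Longrightarrow>
      \<exists>n. runs c s n (\<lambda>s'. Inv s' \<and> 1 + cost b + n + \<Phi> s' \<le> \<Phi> s)"
  shows "runs (While b c) s (\<Phi> s + 1 + cost b) (\<lambda>s'. Inv s' \<and> val b s' = 0)"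
  using assms(1)
proof (induction "\<Phi> s" arbitrary: s rule: less_induct)
  case less
  show ?case
  proof (cases "val b s = 0")
    case True
    then show ?thesis using less.prems True
      by (intro runs_exec[OF WhileFalse[OF True, of c]]) auto
  next
    case False
    from step[OF less.prems False] obtain n t s' where 1: "exec c s t s'" "t \<le> n" "Inv s'"
      "1 + cost b + n + \<Phi> s' \<le> \<Phi> s" unfolding runs_def by blast
    then have "\<Phi> s' < \<Phi> s" by simp
    from less.hyps[OF this 1(3)] obtain t' s'' where 2: "exec (While b c) s' t' s''"
      "t' \<le> \<Phi> s' + 1 + cost b" "Inv s''" "val b s'' = 0" unfolding runs_def by blast
    have "exec (While b c) s (1 + cost b + t + t') s''" using WhileTrue[OF False 1(1) 2(1)] .
    moreover have "1 + cost b + t + t' \<le> \<Phi> s + 1 + cost b" using 1 2 by simp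
    ultimately show ?thesis using 2 unfolding runs_def by blast
  qed
qed

section \<open>Symbolic execution of loop-free code\<close>

fun loopfree :: "cmd \<Rightarrow> bool" where
  "loopfree (Seq c1 c2) \<longleftrightarrow> loopfree c1 \<and> loopfree c2"
| "loopfree (Cond b c1 c2) \<longleftrightarrow> loopfree c1 \<and> loopfree c2"
| "loopfree (While b c) \<longleftrightarrow> False"
| "loopfree _ \<longleftrightarrow> True"

fun sem :: "cmd \<Rightarrow> state \<Rightarrow> state" where
  "sem Skip s = s"
| "sem (Assign r a) s = ((fst s)(r := val a s), snd s)"
| "sem (Store a b) s = (fst s, (snd s)(val a s := val b s))"
| "sem (Seq c1 c2) s = sem c2 (sem c1 s)"
| "sem (Cond b c1 c2) s = (if val b s = 0 then sem c2 s else sem c1 s)"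
| "sem (While b c) s = s"

fun max_cost :: "cmd \<Rightarrow> nat" where
  "max_cost Skip = 1"
| "max_cost (Assign r a) = 1 + cost a"
| "max_cost (Store a b) = 1 + cost a + cost b"
| "max_cost (Seq c1 c2) = max_cost c1 + max_cost c2"
| "max_cost (Cond b c1 c2) = 1 + cost b + max (max_cost c1) (max_cost c2)"
| "max_cost (While b c) = 0"

text \<open>Reduces loop-free code to evaluating the function \<open>sem\<close>, with a cost bound
  independent of the state.\<close>

lemma runs_loopfree: "loopfree c \<Longrightarrow> runs c s (max_cost c) (\<lambda>s'. s' = sem c s)"
proof (induction c arbitrary: s)
  case (Seq c1 c2)
  have "runs (Seq c1 c2) s (max_cost c1 + max_cost c2) (\<lambda>s'. s' = sem (Seq c1 c2) s)"
  proof (rule runs_Seq)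
    show "runs c1 s (max_cost c1) (\<lambda>s'. s' = sem c1 s)" using Seq by simp
    show "runs c2 s' (max_cost c2) (\<lambda>s'. s' = sem (Seq c1 c2) s)" if "s' = sem c1 s" for s'
      using Seq that by simp
  qed
  then show ?case by simp
next
  case (Cond b c1 c2)
  have "runs (Cond b c1 c2) s (1 + cost b + max (max_cost c1) (max_cost c2))
      (\<lambda>s'. s' = sem (Cond b c1 c2) s)"
  proof (rule runs_Cond)
    show "runs c1 s (max (max_cost c1) (max_cost c2)) (\<lambda>s'. s' = sem (Cond b c1 c2) s)" if "val b s \<noteq> 0"
      using Cond that by (intro runs_conseq[OF Cond.IH(1)]) auto
    show "runs c2 s (max (max_cost c1) (max_cost c2)) (\<lambda>s'. s' = sem (Cond b c1 c2) s)" if "val b s = 0"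
      using Cond that by (intro runs_conseq[OF Cond.IH(2)]) auto
  qed
  then show ?case by simp
next
  case Skip
  show ?case by (rule runs_exec[OF exec.Skip]) simp_all
next
  case (Assign r a)
  show ?case by (rule runs_exec[OF exec.Assign]) simp_all
next
  case (Store a b)
  show ?case by (rule runs_exec[OF exec.Store]) simp_all
qed simp

lemma runs_sem: "loopfree c \<Longrightarrow> Q (sem c s) \<Longrightarrow> max_cost c \<le> n \<Longrightarrow> runs c s n Q"
  using runs_loopfree[of c s] runs_conseq by blast

lemma runs_While_loopfree:
  assumes "loopfree c" and "Inv s"
    and step: "\<And>s. Inv s \<Longrightarrow> val b s \<noteq> 0 \<Longrightarrow> Inv (sem c s) \<and> \<mu> (sem c s) < \<mu> s"
  shows "runs (While b c) s ((1 + cost b + max_cost c) * \<mu> s + 1 + cost b)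
    (\<lambda>s'. Inv s' \<and> val b s' = 0)"
proof (rule runs_While[where \<Phi> = "\<lambda>s. (1 + cost b + max_cost c) * \<mu> s" and Inv = Inv, OF assms(2)])
  fix s assume s: "Inv s" "val b s \<noteq> 0"
  let ?C = "1 + cost b + max_cost c"
  have "?C * Suc (\<mu> (sem c s)) \<le> ?C * \<mu> s"
    using step[OF s] by (intro mult_le_mono2) simp
  then have "1 + cost b + max_cost c + ?C * \<mu> (sem c s) \<le> ?C * \<mu> s" by simp
  then show "\<exists>n. runs c s n (\<lambda>s'. Inv s' \<and> 1 + cost b + n + ?C * \<mu> s' \<le> ?C * \<mu> s)"
    using step[OF s] assms(1) by (intro exI[of _ "max_cost c"] runs_sem) auto
qed

lemma runs_While_upto:
  assumes "loopfree c" and "Inv s" and "m - fst s k = n"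
    and "\<And>s. Inv s \<Longrightarrow> val b s \<noteq> 0 \<Longrightarrow> Inv (sem c s) \<and> m - fst (sem c s) k < m - fst s k"
  shows "runs (While b c) s ((1 + cost b + max_cost c) * n + 1 + cost b)
    (\<lambda>s'. Inv s' \<and> val b s' = 0)"
  using runs_While_loopfree[of c Inv s b "\<lambda>s. m - fst s k"] assms by auto

section \<open>Expressions\<close>

text \<open>As a condition an expression holds here if its value is \<open>0\<close>: then addition is
  conjunction and the minimum is disjunction.\<close>

definition eqE :: "expr \<Rightarrow> expr \<Rightarrow> expr" where
  "eqE a b = Add (Sub a b) (Sub b a)"

definition neqE :: "expr \<Rightarrow> expr \<Rightarrow> expr" where
  "neqE a b = Sub (Num 1) (eqE a b)"

definition andE :: "expr list \<Rightarrow> expr" where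
  "andE es = foldr Add es (Num 0)"

definition minE :: "expr \<Rightarrow> expr \<Rightarrow> expr" where
  "minE a b = Sub a (Sub a b)"

definition maxE :: "expr \<Rightarrow> expr \<Rightarrow> expr" where
  "maxE a b = Add a (Sub b a)"

definition orE :: "expr list \<Rightarrow> expr" where
  "orE es = foldr minE es (Num 1)"

lemma val_eqE [simp]: "val (eqE a b) s = 0 \<longleftrightarrow> val a s = val b s"
  by (auto simp: eqE_def)

lemma val_neqE [simp]: "val (neqE a b) s = 0 \<longleftrightarrow> val a s \<noteq> val b s"
  by (auto simp: neqE_def eqE_def)

lemma val_andE [simp]: "val (andE es) s = 0 \<longleftrightarrow> (\<forall>e\<in>set es. val e s = 0)"
  unfolding andE_def by (induction es) auto

lemma val_minE [simp]: "val (minE a b) s = min (val a s) (val b s)"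
  by (auto simp: minE_def)

lemma val_maxE [simp]: "val (maxE a b) s = max (val a s) (val b s)"
  by (auto simp: maxE_def)

lemma val_orE [simp]: "val (orE es) s = 0 \<longleftrightarrow> (\<exists>e\<in>set es. val e s = 0)"
  unfolding orE_def by (induction es) (auto simp: min_def)

section \<open>Parsing prefix words\<close>

lemma length_prefix_word: "length (prefix_word t) = nsyms t"
proof (induction t)
  case (Fun f ts)
  then have "map length (map prefix_word ts) = map nsyms ts" by simp
  then show ?case by (simp only: prefix_word.simps nsyms.simps length_Cons length_concat)
qed simp

lemma length_concat_prefix_words:
  "length (concat (map prefix_word ts)) = (\<Sum>t\<leftarrow>ts. nsyms t)"
  by (induction ts) (simp_all add: length_prefix_word)

lemma nsyms_pos: "nsyms t > 0"
  by (cases t) auto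

lemma gterms_FunE:
  assumes "t \<in> gterms ar F {}"
  obtains f ts where "t = Fun f ts" "f \<in> F" "length ts = ar f" "set ts \<subseteq> gterms ar F {}"
proof (cases t)
  case (Var x)
  then show ?thesis using assms by (simp add: gterms_def)
next
  case (Fun f ts)
  then show ?thesis using assms gterms_Fun_iff[of f ts ar F "{}"] by (intro that[of f ts]) auto
qed

text \<open>The symbol determines the arity, so the word itself tells where each argument
  ends.\<close>

lemma prefix_word_unique:
  "t \<in> gterms ar F {} \<Longrightarrow> t' \<in> gterms ar F {} \<Longrightarrow> prefix_word t @ r = prefix_word t' @ r' \<Longrightarrow>
     t = t' \<and> r = r'"
proof (induction t arbitrary: t' r r')
  case (Var x)
  then show ?case by (simp add: gterms_def)
next
  case (Fun f ts)
  from Fun.prems have ts: "length ts = ar f" "set ts \<subseteq> gterms ar F {}" by (auto simp: gterms_Fun_iff)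
  from Fun.prems(2) obtain f' ts' where t': "t' = Fun f' ts'" "length ts' = ar f'"
    "set ts' \<subseteq> gterms ar F {}" by (rule gterms_FunE)
  \<comment> \<open>Generalised to sublists of the arguments, so that they can be split off one at a
    time.\<close>
  have "us = us' \<and> r = r'"
    if "set us \<subseteq> set ts" "set us' \<subseteq> gterms ar F {}" "length us = length us'"
      "concat (map prefix_word us) @ r = concat (map prefix_word us') @ r'" for us us'
    using that
  proof (induction us arbitrary: us')
    case (Cons u us)
    then obtain u' vs where us': "us' = u' # vs" by (cases us') auto
    have "u = u' \<and> concat (map prefix_word us) @ r = concat (map prefix_word vs) @ r'"
      using Cons.prems us' ts(2) by (intro Fun.IH) auto
    then show ?case using Cons.IH[of vs] Cons.prems us' by auto
  qed simp
  from this[of ts ts'] show ?case using Fun.prems(3) ts t' by auto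
qed

text \<open>Removing the first symbol of a forest replaces its first tree by the arguments of that
  tree, which is again a forest.\<close>

lemma prefix_word_drop:
  "set ts \<subseteq> gterms ar F {} \<Longrightarrow> i < length (concat (map prefix_word ts)) \<Longrightarrow>
     \<exists>t\<in>gterms ar F {}. \<exists>rest. drop i (concat (map prefix_word ts)) = prefix_word t @ rest"
proof (induction i arbitrary: ts)
  case 0
  then obtain t ts' where "ts = t # ts'" by (cases ts) auto
  then show ?case using 0 by auto
next
  case (Suc i)
  then obtain t ts' where ts: "ts = t # ts'" by (cases ts) auto
  then have "t \<in> gterms ar F {}" using Suc.prems by simp
  then obtain f us where t: "t = Fun f us" "set us \<subseteq> gterms ar F {}" by (rule gterms_FunE)
  from Suc.IH[of "us @ ts'"] show ?case using Suc.prems ts t by simp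
qed

text \<open>\<open>mm\<close> also contains the cells before \<open>A\<close>, so that list indices
  coincide with machine addresses.\<close>

locale parsed_word =
  fixes ar :: "nat \<Rightarrow> nat" and F :: "nat set" and mm :: "nat list" and A :: nat and roots :: "trm list"
  assumes word: "drop A mm = concat (map prefix_word roots)"
    and roots: "set roots \<subseteq> gterms ar F {}"
    and A_le: "A \<le> length mm"
begin

definition "M = length mm"

abbreviation I :: "nat set" where "I \<equiv> {A..<M}"

definition tm :: "nat \<Rightarrow> trm" where
  "tm a = (THE t. t \<in> gterms ar F {} \<and> (\<exists>rest. drop a mm = prefix_word t @ rest))"

definition en :: "nat \<Rightarrow> nat" where "en a = a + nsyms (tm a)"

text \<open>The first argument starts right after the symbol and each further one where its
  predecessor ends. For \<open>k\<close> equal to the arity this is the end of the whole subterm,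
  which is how the ends are computed.\<close>

definition chp :: "nat \<Rightarrow> nat \<Rightarrow> nat" where "chp a k = (en ^^ k) (Suc a)"

definition chs :: "nat \<Rightarrow> nat list" where "chs a = map (chp a) [0..<ar (mm ! a)]"

lemma tm_eq:
  assumes "t \<in> gterms ar F {}" and "drop a mm = prefix_word t @ rest"
  shows "tm a = t"
  unfolding tm_def
proof (rule the_equality)
  show "t \<in> gterms ar F {} \<and> (\<exists>rest. drop a mm = prefix_word t @ rest)" using assms by simp
  fix t' assume "t' \<in> gterms ar F {} \<and> (\<exists>rest. drop a mm = prefix_word t' @ rest)"
  then obtain rest' where "t' \<in> gterms ar F {}" "prefix_word t' @ rest' = prefix_word t @ rest"
    using assms(2) by metis
  then show "t' = t" using prefix_word_unique assms(1) by blast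
qed

lemma tm_ex:
  assumes "a \<in> I"
  shows "tm a \<in> gterms ar F {} \<and> (\<exists>rest. drop a mm = prefix_word (tm a) @ rest)"
proof -
  have "drop a mm = drop (a - A) (drop A mm)" using assms by simp
  moreover have "a - A < length (drop A mm)" using assms by (auto simp: M_def)
  ultimately obtain t rest where "t \<in> gterms ar F {}" "drop a mm = prefix_word t @ rest"
    using prefix_word_drop[OF roots, of "a - A"] word by auto
  then show ?thesis using tm_eq by auto
qed

lemma in_I_of_drop: "A \<le> a \<Longrightarrow> drop a mm = prefix_word t @ rest \<Longrightarrow> a \<in> I"
  using nsyms_pos[of t] by (cases "a < length mm") (auto simp: M_def length_prefix_word[symmetric])

lemma en_funpow_drop:
  assumes "A \<le> b" and "set us \<subseteq> gterms ar F {}" and "drop b mm = concat (map prefix_word us) @ rest"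
    and "k \<le> length us"
  shows "drop ((en ^^ k) b) mm = concat (map prefix_word (drop k us)) @ rest \<and>
    (en ^^ k) b = b + length (concat (map prefix_word (take k us)))"
  using assms(4)
proof (induction k)
  case 0
  then show ?case using assms by simp
next
  case (Suc k)
  let ?c = "(en ^^ k) b"
  have us: "drop k us = us ! k # drop (Suc k) us" using Suc.prems by (simp add: Cons_nth_drop_Suc)
  have IH: "drop ?c mm = prefix_word (us ! k) @ concat (map prefix_word (drop (Suc k) us)) @ rest"
    "?c = b + length (concat (map prefix_word (take k us)))" using Suc us by auto
  have "us ! k \<in> gterms ar F {}" using assms(2) Suc.prems by auto
  then have t: "tm ?c = us ! k" using tm_eq IH(1) by blast
  have "drop (en ?c) mm = drop (length (prefix_word (us ! k))) (drop ?c mm)"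
    using t by (simp add: en_def length_prefix_word add.commute)
  then have "drop (en ?c) mm = concat (map prefix_word (drop (Suc k) us)) @ rest" using IH(1) by simp
  moreover have "en ?c = b + length (concat (map prefix_word (take (Suc k) us)))"
    using t IH(2) Suc.prems by (simp add: en_def take_Suc_conv_app_nth length_prefix_word)
  ultimately show ?case by simp
qed

lemma node:
  assumes "a \<in> I"
  shows "mm ! a \<in> F" and "\<And>k. k < ar (mm ! a) \<Longrightarrow> chp a k \<in> I \<and> a < chp a k"
    and "chp a (ar (mm ! a)) = en a" and "tm a = Fun (mm ! a) (map tm (chs a))"
proof -
  from tm_ex[OF assms] obtain rest where t: "tm a \<in> gterms ar F {}"
    "drop a mm = prefix_word (tm a) @ rest" by blast
  from t(1) obtain f us where u: "tm a = Fun f us" "f \<in> F" "length us = ar f"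
    "set us \<subseteq> gterms ar F {}" by (rule gterms_FunE)
  have "a < length mm" using assms by (simp add: M_def)
  then have d: "drop a mm = mm ! a # drop (Suc a) mm" by (simp add: Cons_nth_drop_Suc)
  then have f: "mm ! a = f" "drop (Suc a) mm = concat (map prefix_word us) @ rest" using t u by auto
  then show "mm ! a \<in> F" using u by simp
  have A: "A \<le> Suc a" using assms by simp
  note e = en_funpow_drop[OF A u(4) f(2)]
  have kth: "chp a k \<in> I \<and> a < chp a k \<and> tm (chp a k) = us ! k" if "k < ar f" for k
  proof -
    have c: "drop (chp a k) mm = prefix_word (us ! k) @ concat (map prefix_word (drop (Suc k) us)) @ rest"
      "a < chp a k"
      using e[of k] that u(3) by (auto simp: chp_def Cons_nth_drop_Suc[symmetric])
    have "A \<le> chp a k" using c(2) assms by simp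
    moreover have "us ! k \<in> gterms ar F {}" using u that by auto
    ultimately show ?thesis using in_I_of_drop[OF _ c(1)] tm_eq[OF _ c(1)] c(2) by simp
  qed
  then show "\<And>k. k < ar (mm ! a) \<Longrightarrow> chp a k \<in> I \<and> a < chp a k" using f by simp
  show "chp a (ar (mm ! a)) = en a"
    using e[of "length us"] u f by (simp add: chp_def en_def length_concat_prefix_words del: length_concat)
  have "us = map tm (chs a)"
    using kth f u(3) by (intro nth_equalityI) (auto simp: chs_def)
  then show "tm a = Fun (mm ! a) (map tm (chs a))" using u f by simp
qed

lemma length_chs: "length (chs a) = ar (mm ! a)"
  by (simp add: chs_def)

lemma set_chs: "a \<in> I \<Longrightarrow> set (chs a) \<subseteq> I"
  using node(2) by (auto simp: chs_def)

lemma nth_chs: "k < ar (mm ! a) \<Longrightarrow> chs a ! k = chp a k"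
  by (simp add: chs_def)

lemma root_drop:
  assumes "A \<le> a" and "drop a mm = prefix_word t @ rest" and "t \<in> gterms ar F {}"
  shows "a \<in> I" and "tm a = t" and "a < en a" and "en a \<le> M" and "drop (en a) mm = rest"
proof -
  show I: "a \<in> I" using in_I_of_drop assms by blast
  show t: "tm a = t" using tm_eq assms by blast
  show "a < en a" using nsyms_pos by (simp add: en_def)
  have "drop (en a) mm = drop (length (prefix_word t)) (drop a mm)"
    using t by (simp add: en_def length_prefix_word add.commute)
  then show "drop (en a) mm = rest" using assms by simp
  have "length (drop a mm) \<ge> nsyms t" using assms by (simp add: length_prefix_word)
  then show "en a \<le> M" using t I by (auto simp: en_def M_def)
qed

end

section \<open>The program\<close>

text \<open>A node is the address of a symbol of the input. Register \<open>1\<close> holds the first address \<open>M\<close>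
  after the input. For a node \<open>a\<close>, the end of the subterm at \<open>a\<close> is kept at \<open>a + M\<close>, the label at
  \<open>a + 2 * M\<close>, and at \<open>a + 3 * M\<close> the root of the right-hand side if \<open>a\<close> is the root of the
  left-hand side of an equation. The output starts at \<open>4 * M\<close>.\<close>

fun addM :: "nat \<Rightarrow> expr \<Rightarrow> expr" where
  "addM 0 x = x"
| "addM (Suc k) x = Add (addM k x) (Reg 1)"

definition firstE :: expr where "firstE = Add (Reg 0) (Num 1)"

text \<open>Machine version of \<open>chp\<close>: the stored end at offset \<open>M\<close> takes
  the place of \<open>en\<close>.\<close>

fun chE :: "nat \<Rightarrow> expr \<Rightarrow> expr" where
  "chE 0 x = Add x (Num 1)"
| "chE (Suc k) x = Load (addM 1 (chE k x))"

definition labE :: "expr \<Rightarrow> expr" where "labE x = Load (addM 2 x)"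

text \<open>The case distinction on the symbol is unrolled over the signature, so its cost does not
  depend on the input. Equality is the value 0, hence the first branch of \<open>Cond\<close> is the
  mismatch.\<close>

fun end_cmd :: "(nat \<Rightarrow> nat) \<Rightarrow> nat list \<Rightarrow> cmd" where
  "end_cmd ar [] = Skip"
| "end_cmd ar (f # fs) = Cond (eqE (Load (Reg 2)) (Num f)) (end_cmd ar fs)
     (Store (addM 1 (Reg 2)) (chE (ar f) (Reg 2)))"

text \<open>Addresses are treated in descending order, because arguments lie to the right of their
  symbol. Adding \<open>base\<close> moves the initial labels beyond all symbols of
  \<open>F\<close>.\<close>

definition parse_body :: "(nat \<Rightarrow> nat) \<Rightarrow> nat list \<Rightarrow> nat \<Rightarrow> cmd" where
  "parse_body ar fl base = Seq (Assign 2 (Sub (Reg 2) (Num 1))) (Seq (end_cmd ar fl)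
     (Store (addM 2 (Reg 2)) (Add (Reg 2) (Num base))))"

definition parse_cmd :: "(nat \<Rightarrow> nat) \<Rightarrow> nat list \<Rightarrow> nat \<Rightarrow> cmd" where
  "parse_cmd ar fl base = Seq (Assign 2 (Reg 1)) (While (Sub (Reg 2) firstE) (parse_body ar fl base))"

definition zero_cmd :: "rule_kind set \<Rightarrow> nat \<Rightarrow> cmd" where
  "zero_cmd rs z = (if Unit \<in> rs then Store (addM 2 (Sub (Reg 1) (Num 1))) (Num z) else Skip)"

text \<open>The right-hand side starts where the left-hand side ends. Cells not written here stay 0,
  which is not a node.\<close>

definition pair_body :: cmd where
  "pair_body = Seq (Store (addM 3 (Reg 2)) (Load (addM 1 (Reg 2))))
     (Assign 2 (Load (addM 1 (Load (addM 1 (Reg 2))))))"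

definition pair_cmd :: cmd where
  "pair_cmd = Seq (Assign 2 firstE) (While (Sub (Reg 1) (Reg 2)) pair_body)"

definition cong_testE :: "nat \<Rightarrow> nat \<Rightarrow> (nat \<Rightarrow> nat) \<Rightarrow> expr" where
  "cong_testE n f \<pi> = andE ([eqE (Load (Reg 2)) (Num f), eqE (Load (Reg 3)) (Num f)] @
     map (\<lambda>k. eqE (labE (chE k (Reg 2))) (labE (chE (\<pi> k) (Reg 3)))) [0..<n])"

definition rule_tests :: "rule_kind set \<Rightarrow> nat \<Rightarrow> nat \<Rightarrow> expr list" where
  "rule_tests rs g z =
     (if Idem \<in> rs then [andE [eqE (Load (Reg 2)) (Num g),
        eqE (labE (chE 0 (Reg 2))) (labE (chE 1 (Reg 2))), eqE (Reg 3) (chE 0 (Reg 2))]] else []) @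
     (if Nilp \<in> rs then [andE [eqE (Load (Reg 2)) (Num g),
        eqE (labE (chE 0 (Reg 2))) (labE (chE 1 (Reg 2))), eqE (Load (Reg 3)) (Num z)]] else []) @
     (if Unit \<in> rs then
       [andE [eqE (Load (Reg 2)) (Num g), eqE (labE (chE 1 (Reg 2))) (Num z),
          eqE (Reg 3) (chE 0 (Reg 2))],
        andE [eqE (Load (Reg 2)) (Num g), eqE (labE (chE 0 (Reg 2))) (Num z),
          eqE (Reg 3) (chE 1 (Reg 2))]] else [])"

definition testE :: "(nat \<Rightarrow> nat) \<Rightarrow> nat list \<Rightarrow> (nat \<Rightarrow> (nat \<Rightarrow> nat) list) \<Rightarrow> rule_kind set \<Rightarrow>
    nat \<Rightarrow> nat \<Rightarrow> expr" where
  "testE ar fl pl rs g z = orE (eqE (Load (addM 3 (Reg 2))) (Reg 3) #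
     concat (map (\<lambda>f. map (cong_testE (ar f) f) (pl f)) fl) @ rule_tests rs g z)"

definition merge_body :: cmd where
  "merge_body = Seq (Cond (eqE (labE (Reg 4)) (Reg 6)) Skip (Store (addM 2 (Reg 4)) (Reg 5)))
     (Assign 4 (Add (Reg 4) (Num 1)))"

definition merge_init :: cmd where
  "merge_init = Seq (Assign 5 (minE (labE (Reg 2)) (labE (Reg 3))))
     (Seq (Assign 6 (maxE (labE (Reg 2)) (labE (Reg 3)))) (Assign 4 firstE))"

definition reset_cmd :: cmd where
  "reset_cmd = Seq (Assign 2 firstE) (Assign 3 firstE)"

definition merge_cmd :: cmd where
  "merge_cmd = Seq merge_init (Seq (While (Sub (Reg 1) (Reg 4)) merge_body) reset_cmd)"

definition advance_cmd :: cmd where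
  "advance_cmd = Seq (Assign 3 (Add (Reg 3) (Num 1)))
     (Cond (Sub (Reg 1) (Reg 3)) Skip (Seq (Assign 2 (Add (Reg 2) (Num 1))) (Assign 3 firstE)))"

text \<open>The condition has the value 0 exactly if the test succeeds and the two labels still
  differ, so the branch for 0 merges.\<close>

definition saturate_body :: "expr \<Rightarrow> cmd" where
  "saturate_body t = Cond (Add t (neqE (labE (Reg 2)) (labE (Reg 3)))) advance_cmd merge_cmd"

definition saturate_cmd :: "expr \<Rightarrow> cmd" where
  "saturate_cmd t = Seq reset_cmd (While (Sub (Reg 1) (Reg 2)) (saturate_body t))"

definition push :: "expr \<Rightarrow> cmd" where
  "push e = Seq (Store (Reg 7) e) (Assign 7 (Add (Reg 7) (Num 1)))"

fun push_args :: "nat \<Rightarrow> cmd" where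
  "push_args 0 = Skip"
| "push_args (Suc k) = Seq (push_args k) (push (labE (chE k (Reg 4))))"

fun push_rule :: "(nat \<Rightarrow> nat) \<Rightarrow> nat list \<Rightarrow> cmd" where
  "push_rule ar [] = Skip"
| "push_rule ar (f # fs) = Cond (eqE (Load (Reg 4)) (Num f)) (push_rule ar fs)
     (Seq (push (Num f)) (Seq (push_args (ar f)) (push (labE (Reg 4)))))"

definition next_cmd :: cmd where
  "next_cmd = Assign 4 (Add (Reg 4) (Num 1))"

text \<open>The number of rules precedes the rules in the output, so it is counted while the labels
  are written. \<open>neqE\<close> is 1 on equal and 0 on different values; subtracting it from 1
  gives the increment.\<close>

definition label_body :: cmd where
  "label_body = Seq (push (labE (Reg 4)))
     (Seq (Assign 8 (Add (Reg 8) (Sub (Num 1) (neqE (Load (Reg 4)) (labE (Reg 4)))))) next_cmd)"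

definition rule_body :: "(nat \<Rightarrow> nat) \<Rightarrow> nat list \<Rightarrow> cmd" where
  "rule_body ar fl = Seq (Cond (eqE (Load (Reg 4)) (labE (Reg 4))) (push_rule ar fl) Skip) next_cmd"

definition output_init :: cmd where
  "output_init = Seq (Assign 7 (addM 4 (Num 0))) (Seq (push (Sub (Reg 1) firstE))
     (Seq (Assign 8 (Num 0)) (Assign 4 firstE)))"

definition output_final :: cmd where
  "output_final = Seq (push (Num 0)) (Assign 0 (addM 4 (Num 0)))"

definition output_cmd :: "(nat \<Rightarrow> nat) \<Rightarrow> nat list \<Rightarrow> cmd" where
  "output_cmd ar fl = Seq output_init (Seq (While (Sub (Reg 1) (Reg 4)) label_body)
     (Seq (Seq (push (Reg 8)) (Assign 4 firstE))
     (Seq (While (Sub (Reg 1) (Reg 4)) (rule_body ar fl)) output_final)))"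

text \<open>Appends the trivial equation between \<open>0\<close> and itself, one cell for each
  side, which provides a node for \<open>0\<close> in the last cell. The stored number of equations
  may stay unchanged, as register 1 marks the end of the word.\<close>

definition append_cmd :: "rule_kind set \<Rightarrow> nat \<Rightarrow> cmd" where
  "append_cmd rs z = (if Nilp \<in> rs \<or> Unit \<in> rs then
     Seq (Store (Reg 1) (Num z)) (Seq (Store (Add (Reg 1) (Num 1)) (Num z))
       (Assign 1 (Add (Reg 1) (Num 2)))) else Skip)"

section \<open>Time bounds of the phases\<close>

definition parse_time ::
  "(nat \<Rightarrow> nat) \<Rightarrow> nat list \<Rightarrow> nat \<Rightarrow> rule_kind set \<Rightarrow> nat \<Rightarrow> nat \<Rightarrow> nat" where
  "parse_time ar fl base rs z n = 2 + ((1 + cost (Sub (Reg 2) firstE) + max_cost (parse_body ar fl base)) * n +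
     1 + cost (Sub (Reg 2) firstE)) + max_cost (zero_cmd rs z)"

definition pair_time :: "nat \<Rightarrow> nat" where
  "pair_time n = max_cost (Assign 2 firstE) +
     ((1 + cost (Sub (Reg 1) (Reg 2)) + max_cost pair_body) * n + 1 + cost (Sub (Reg 1) (Reg 2)))"

definition advance_time :: "expr \<Rightarrow> nat" where
  "advance_time t = 1 + cost (Sub (Reg 1) (Reg 2)) +
     (1 + cost (Add t (neqE (labE (Reg 2)) (labE (Reg 3)))) + max_cost advance_cmd)"

definition merge_time :: "nat \<Rightarrow> nat" where
  "merge_time n = max_cost merge_init + (((1 + cost (Sub (Reg 1) (Reg 4)) + max_cost merge_body) * n +
     1 + cost (Sub (Reg 1) (Reg 4))) + max_cost reset_cmd)"

text \<open>The budget between two merges: a full enumeration of the pairs and the merge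
  itself.\<close>

definition phase_time :: "expr \<Rightarrow> nat \<Rightarrow> nat" where
  "phase_time t n = advance_time t * (n * n + n) + (1 + cost (Sub (Reg 1) (Reg 2)) +
     (1 + cost (Add t (neqE (labE (Reg 2)) (labE (Reg 3)))) + merge_time n))"

definition saturate_time :: "expr \<Rightarrow> nat \<Rightarrow> nat" where
  "saturate_time t n = max_cost reset_cmd +
     (n * phase_time t n + advance_time t * (n * n + n) + 1 + cost (Sub (Reg 1) (Reg 2)))"

definition output_time :: "(nat \<Rightarrow> nat) \<Rightarrow> nat list \<Rightarrow> nat \<Rightarrow> nat" where
  "output_time ar fl n = max_cost output_init +
     (((1 + cost (Sub (Reg 1) (Reg 4)) + max_cost label_body) * n + 1 + cost (Sub (Reg 1) (Reg 4))) +
     (max_cost (Seq (push (Reg 8)) (Assign 4 firstE)) +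
     (((1 + cost (Sub (Reg 1) (Reg 4)) + max_cost (rule_body ar fl)) * n + 1 +
        cost (Sub (Reg 1) (Reg 4))) + max_cost output_final)))"

definition main_cmd :: "(nat \<Rightarrow> nat) \<Rightarrow> nat list \<Rightarrow> nat \<Rightarrow> rule_kind set \<Rightarrow> nat \<Rightarrow> expr \<Rightarrow> cmd" where
  "main_cmd ar fl base rs z t = Seq (Seq (parse_cmd ar fl base) (zero_cmd rs z))
     (Seq pair_cmd (Seq (saturate_cmd t) (output_cmd ar fl)))"

definition main_time ::
  "(nat \<Rightarrow> nat) \<Rightarrow> nat list \<Rightarrow> nat \<Rightarrow> rule_kind set \<Rightarrow> nat \<Rightarrow> expr \<Rightarrow> nat \<Rightarrow> nat" where
  "main_time ar fl base rs z t n =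
     parse_time ar fl base rs z n + (pair_time n + (saturate_time t n + output_time ar fl n))"

lemma loopfree_end_cmd [simp]: "loopfree (end_cmd ar fl)"
  by (induction fl) auto

lemma loopfree_parse_body [simp]: "loopfree (parse_body ar fl base)"
  by (simp add: parse_body_def)

lemma loopfree_push_args [simp]: "loopfree (push_args k)"
  by (induction k) (auto simp: push_def)

lemma loopfree_push_rule [simp]: "loopfree (push_rule ar fl)"
  by (induction fl) (auto simp: push_def)

lemma val_addM [simp]: "val (addM k x) s = val x s + k * fst s 1"
  by (induction k) auto

lemma val_firstE [simp]: "val firstE s = Suc (fst s 0)"
  by (simp add: firstE_def)

lemma val_labE [simp]: "val (labE x) s = snd s (val x s + 2 * fst s 1)"
  by (simp add: labE_def)

lemma sem_end_cmd:
  "snd s (fst s 2) \<in> set fl \<Longrightarrow> sem (end_cmd ar fl) s =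
     (fst s, (snd s)(fst s 2 + fst s 1 := val (chE (ar (snd s (fst s 2))) (Reg 2)) s))"
  by (induction fl) auto

text \<open>\<open>ps\<close> may contain trivial pairs besides \<open>P\<close>, which accommodates
  the appended one. \<open>A_pos\<close> lets the value 0 mean that a node has no partner.\<close>

locale input_word = parsed_word ar F mm A roots
  for ar F mm A roots +
  fixes E P :: "eqn set" and ps :: "eqn list" and g z base :: nat and rs :: "rule_kind set"
    and fl :: "nat list" and pl :: "nat \<Rightarrow> (nat \<Rightarrow> nat) list"
  assumes A_pos: "A > 0"
    and roots_eq: "roots = concat (map (\<lambda>(l, r). [l, r]) ps)"
    and fl: "set fl = F"
    and pl: "\<And>f. set (pl f) = arg_perms ar F E f (ar f)"
    and base: "\<And>f. f \<in> F \<Longrightarrow> f < base"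
    and zero: "Nilp \<in> rs \<or> Unit \<in> rs \<Longrightarrow> z \<in> F \<and> ar z = 0 \<and> A < M \<and> mm ! (M - 1) = z"
    and g: "rs \<noteq> {} \<Longrightarrow> g \<in> F \<and> ar g = 2"
    and P_ps: "P \<subseteq> set ps" and ps_P: "set ps \<subseteq> P \<union> Id"
    and not_both: "\<not> (Idem \<in> rs \<and> Nilp \<in> rs)"
    and E_perm: "\<And>e. e \<in> E \<Longrightarrow> is_perm_eqn ar F e"
begin

definition "N = M - A"

abbreviation "B \<equiv> kind_rules g z rs"
abbreviation "T0 \<equiv> terms ar F {}"
abbreviation "Q \<equiv> eqth T0 (P \<union> B \<union> E)"

lemma A_le_M: "A \<le> M" using A_le by (simp add: M_def)

subsection \<open>Parsing\<close>

definition frame :: "state \<Rightarrow> bool" where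
  "frame s \<longleftrightarrow> Suc (fst s 0) = A \<and> fst s 1 = M \<and> (\<forall>a\<in>I. snd s a = mm ! a)"

text \<open>Only ends at addresses beyond \<open>a\<close> are required, so this applies during the
  descending parse as well as afterwards.\<close>

lemma val_chE:
  assumes "fst s 1 = M" and "val x s = a" and "a \<in> I" and "k \<le> ar (mm ! a)"
    and "\<And>c. c \<in> I \<Longrightarrow> a < c \<Longrightarrow> snd s (c + M) = en c"
  shows "val (chE k x) s = chp a k"
  using assms(4)
proof (induction k)
  case 0
  then show ?case using assms(2) by (simp add: chp_def)
next
  case (Suc k)
  then have "chp a k \<in> I \<and> a < chp a k" using node(2)[OF assms(3)] by simp
  then show ?case using Suc assms(1,5) by (simp add: chp_def)
qed

definition parse_inv :: "state \<Rightarrow> bool" where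
  "parse_inv s \<longleftrightarrow> frame s \<and> (\<forall>a\<ge>3 * M. snd s a = 0) \<and> A \<le> fst s 2 \<and> fst s 2 \<le> M \<and>
     (\<forall>a\<in>I. fst s 2 \<le> a \<longrightarrow> snd s (a + M) = en a \<and> snd s (a + 2 * M) = a + base)"

lemma parse_step:
  assumes "parse_inv s" and "val (Sub (Reg 2) firstE) s \<noteq> 0"
  shows "parse_inv (sem (parse_body ar fl base) s) \<and>
    fst (sem (parse_body ar fl base) s) 2 - A < fst s 2 - A"
proof -
  define a where "a = fst s 2 - 1"
  have fr: "Suc (fst s 0) = A" "fst s 1 = M" "\<And>a. a \<in> I \<Longrightarrow> snd s a = mm ! a"
    using assms(1) by (auto simp: parse_inv_def frame_def)
  have hi: "snd s c = 0" if "3 * M \<le> c" for c using assms(1) that by (auto simp: parse_inv_def)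
  have inv: "fst s 2 \<le> M" "\<And>c. c \<in> I \<Longrightarrow> fst s 2 \<le> c \<Longrightarrow> snd s (c + M) = en c \<and> snd s (c + 2 * M) = c + base"
    using assms(1) by (auto simp: parse_inv_def)
  have gt: "A < fst s 2" using assms(2) fr(1) by simp
  then have a: "a \<in> I" "fst s 2 = Suc a" using inv(1) by (auto simp: a_def)
  define s1 where "s1 = ((fst s)(2 := a), snd s)"
  have s1: "sem (Assign 2 (Sub (Reg 2) (Num 1))) s = s1" by (simp add: s1_def a_def)
  have sy: "snd s1 (fst s1 2) = mm ! a" using fr(3)[OF a(1)] by (simp add: s1_def)
  have "val (chE (ar (mm ! a)) (Reg 2)) s1 = chp a (ar (mm ! a))"
    using fr inv(2) a by (intro val_chE) (auto simp: s1_def)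
  then have v: "val (chE (ar (mm ! a)) (Reg 2)) s1 = en a" using node(3)[OF a(1)] by simp
  have s2: "sem (end_cmd ar fl) s1 = (fst s1, (snd s)(a + M := en a))"
    using sem_end_cmd[of s1 fl ar] sy v node(1)[OF a(1)] fl fr(2) by (simp add: s1_def)
  have s3: "sem (parse_body ar fl base) s =
      ((fst s)(2 := a), (snd s)(a + M := en a, a + 2 * M := a + base))"
    unfolding parse_body_def sem.simps(4) s1 s2 using fr by (simp add: s1_def)
  have "c = a" if "c \<in> I" "\<not> fst s 2 \<le> c" "a \<le> c" for c using that a by simp
  then show ?thesis unfolding s3 using fr hi inv a gt
    by (auto simp: parse_inv_def frame_def)
qed

definition parsed :: "state \<Rightarrow> bool" where
  "parsed s \<longleftrightarrow> frame s \<and> (\<forall>a\<ge>3 * M. snd s a = 0) \<and> (\<forall>a\<in>I. snd s (a + M) = en a)"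

definition lab0 :: "nat \<Rightarrow> nat" where
  "lab0 a = (if Unit \<in> rs \<and> a = M - 1 then z else a + base)"

lemma parse_runs:
  assumes "frame s" and "\<forall>a\<ge>M. snd s a = 0"
  shows "runs (Seq (parse_cmd ar fl base) (zero_cmd rs z)) s (parse_time ar fl base rs z N)
    (\<lambda>s. parsed s \<and> (\<forall>a\<in>I. snd s (a + 2 * M) = lab0 a))"
  unfolding parse_time_def
proof (rule runs_Seq)
  let ?b = "Sub (Reg 2) firstE" and ?c = "parse_body ar fl base"
  show "runs (parse_cmd ar fl base) s (2 + ((1 + cost ?b + max_cost ?c) * N + 1 + cost ?b))
      (\<lambda>s'. parse_inv s' \<and> val ?b s' = 0)"
    unfolding parse_cmd_def
  proof (rule runs_Seq)
    show "runs (Assign 2 (Reg 1)) s 2 (\<lambda>s'. parse_inv s' \<and> fst s' 2 - A = N)"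
      using assms A_le_M by (intro runs_sem) (auto simp: parse_inv_def frame_def N_def)
    fix s' assume "parse_inv s' \<and> fst s' 2 - A = N"
    then show "runs (While ?b ?c) s' ((1 + cost ?b + max_cost ?c) * N + 1 + cost ?b)
        (\<lambda>s'. parse_inv s' \<and> val ?b s' = 0)"
      using runs_While_loopfree[of ?c parse_inv s' ?b "\<lambda>s. fst s 2 - A"] parse_step by auto
  qed
  fix s' assume s': "parse_inv s' \<and> val ?b s' = 0"
  then have "fst s' 2 = A" by (auto simp: parse_inv_def frame_def)
  with s' have p: "parsed s'" "\<And>a. a \<in> I \<Longrightarrow> snd s' (a + 2 * M) = a + base"
    by (auto simp: parse_inv_def parsed_def)
  have fr: "Suc (fst s' 0) = A" "fst s' 1 = M" using p(1) by (auto simp: parsed_def frame_def)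
  show "runs (zero_cmd rs z) s' (max_cost (zero_cmd rs z))
      (\<lambda>s. parsed s \<and> (\<forall>a\<in>I. snd s (a + 2 * M) = lab0 a))"
  proof (rule runs_sem)
    have m: "M - 1 \<noteq> M + c" "M - Suc 0 + 2 * M \<noteq> c + M" "M - 1 + 2 * M < 3 * M" if "c < M" for c using that by auto
    have e: "M - Suc 0 + 2 * M = a + 2 * M \<longleftrightarrow> a = M - Suc 0" for a by auto
    have "A < M" if "Unit \<in> rs" using zero that by simp
    then show "parsed (sem (zero_cmd rs z) s') \<and> (\<forall>a\<in>I. snd (sem (zero_cmd rs z) s') (a + 2 * M) = lab0 a)"
      using p fr m by (auto simp: zero_cmd_def lab0_def parsed_def frame_def)
  qed (simp_all add: zero_cmd_def)
qed

subsection \<open>Pairing the sides of the equations\<close>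

definition paired :: "(nat \<Rightarrow> nat) \<Rightarrow> nat \<Rightarrow> bool" where
  "paired m a \<longleftrightarrow> (\<exists>qs qs'. ps = qs @ qs' \<and>
     drop a mm = concat (map prefix_word (concat (map (\<lambda>(l, r). [l, r]) qs'))) \<and>
     (\<forall>l r. (l, r) \<in> set qs \<longrightarrow> (\<exists>c\<in>I. tm c = l \<and> m (c + 3 * M) \<in> I \<and> tm (m (c + 3 * M)) = r)))"

lemma pairedE:
  assumes "paired m a"
  obtains qs qs' where "ps = qs @ qs'"
    "drop a mm = concat (map prefix_word (concat (map (\<lambda>(l, r). [l, r]) qs')))"
    "\<And>l r. (l, r) \<in> set qs \<Longrightarrow> \<exists>c\<in>I. tm c = l \<and> m (c + 3 * M) \<in> I \<and> tm (m (c + 3 * M)) = r"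
  using assms unfolding paired_def by (elim exE conjE) auto

definition pair_inv :: "state \<Rightarrow> bool" where
  "pair_inv s \<longleftrightarrow> frame s \<and> (\<forall>a\<in>I. snd s (a + M) = en a) \<and> (\<forall>a\<in>I. snd s (a + 2 * M) = lab0 a) \<and>
     A \<le> fst s 2 \<and> fst s 2 \<le> M \<and> (\<forall>a\<in>I. fst s 2 \<le> a \<longrightarrow> snd s (a + 3 * M) = 0) \<and>
     (\<forall>a\<in>I. snd s (a + 3 * M) \<noteq> 0 \<longrightarrow> snd s (a + 3 * M) \<in> I \<and> (tm a, tm (snd s (a + 3 * M))) \<in> set ps) \<and>
     paired (snd s) (fst s 2)"

lemma pair_step:
  assumes "pair_inv s" and "val (Sub (Reg 1) (Reg 2)) s \<noteq> 0"
  shows "pair_inv (sem pair_body s) \<and> M - fst (sem pair_body s) 2 < M - fst s 2"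
proof -
  define a where "a = fst s 2"
  have fr: "Suc (fst s 0) = A" "fst s 1 = M" "\<And>a. a \<in> I \<Longrightarrow> snd s a = mm ! a"
    using assms(1) by (auto simp: pair_inv_def frame_def)
  have inv: "\<And>c. c \<in> I \<Longrightarrow> snd s (c + M) = en c" "\<And>c. c \<in> I \<Longrightarrow> snd s (c + 2 * M) = lab0 c"
    "A \<le> a" "a \<le> M" "\<And>c. c \<in> I \<Longrightarrow> a \<le> c \<Longrightarrow> snd s (c + 3 * M) = 0"
    "\<And>c. c \<in> I \<Longrightarrow> snd s (c + 3 * M) \<noteq> 0 \<Longrightarrow> snd s (c + 3 * M) \<in> I \<and> (tm c, tm (snd s (c + 3 * M))) \<in> set ps"
    using assms(1) by (auto simp: pair_inv_def a_def)
  have "paired (snd s) a" using assms(1) by (simp add: pair_inv_def a_def)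
  then obtain qs qs' where q: "ps = qs @ qs'"
    "drop a mm = concat (map prefix_word (concat (map (\<lambda>(l, r). [l, r]) qs')))"
    "\<And>l r. (l, r) \<in> set qs \<Longrightarrow> \<exists>a\<in>I. tm a = l \<and> snd s (a + 3 * M) \<in> I \<and> tm (snd s (a + 3 * M)) = r"
    by (rule pairedE) (rule that)
  have "a < M" using assms(2) fr by (simp add: a_def)
  then have "qs' \<noteq> []" using q(2) by (auto simp: M_def)
  then obtain l r qs'' where q': "qs' = (l, r) # qs''" by (cases qs') auto
  have lr: "l \<in> gterms ar F {}" "r \<in> gterms ar F {}" using roots q(1) q' by (auto simp: roots_eq)
  have d: "drop a mm = prefix_word l @ (prefix_word r @ concat (map prefix_word (concat (map (\<lambda>(l, r). [l, r]) qs''))))"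
    using q(2) q' by simp
  note 1 = root_drop[OF inv(3) d lr(1)]
  have "A \<le> en a" using 1(3) inv(3) by simp
  note 2 = root_drop[OF this 1(5) lr(2)]
  have body: "sem pair_body s = ((fst s)(2 := en (en a)), (snd s)(a + 3 * M := en a))"
    using fr inv(1)[OF 1(1)] inv(1)[OF 2(1)] 1(1) 2(1) by (auto simp: pair_body_def a_def)
  \<comment> \<open>The partner cell of \<open>a\<close> was still 0, hence overwriting it destroys
    no witness for an earlier equation.\<close>
  have ne: "snd s (c + 3 * M) \<in> I \<Longrightarrow> c \<in> I \<Longrightarrow> c \<noteq> a" for c using inv(5)[of c] A_pos by auto
  have "\<exists>a'\<in>I. tm a' = l' \<and> ((snd s)(a + 3 * M := en a)) (a' + 3 * M) \<in> I \<and>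
      tm (((snd s)(a + 3 * M := en a)) (a' + 3 * M)) = r'" if "(l', r') \<in> set (qs @ [(l, r)])" for l' r'
  proof (cases "(l', r') \<in> set qs")
    case True
    then obtain c where "c \<in> I" "tm c = l'" "snd s (c + 3 * M) \<in> I" "tm (snd s (c + 3 * M)) = r'"
      using q(3) by blast
    then show ?thesis using ne[of c] by (intro bexI[of _ c]) auto
  next
    case False
    then show ?thesis using that 1 2 by (intro bexI[of _ a]) auto
  qed
  then have "paired ((snd s)(a + 3 * M := en a)) (en (en a))"
    unfolding paired_def using q(1) q' 2(5)
    by (intro exI[of _ "qs @ [(l, r)]"] exI[of _ qs'']) auto
  moreover have "(l, r) \<in> set ps" using q(1) q' by simp
  ultimately show ?thesis
    unfolding body using fr inv 1 2
    by (auto simp: pair_inv_def frame_def a_def[symmetric])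
qed

definition partner :: "(nat \<Rightarrow> nat) \<Rightarrow> bool" where
  "partner pt \<longleftrightarrow> (\<forall>a\<in>I. pt a \<in> I \<longrightarrow> (tm a, tm (pt a)) \<in> P \<union> Id) \<and>
     (\<forall>(l, r)\<in>P. \<exists>a\<in>I. tm a = l \<and> pt a \<in> I \<and> tm (pt a) = r)"

definition ready :: "(nat \<Rightarrow> nat) \<Rightarrow> state \<Rightarrow> bool" where
  "ready pt s \<longleftrightarrow> frame s \<and> (\<forall>a\<in>I. snd s (a + M) = en a \<and> snd s (a + 3 * M) = pt a)"

abbreviation labels :: "state \<Rightarrow> nat \<Rightarrow> nat" where
  "labels s \<equiv> \<lambda>a. snd s (a + 2 * M)"

lemma pair_runs:
  assumes "parsed s" and "\<forall>a\<in>I. snd s (a + 2 * M) = lab0 a"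
  shows "runs pair_cmd s (pair_time N)
    (\<lambda>s. (\<exists>pt. partner pt \<and> ready pt s) \<and> (\<forall>a\<in>I. labels s a = lab0 a))"
  unfolding pair_cmd_def pair_time_def
proof (rule runs_Seq)
  let ?b = "Sub (Reg 1) (Reg 2)"
  show "runs (Assign 2 firstE) s (max_cost (Assign 2 firstE)) (\<lambda>s'. pair_inv s' \<and> M - fst s' 2 = N)"
  proof (rule runs_sem)
    have "drop A mm = concat (map prefix_word (concat (map (\<lambda>(l, r). [l, r]) ps)))"
      using word roots_eq by simp
    then have "paired (snd s) A"
      unfolding paired_def by (intro exI[of _ "[]"] exI[of _ ps]) auto
    then show "pair_inv (sem (Assign 2 firstE) s) \<and> M - fst (sem (Assign 2 firstE) s) 2 = N"
      using assms A_le_M by (auto simp: pair_inv_def parsed_def frame_def N_def)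
  qed simp_all
  fix s' assume "pair_inv s' \<and> M - fst s' 2 = N"
  then have "runs (While ?b pair_body) s' ((1 + cost ?b + max_cost pair_body) * N + 1 + cost ?b)
        (\<lambda>s'. pair_inv s' \<and> val ?b s' = 0)"
    using runs_While_loopfree[of pair_body pair_inv s' ?b "\<lambda>s. M - fst s 2"] pair_step
    by (auto simp: pair_body_def)
  then show "runs (While ?b pair_body) s' ((1 + cost ?b + max_cost pair_body) * N + 1 + cost ?b)
      (\<lambda>s. (\<exists>pt. partner pt \<and> ready pt s) \<and> (\<forall>a\<in>I. labels s a = lab0 a))"
  proof (rule runs_conseq[OF _ order_refl])
    fix s assume s: "pair_inv s \<and> val ?b s = 0"
    then have "M \<le> fst s 2" by (auto simp: pair_inv_def frame_def)
    from s have "paired (snd s) (fst s 2)" by (simp add: pair_inv_def)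
    then obtain qs qs' where q: "ps = qs @ qs'"
      "drop (fst s 2) mm = concat (map prefix_word (concat (map (\<lambda>(l, r). [l, r]) qs')))"
      "\<And>l r. (l, r) \<in> set qs \<Longrightarrow> \<exists>a\<in>I. tm a = l \<and> snd s (a + 3 * M) \<in> I \<and> tm (snd s (a + 3 * M)) = r"
      by (rule pairedE) (rule that)
    have "length (prefix_word t) \<noteq> 0" for t using nsyms_pos[of t] by (simp add: length_prefix_word)
    then have "qs' = []" using q(2) \<open>M \<le> fst s 2\<close> by (cases qs') (auto simp: M_def)
    then have "set ps = set qs" using q(1) by simp
    have "(tm a, tm (snd s (a + 3 * M))) \<in> P \<union> Id" if "a \<in> I" "snd s (a + 3 * M) \<in> I" for a
      using s that A_pos ps_P unfolding pair_inv_def by (metis atLeastLessThan_iff leD subsetD)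
    moreover have "\<exists>a\<in>I. tm a = l \<and> snd s (a + 3 * M) \<in> I \<and> tm (snd s (a + 3 * M)) = r"
      if "(l, r) \<in> P" for l r using q(3) that P_ps \<open>set ps = set qs\<close> by blast
    ultimately have "partner (\<lambda>a. snd s (a + 3 * M))"
      unfolding partner_def by blast
    moreover have "ready (\<lambda>a. snd s (a + 3 * M)) s" using s by (auto simp: ready_def pair_inv_def)
    ultimately show "(\<exists>pt. partner pt \<and> ready pt s) \<and> (\<forall>a\<in>I. labels s a = lab0 a)"
      using s by (auto simp: pair_inv_def)
  qed
qed

subsection \<open>Saturation\<close>

text \<open>The relation need not be symmetric, as all ordered pairs of nodes are
  enumerated.\<close>

definition tst :: "(nat \<Rightarrow> nat) \<Rightarrow> (nat \<Rightarrow> nat) \<Rightarrow> nat \<Rightarrow> nat \<Rightarrow> bool" where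
  "tst pt l a b \<longleftrightarrow> pt a = b \<or>
     (mm ! a = mm ! b \<and> (\<exists>\<pi>\<in>arg_perms ar F E (mm ! a) (ar (mm ! a)).
        \<forall>k<ar (mm ! a). l (chp a k) = l (chp b (\<pi> k)))) \<or>
     (Idem \<in> rs \<and> mm ! a = g \<and> l (chp a 0) = l (chp a 1) \<and> b = chp a 0) \<or>
     (Nilp \<in> rs \<and> mm ! a = g \<and> l (chp a 0) = l (chp a 1) \<and> mm ! b = z) \<or>
     (Unit \<in> rs \<and> mm ! a = g \<and> (l (chp a 1) = z \<and> b = chp a 0 \<or> l (chp a 0) = z \<and> b = chp a 1))"

lemma val_testE:
  assumes rd: "ready pt s" and a: "fst s 2 = a" "a \<in> I" and b: "fst s 3 = b" "b \<in> I"
  shows "val (testE ar fl pl rs g z) s = 0 \<longleftrightarrow> tst pt (labels s) a b"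
proof -
  have fr: "fst s 1 = M" "\<And>a. a \<in> I \<Longrightarrow> snd s a = mm ! a" "\<And>a. a \<in> I \<Longrightarrow> snd s (a + M) = en a"
    "\<And>a. a \<in> I \<Longrightarrow> snd s (a + 3 * M) = pt a"
    using rd by (auto simp: ready_def frame_def)
  have ca: "val (chE k (Reg 2)) s = chp a k" if "k \<le> ar (mm ! a)" for k
    using that fr a by (intro val_chE) auto
  have cb: "val (chE k (Reg 3)) s = chp b k" if "k \<le> ar (mm ! b)" for k
    using that fr b by (intro val_chE) auto
  have sy: "snd s a = mm ! a" "snd s b = mm ! b" using fr a b by auto
  have cong: "val (cong_testE (ar f) f \<pi>) s = 0 \<longleftrightarrow>
      mm ! a = f \<and> mm ! b = f \<and> (\<forall>k<ar f. labels s (chp a k) = labels s (chp b (\<pi> k)))"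
    if "\<pi> \<in> set (pl f)" for f \<pi>
  proof -
    have "\<pi> k \<le> ar f" if "k < ar f" for k
      using arg_perms_less[of \<pi> ar F E f "ar f" k] pl[of f] \<open>\<pi> \<in> set (pl f)\<close> that by simp
    then show ?thesis
      using ca cb a b sy fr(1) by (auto simp: cong_testE_def simp del: chE.simps)
  qed
  have rule: "(\<exists>e\<in>set (rule_tests rs g z). val e s = 0) \<longleftrightarrow>
     (Idem \<in> rs \<and> mm ! a = g \<and> labels s (chp a 0) = labels s (chp a 1) \<and> b = chp a 0) \<or>
     (Nilp \<in> rs \<and> mm ! a = g \<and> labels s (chp a 0) = labels s (chp a 1) \<and> mm ! b = z) \<or>
     (Unit \<in> rs \<and> mm ! a = g \<and> (labels s (chp a 1) = z \<and> b = chp a 0 \<or>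
        labels s (chp a 0) = z \<and> b = chp a 1))"
  proof (cases "mm ! a = g \<and> rs \<noteq> {}")
    case True
    then have "ar (mm ! a) = 2" using g by simp
    then have "val (chE 0 (Reg 2)) s = chp a 0" "val (chE (Suc 0) (Reg 2)) s = chp a (Suc 0)"
      using ca[of 0] ca[of "Suc 0"] by auto
    then show ?thesis using True a(1) b(1) sy fr(1)
      by (cases "Idem \<in> rs"; cases "Nilp \<in> rs"; cases "Unit \<in> rs")
        (simp_all add: rule_tests_def del: chE.simps)
  next
    case False
    then show ?thesis using a(1) sy
      by (cases "Idem \<in> rs"; cases "Nilp \<in> rs"; cases "Unit \<in> rs")
        (auto simp: rule_tests_def simp del: chE.simps)
  qed
  have "(\<exists>e\<in>set (concat (map (\<lambda>f. map (cong_testE (ar f) f) (pl f)) fl)). val e s = 0) \<longleftrightarrow>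
      (\<exists>f\<in>F. \<exists>\<pi>\<in>set (pl f). val (cong_testE (ar f) f \<pi>) s = 0)"
    using fl by auto
  also have "\<dots> \<longleftrightarrow> mm ! a = mm ! b \<and> (\<exists>\<pi>\<in>arg_perms ar F E (mm ! a) (ar (mm ! a)).
        \<forall>k<ar (mm ! a). labels s (chp a k) = labels s (chp b (\<pi> k)))"
    using cong node(1)[OF a(2)] pl[of "mm ! a"] by (auto cong: bex_cong)
  finally have c: "(\<exists>e\<in>set (concat (map (\<lambda>f. map (cong_testE (ar f) f) (pl f)) fl)). val e s = 0) \<longleftrightarrow>
    mm ! a = mm ! b \<and> (\<exists>\<pi>\<in>arg_perms ar F E (mm ! a) (ar (mm ! a)).
        \<forall>k<ar (mm ! a). labels s (chp a k) = labels s (chp b (\<pi> k)))" .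
  have p: "val (eqE (Load (addM 3 (Reg 2))) (Reg 3)) s = 0 \<longleftrightarrow> pt a = b"
    using a b fr by simp
  show ?thesis
    unfolding testE_def val_orE set_simps set_append bex_simps bex_Un tst_def p c rule by blast
qed

text \<open>The first two parts provide \<open>lab_F\<close> and \<open>lab_z\<close>, the third is
  soundness; all three survive merging.\<close>

definition good :: "(nat \<Rightarrow> nat) \<Rightarrow> bool" where
  "good l \<longleftrightarrow> (\<forall>a\<in>I. l a \<in> lab0 ` I) \<and> (Unit \<in> rs \<longrightarrow> l (M - 1) = z) \<and>
     (\<forall>a\<in>I. \<forall>b\<in>I. l a = l b \<longrightarrow> (tm a, tm b) \<in> Q)"

lemma last_node: "Nilp \<in> rs \<or> Unit \<in> rs \<Longrightarrow> M - 1 \<in> I \<and> mm ! (M - 1) = z \<and> ar z = 0 \<and> z \<in> F"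
  using zero by auto

lemma good_cong:
  assumes "good l" and "\<And>c. c \<in> I \<Longrightarrow> l' c = l c"
  shows "good l'"
proof -
  have "Unit \<in> rs \<longrightarrow> l' (M - 1) = z" using assms last_node unfolding good_def by metis
  then show ?thesis using assms unfolding good_def by simp
qed

lemma tm_T0: "a \<in> I \<Longrightarrow> tm a \<in> T0"
  and tm_vars: "a \<in> I \<Longrightarrow> vars (tm a) = {}"
  using tm_ex[of a] by (auto simp: gterms_def)

lemma tm_g:
  assumes "a \<in> I" and "mm ! a = g" and "rs \<noteq> {}"
  shows "tm a = Fun g [tm (chp a 0), tm (chp a 1)]" and "chp a 0 \<in> I" and "chp a 1 \<in> I"
proof -
  have "ar (mm ! a) = 2" using g assms by simp
  then show "tm a = Fun g [tm (chp a 0), tm (chp a 1)]" "chp a 0 \<in> I" "chp a 1 \<in> I"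
    using node(4)[OF assms(1)] node(2)[OF assms(1)] assms(2)
    by (auto simp: chs_def upt_rec numeral_2_eq_2)
qed

lemma tm_z: "a \<in> I \<Longrightarrow> mm ! a = z \<Longrightarrow> ar z = 0 \<Longrightarrow> tm a = Cst z"
  using node(4)[of a] by (simp add: chs_def)

lemma tst_sound:
  assumes pt: "partner pt" and l: "good l" and a: "a \<in> I" and b: "b \<in> I" and t: "tst pt l a b"
  shows "(tm a, tm b) \<in> Q"
proof -
  have snd: "(tm c, tm d) \<in> Q" if "c \<in> I" "d \<in> I" "l c = l d" for c d
    using l that by (auto simp: good_def)
  have step: "(subst u \<sigma>, subst v \<sigma>) \<in> Q" if "(u, v) \<in> P \<union> B" "subst u \<sigma> \<in> T0" "subst v \<sigma> \<in> T0" for u v \<sigma>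
    using eqth_rule[of u v "P \<union> B \<union> E" \<sigma> T0] that by blast
  consider "pt a = b"
    | \<pi> where "mm ! a = mm ! b" "\<pi> \<in> arg_perms ar F E (mm ! a) (ar (mm ! a))"
        "\<And>k. k < ar (mm ! a) \<Longrightarrow> l (chp a k) = l (chp b (\<pi> k))"
    | "Idem \<in> rs" "mm ! a = g" "l (chp a 0) = l (chp a 1)" "b = chp a 0"
    | "Nilp \<in> rs" "mm ! a = g" "l (chp a 0) = l (chp a 1)" "mm ! b = z"
    | "Unit \<in> rs" "mm ! a = g" "l (chp a 1) = z" "b = chp a 0"
    | "Unit \<in> rs" "mm ! a = g" "l (chp a 0) = z" "b = chp a 1"
    using t unfolding tst_def by blast
  then show ?thesis
  proof cases
    case 1
    then have "(tm a, tm b) \<in> P \<union> Id" using pt a b by (auto simp: partner_def)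
    then show ?thesis
      using step[of "tm a" "tm b" Var] subst_ground[OF tm_vars[OF a]] subst_ground[OF tm_vars[OF b]]
        tm_T0[OF a] tm_T0[OF b] by auto
  next
    case 2
    let ?f = "mm ! a" and ?ts = "map tm (chs a)" and ?us = "map tm (chs b)"
    have len: "length ?ts = ar ?f" "length ?us = ar ?f" using 2(1) by (simp_all add: length_chs)
    have tms: "tm a = Fun ?f ?ts" "tm b = Fun ?f ?us" using node(4) a b 2(1) by auto
    have p: "\<pi> permutes {..<length ?us}" using arg_perms_permutes[OF 2(2)] len by simp
    have "(Fun ?f ?ts, Fun ?f (permute_list \<pi> ?us)) \<in> Q"
    proof (rule eqth_args)
      fix k assume "k < length ?ts"
      then have k: "k < ar ?f" using len by simp
      then have k': "\<pi> k < ar ?f" using arg_perms_less[OF 2(2)] by simp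
      have "(tm (chp a k), tm (chp b (\<pi> k))) \<in> Q"
        using snd node(2)[OF a k] node(2)[OF b, of "\<pi> k"] k' 2(1) 2(3)[OF k] by simp
      moreover have "permute_list \<pi> ?us ! k = ?us ! \<pi> k" using permute_list_nth[OF p] k len by simp
      ultimately show "(?ts ! k, permute_list \<pi> ?us ! k) \<in> Q"
        using k k' 2(1) len by (simp add: nth_chs length_chs)
    qed (use len tms tm_T0[OF a] in auto)
    moreover have "(Fun ?f ?us, Fun ?f (permute_list \<pi> ?us)) \<in> Q"
      using 2(2) len tms tm_T0[OF b] eqth_mono[of E "P \<union> B \<union> E" T0] unfolding arg_perms_def by auto
    ultimately show ?thesis using tms eqth_trans eqth_sym by metis
  next
    case 3
    note g = tm_g[OF a 3(2)]
    have ne: "rs \<noteq> {}" using 3 by auto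
    let ?t = "tm (chp a 0)"
    have "(tm a, Fun g [?t, ?t]) \<in> Q"
      using g[OF ne] 3 snd[of "chp a 1" "chp a 0"] tm_T0[OF a]
      by (auto intro!: eqth_args simp: less_Suc_eq)
    moreover have "(Fun g [?t, ?t], ?t) \<in> Q"
      using step[of "Fun g [Var 1, Var 1]" "Var 1" "\<lambda>_. ?t"] 3(1) eqth_in[OF calculation tm_T0[OF a]]
        tm_T0 g(2)[OF ne]
      by (auto simp: kind_rules_def idem_rules_def)
    ultimately show ?thesis using 3(4) eqth_trans by auto
  next
    case 4
    note g = tm_g[OF a 4(2)]
    have ne: "rs \<noteq> {}" using 4 by auto
    have z: "tm b = Cst z" using tm_z b 4 last_node by auto
    let ?t = "tm (chp a 0)"
    have "(tm a, Fun g [?t, ?t]) \<in> Q"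
      using g[OF ne] 4 snd[of "chp a 1" "chp a 0"] tm_T0[OF a]
      by (auto intro!: eqth_args simp: less_Suc_eq)
    moreover have "(Fun g [?t, ?t], Cst z) \<in> Q"
      using step[of "Fun g [Var 1, Var 1]" "Cst z" "\<lambda>_. ?t"] 4(1) eqth_in[OF calculation tm_T0[OF a]]
        tm_T0[OF b] z
      by (auto simp: kind_rules_def nilp_rules_def)
    ultimately show ?thesis using z eqth_trans by auto
  next
    case 5
    note g = tm_g[OF a 5(2)]
    have ne: "rs \<noteq> {}" using 5 by auto
    have z: "tm (M - 1) = Cst z" "M - 1 \<in> I" using tm_z 5 last_node by auto
    \<comment> \<open>A child labelled \<open>z\<close> is in the class of the last node, which
      denotes \<open>0\<close>; this turns the test on a label into a provable equation.\<close>
    have lz: "l (M - 1) = z" using l 5 by (simp add: good_def)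
    let ?t = "tm (chp a 0)"
    have "(tm a, Fun g [?t, Cst z]) \<in> Q"
      using g[OF ne] 5 snd[of "chp a 1" "M - 1"] tm_T0[OF a] z lz
      by (auto intro!: eqth_args simp: less_Suc_eq)
    moreover have "(Fun g [?t, Cst z], ?t) \<in> Q"
      using step[of "Fun g [Var 1, Cst z]" "Var 1" "\<lambda>_. ?t"] 5(1) eqth_in[OF calculation tm_T0[OF a]]
        tm_T0 g(2)[OF ne]
      by (auto simp: kind_rules_def unit_rules_def)
    ultimately show ?thesis using 5 eqth_trans by auto
  next
    case 6
    note g = tm_g[OF a 6(2)]
    have ne: "rs \<noteq> {}" using 6 by auto
    have z: "tm (M - 1) = Cst z" "M - 1 \<in> I" using tm_z 6 last_node by auto
    have lz: "l (M - 1) = z" using l 6 by (simp add: good_def)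
    let ?t = "tm (chp a 1)"
    have "(tm a, Fun g [Cst z, ?t]) \<in> Q"
      using g[OF ne] 6 snd[of "chp a 0" "M - 1"] tm_T0[OF a] z lz
      by (auto intro!: eqth_args simp: less_Suc_eq)
    moreover have "(Fun g [Cst z, ?t], ?t) \<in> Q"
      using step[of "Fun g [Cst z, Var 1]" "Var 1" "\<lambda>_. ?t"] 6(1) eqth_in[OF calculation tm_T0[OF a]]
        tm_T0 g(3)[OF ne]
      by (auto simp: kind_rules_def unit_rules_def)
    ultimately show ?thesis using 6 eqth_trans by auto
  qed
qed

section \<open>Merging two classes\<close>

definition merged :: "(nat \<Rightarrow> nat) \<Rightarrow> nat \<Rightarrow> nat \<Rightarrow> nat \<Rightarrow> nat" where
  "merged l a b c = (if l c = max (l a) (l b) then min (l a) (l b) else l c)"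

text \<open>The other initial labels are at least \<open>base\<close>, so taking the minimum can
  never discard \<open>z\<close>.\<close>

lemma z_least:
  assumes "Unit \<in> rs" and "c \<in> lab0 ` I"
  shows "z \<le> c"
proof -
  have "z < base" using assms(1) last_node base by simp
  then show ?thesis using assms(2) by (auto simp: lab0_def)
qed

lemma good_merged:
  assumes pt: "partner pt" and l: "good l" and a: "a \<in> I" and b: "b \<in> I" and t: "tst pt l a b"
  shows "good (merged l a b)"
proof -
  have ab: "(tm a, tm b) \<in> Q" by (rule tst_sound[OF assms])
  have l': "\<And>c. c \<in> I \<Longrightarrow> l c \<in> lab0 ` I" "Unit \<in> rs \<Longrightarrow> l (M - 1) = z"
    "\<And>c d. c \<in> I \<Longrightarrow> d \<in> I \<Longrightarrow> l c = l d \<Longrightarrow> (tm c, tm d) \<in> Q" using l by (auto simp: good_def)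
  have 1: "\<exists>c'\<in>I. merged l a b c = l c' \<and> (tm c, tm c') \<in> Q" if c: "c \<in> I" for c
  proof (cases "l c = max (l a) (l b)")
    case True
    \<comment> \<open>\<open>e\<close> carries the label that disappears and \<open>d\<close> the
      one that survives; the node \<open>c\<close> is linked to \<open>d\<close> through
      \<open>e\<close>.\<close>
    define d e where "d = (if l a \<le> l b then a else b)" and "e = (if l a \<le> l b then b else a)"
    have "l e = l c" "merged l a b c = l d" "d \<in> I" "e \<in> I" "(tm e, tm d) \<in> Q"
      using True a b ab eqth_sym[OF ab] by (auto simp: d_def e_def merged_def)
    then show ?thesis using l'(3)[OF c, of e] eqth_trans by (intro bexI[of _ d]) auto
  next
    case False
    then show ?thesis using c by (auto simp: merged_def)
  qed
  have "merged l a b c \<in> lab0 ` I" if "c \<in> I" for c using 1[OF that] l'(1) by auto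
  moreover have "merged l a b (M - 1) = z" if "Unit \<in> rs"
    using l'(2)[OF that] z_least[OF that l'(1)[OF a]] z_least[OF that l'(1)[OF b]]
    by (auto simp: merged_def)
  moreover have "(tm c, tm d) \<in> Q" if c: "c \<in> I" and d: "d \<in> I" and e: "merged l a b c = merged l a b d" for c d
  proof -
    obtain c' d' where "c' \<in> I" "d' \<in> I" "(tm c, tm c') \<in> Q" "(tm d, tm d') \<in> Q" "l c' = l d'"
      using 1[OF c] 1[OF d] e by metis
    then show ?thesis using l'(3)[of c' d'] eqth_trans eqth_sym by meson
  qed
  ultimately show ?thesis by (simp add: good_def)
qed

lemma card_merged:
  assumes "a \<in> I" and "b \<in> I" and "l a \<noteq> l b"
  shows "card (merged l a b ` I) < card (l ` I)"
proof -
  have "merged l a b ` I \<subseteq> l ` I - {max (l a) (l b)}"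
    using assms by (auto simp: merged_def min_def max_def)
  moreover have "max (l a) (l b) \<in> l ` I" using assms by (auto simp: max_def)
  ultimately have "merged l a b ` I \<subset> l ` I" by blast
  then show ?thesis by (intro psubset_card_mono) auto
qed

lemma merge_runs:
  assumes rd: "ready pt s" and a: "fst s 2 = a" "a \<in> I" and b: "fst s 3 = b" "b \<in> I"
  shows "runs merge_cmd s (merge_time N) (\<lambda>s'. ready pt s' \<and>
    (\<forall>c\<in>I. labels s' c = merged (labels s) a b c) \<and> fst s' 2 = A \<and> fst s' 3 = A)"
proof -
  let ?b = "Sub (Reg 1) (Reg 4)"
  \<comment> \<open>Both labels are kept in registers, since those of \<open>a\<close> and
    \<open>b\<close> may change during the sweep.\<close>
  define inv where "inv = (\<lambda>s'. ready pt s' \<and> fst s' 5 = min (labels s a) (labels s b) \<and>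
    fst s' 6 = max (labels s a) (labels s b) \<and> A \<le> fst s' 4 \<and> fst s' 4 \<le> M \<and>
    (\<forall>c\<in>I. labels s' c = (if c < fst s' 4 then merged (labels s) a b c else labels s c)))"
  have step: "inv (sem merge_body s') \<and> M - fst (sem merge_body s') 4 < M - fst s' 4"
    if s': "inv s'" "val ?b s' \<noteq> 0" for s'
  proof -
    define k where "k = fst s' 4"
    have fr: "Suc (fst s' 0) = A" "fst s' 1 = M" using s' by (auto simp: inv_def ready_def frame_def)
    have k: "k \<in> I" using s' fr by (auto simp: inv_def k_def)
    have lk: "labels s' k = labels s k" using s'(1) k by (auto simp: inv_def k_def)
    have m: "fst s' 5 = min (labels s a) (labels s b)" "fst s' 6 = max (labels s a) (labels s b)"
      using s'(1) by (auto simp: inv_def)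
    have body: "sem merge_body s' = ((fst s')(4 := Suc k),
        if labels s k = fst s' 6 then (snd s')(k + 2 * M := fst s' 5) else snd s')"
      using fr lk by (auto simp: merge_body_def k_def)
    have lb: "labels (sem merge_body s') c = (if c < Suc k then merged (labels s) a b c else labels s c)"
      if "c \<in> I" for c
      using s'(1) that k m unfolding body
      by (auto simp: inv_def k_def[symmetric] merged_def less_Suc_eq)
    have rd': "ready pt (sem merge_body s')"
      using s'(1) k unfolding body by (auto simp: inv_def ready_def frame_def)
    show ?thesis using rd' lb m k s'(1) unfolding inv_def
      by (simp add: body k_def[symmetric]) (use k in auto)
  qed
  have fr: "Suc (fst s 0) = A" "fst s 1 = M" using rd by (auto simp: ready_def frame_def)
  show ?thesis
    unfolding merge_cmd_def merge_time_def
  proof (rule runs_Seq)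
    show "runs merge_init s (max_cost merge_init) (\<lambda>s'. inv s' \<and> M - fst s' 4 = N)"
      using rd fr a b A_le_M
      by (intro runs_sem) (auto simp: merge_init_def inv_def ready_def frame_def N_def)
    fix s1 assume s1: "inv s1 \<and> M - fst s1 4 = N"
    show "runs (Seq (While ?b merge_body) reset_cmd) s1
      (((1 + cost ?b + max_cost merge_body) * N + 1 + cost ?b) + max_cost reset_cmd)
      (\<lambda>s'. ready pt s' \<and> (\<forall>c\<in>I. labels s' c = merged (labels s) a b c) \<and> fst s' 2 = A \<and> fst s' 3 = A)"
    proof (rule runs_Seq)
      show "runs (While ?b merge_body) s1 ((1 + cost ?b + max_cost merge_body) * N + 1 + cost ?b)
          (\<lambda>s'. inv s' \<and> val ?b s' = 0)"
        using runs_While_loopfree[of merge_body inv s1 ?b "\<lambda>s. M - fst s 4"] step s1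
        by (auto simp: merge_body_def)
      fix s2 assume "inv s2 \<and> val ?b s2 = 0"
      then show "runs reset_cmd s2 (max_cost reset_cmd) (\<lambda>s'. ready pt s' \<and>
          (\<forall>c\<in>I. labels s' c = merged (labels s) a b c) \<and> fst s' 2 = A \<and> fst s' 3 = A)"
        by (intro runs_sem) (auto simp: reset_cmd_def inv_def ready_def frame_def)
    qed
  qed
qed

text \<open>The pairs checked so far form an initial segment of the lexicographic order. A merge can
  enable tests on earlier pairs, so the segment is then reset to be empty.\<close>

definition sat_inv :: "(nat \<Rightarrow> nat) \<Rightarrow> state \<Rightarrow> bool" where
  "sat_inv pt s \<longleftrightarrow> ready pt s \<and> good (labels s) \<and> A \<le> fst s 2 \<and> fst s 2 \<le> M \<and> A \<le> fst s 3 \<and>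
     (fst s 2 < M \<longrightarrow> fst s 3 < M) \<and>
     (\<forall>a\<in>I. \<forall>b\<in>I. (a < fst s 2 \<or> a = fst s 2 \<and> b < fst s 3) \<longrightarrow> tst pt (labels s) a b \<longrightarrow>
        labels s a = labels s b)"

abbreviation "test \<equiv> testE ar fl pl rs g z"

text \<open>Each merge removes a label and restarts the enumeration of the pairs of nodes.\<close>

definition potential :: "state \<Rightarrow> nat" where
  "potential s = card (labels s ` I) * phase_time test N +
     advance_time test * ((M - fst s 2) * N + (M - fst s 3))"

lemma saturate_step:
  assumes pt: "partner pt" and s: "sat_inv pt s" "val (Sub (Reg 1) (Reg 2)) s \<noteq> 0"
  shows "\<exists>n. runs (saturate_body test) s n (\<lambda>s'. sat_inv pt s' \<and>
    1 + cost (Sub (Reg 1) (Reg 2)) + n + potential s' \<le> potential s)"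
proof -
  define a b where "a = fst s 2" and "b = fst s 3"
  let ?c = "Add test (neqE (labE (Reg 2)) (labE (Reg 3)))"
  have rd: "ready pt s" and gd: "good (labels s)" using s(1) by (auto simp: sat_inv_def)
  have fr: "Suc (fst s 0) = A" "fst s 1 = M" using rd by (auto simp: ready_def frame_def)
  have ab: "a \<in> I" "b \<in> I" using s fr by (auto simp: sat_inv_def a_def b_def)
  have ok: "tst pt (labels s) c d \<Longrightarrow> labels s c = labels s d"
    if "c \<in> I" "d \<in> I" "c < a \<or> c = a \<and> d < b" for c d
    using s(1) that by (auto simp: sat_inv_def a_def b_def)
  have c: "val ?c s = 0 \<longleftrightarrow> tst pt (labels s) a b \<and> labels s a \<noteq> labels s b"
    using val_testE[OF rd _ ab(1) _ ab(2)] fr by (simp add: a_def b_def)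
  have pot: "potential s = card (labels s ` I) * phase_time test N +
     advance_time test * ((M - a) * N + (M - b))" by (simp add: potential_def a_def b_def)
  show ?thesis
  proof (cases "val ?c s = 0")
    case True
    then have t: "tst pt (labels s) a b" "labels s a \<noteq> labels s b" using c by auto
    have R: "runs (saturate_body test) s (1 + cost ?c + merge_time N) (\<lambda>s'. ready pt s' \<and>
      (\<forall>c\<in>I. labels s' c = merged (labels s) a b c) \<and> fst s' 2 = A \<and> fst s' 3 = A)"
      unfolding saturate_body_def
      using True merge_runs[OF rd _ ab(1) _ ab(2)] by (intro runs_Cond) (auto simp: a_def b_def)
    have "sat_inv pt s' \<and> 1 + cost (Sub (Reg 1) (Reg 2)) + (1 + cost ?c + merge_time N) +
        potential s' \<le> potential s"
      if s': "ready pt s'" "\<forall>c\<in>I. labels s' c = merged (labels s) a b c" "fst s' 2 = A" "fst s' 3 = A" for s'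
    proof -
      have "good (labels s')"
        using good_cong[OF good_merged[OF pt gd ab t(1)]] s'(2) by simp
      then have inv: "sat_inv pt s'" using s' A_le_M ab by (auto simp: sat_inv_def)
      have im: "labels s' ` I = merged (labels s) a b ` I" using s'(2) by (intro image_cong) auto
      \<comment> \<open>The lost label releases one \<open>phase_time\<close>, which pays for this
        merge and for the new enumeration; the rest of the old enumeration budget is given
        up.\<close>
      have "Suc (card (labels s' ` I)) \<le> card (labels s ` I)"
        using card_merged[OF ab t(2)] im by simp
      then have "Suc (card (labels s' ` I)) * phase_time test N \<le> card (labels s ` I) * phase_time test N"
        by (rule mult_le_mono1)
      then have "phase_time test N + card (labels s' ` I) * phase_time test N \<le> potential s"
        using pot by simp
      then have "1 + cost (Sub (Reg 1) (Reg 2)) + (1 + cost ?c + merge_time N) +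
          potential s' \<le> potential s"
        using s'(3,4) by (simp add: potential_def phase_time_def[of _ N] N_def[symmetric])
      then show ?thesis using inv by simp
    qed
    then show ?thesis by (intro exI[of _ "1 + cost ?c + merge_time N"] runs_conseq[OF R order_refl]) blast
  next
    case False
    let ?s = "sem advance_cmd s"
    have adv: "?s = (if Suc b < M then ((fst s)(3 := Suc b), snd s)
        else ((fst s)(3 := A, 2 := Suc a), snd s))"
      using fr by (auto simp: advance_cmd_def a_def b_def fun_eq_iff)
    have cur: "tst pt (labels s) a b \<Longrightarrow> labels s a = labels s b" using False unfolding c by simp
    have snd: "snd ?s = snd s" by (simp add: adv)
    have rd': "ready pt ?s" using rd by (auto simp: adv ready_def frame_def)
    have ok': "labels s c = labels s d" if "c \<in> I" "d \<in> I" "tst pt (labels s) c d"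
      "c < fst ?s 2 \<or> c = fst ?s 2 \<and> d < fst ?s 3" for c d
    proof -
      have "c < a \<or> c = a \<and> d < b \<or> c = a \<and> d = b"
        using that ab by (auto simp: adv a_def[symmetric] less_Suc_eq split: if_splits)
      then show ?thesis using ok[OF that(1,2)] cur that(3) by auto
    qed
    have inv: "sat_inv pt ?s"
      unfolding sat_inv_def snd using rd' gd ok' ab by (auto simp: adv a_def[symmetric])
    \<comment> \<open>The number of remaining pairs drops. At the end of a row the last unit of the
      row is spent, and passing to the next row gives up \<open>N\<close>, exactly what the new row
      receives.\<close>
    have "Suc ((M - fst ?s 2) * N + (M - fst ?s 3)) \<le> (M - a) * N + (M - b)"
    proof (cases "Suc b < M")
      case True
      then show ?thesis by (simp add: adv a_def[symmetric])
    next
      case False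
      then have "M - b = 1" using ab by auto
      moreover have "M - a = Suc (M - Suc a)" using ab by auto
      ultimately show ?thesis using False by (simp add: adv N_def)
    qed
    from mult_le_mono2[OF this, of "advance_time test"]
    have le: "advance_time test + potential ?s \<le> potential s"
      unfolding pot by (simp add: potential_def snd)
    have R: "runs (saturate_body test) s (1 + cost ?c + max_cost advance_cmd) (\<lambda>s'. s' = ?s)"
      unfolding saturate_body_def
      using False by (intro runs_Cond runs_sem) (auto simp: advance_cmd_def reset_cmd_def)
    show ?thesis
      using inv le unfolding advance_time_def
      by (intro exI[of _ "1 + cost ?c + max_cost advance_cmd"] runs_conseq[OF R order_refl]) simp
  qed
qed

lemma saturate_runs:
  assumes pt: "partner pt" and rd: "ready pt s" and lab: "\<forall>a\<in>I. labels s a = lab0 a"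
  shows "runs (saturate_cmd test) s (saturate_time test N) (\<lambda>s'. ready pt s' \<and> good (labels s') \<and>
    (\<forall>a\<in>I. \<forall>b\<in>I. tst pt (labels s') a b \<longrightarrow> labels s' a = labels s' b))"
  unfolding saturate_cmd_def saturate_time_def
proof (rule runs_Seq)
  let ?b = "Sub (Reg 1) (Reg 2)"
  \<comment> \<open>Initially every node forms its own class, so soundness is trivial.\<close>
  have inj: "a = b" if "a \<in> I" "b \<in> I" "lab0 a = lab0 b" for a b
  proof -
    have "z < base" if "Unit \<in> rs" using that last_node base by simp
    then show ?thesis using that by (auto simp: lab0_def split: if_splits)
  qed
  have gd: "good (labels s)"
  proof -
    have "Unit \<in> rs \<longrightarrow> labels s (M - 1) = z" using lab last_node by (auto simp: lab0_def)
    moreover have "(tm a, tm b) \<in> Q" if "a \<in> I" "b \<in> I" "labels s a = labels s b" for a b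
      using inj[of a b] lab that by simp
    ultimately show ?thesis using lab by (simp add: good_def)
  qed
  show "runs reset_cmd s (max_cost reset_cmd)
      (\<lambda>s'. sat_inv pt s' \<and> potential s' \<le> N * phase_time test N + advance_time test * (N * N + N))"
  proof (rule runs_sem)
    have fr: "Suc (fst s 0) = A" "fst s 1 = M" using rd by (auto simp: ready_def frame_def)
    have e: "sem reset_cmd s = ((fst s)(2 := A, 3 := A), snd s)"
      using fr by (simp add: reset_cmd_def)
    have "card (labels s ` I) \<le> N" using card_image_le[of I "labels s"] by (simp add: N_def)
    then have "potential (sem reset_cmd s) \<le> N * phase_time test N + advance_time test * (N * N + N)"
      by (simp add: potential_def e N_def[symmetric] add_mono mult_le_mono1)
    moreover have "sat_inv pt (sem reset_cmd s)"
      using rd gd A_le_M by (auto simp: e sat_inv_def ready_def frame_def)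
    ultimately show "sat_inv pt (sem reset_cmd s) \<and>
      potential (sem reset_cmd s) \<le> N * phase_time test N + advance_time test * (N * N + N)" by blast
  qed (simp_all add: reset_cmd_def)
  fix s1 assume s1: "sat_inv pt s1 \<and> potential s1 \<le> N * phase_time test N + advance_time test * (N * N + N)"
  have "runs (While ?b (saturate_body test)) s1 (potential s1 + 1 + cost ?b) (\<lambda>s'. sat_inv pt s' \<and> val ?b s' = 0)"
    using s1 saturate_step[OF pt] by (intro runs_While) auto
  then show "runs (While ?b (saturate_body test)) s1
      (N * phase_time test N + advance_time test * (N * N + N) + 1 + cost ?b)
      (\<lambda>s'. ready pt s' \<and> good (labels s') \<and>
        (\<forall>a\<in>I. \<forall>b\<in>I. tst pt (labels s') a b \<longrightarrow> labels s' a = labels s' b))"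
  proof (rule runs_conseq)
    fix s' assume s': "sat_inv pt s' \<and> val ?b s' = 0"
    then have "fst s' 2 = M" by (auto simp: sat_inv_def ready_def frame_def)
    then show "ready pt s' \<and> good (labels s') \<and>
        (\<forall>a\<in>I. \<forall>b\<in>I. tst pt (labels s') a b \<longrightarrow> labels s' a = labels s' b)"
      using s' by (auto simp: sat_inv_def)
  qed (use s1 in simp)
qed

subsection \<open>Correctness of the saturated labelling\<close>

lemma saturated_closure:
  assumes pt: "partner pt" and gd: "good l"
    and sat: "\<And>a b. a \<in> I \<Longrightarrow> b \<in> I \<Longrightarrow> tst pt l a b \<Longrightarrow> l a = l b"
  shows "cong_closure_mod ar F E B P (l ` I)
    {(Fun (mm ! i) (map (\<lambda>j. Cst (l j)) (chs i)), Cst (l i)) | i. i \<in> I \<and> mm ! i \<noteq> l i} {}"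
proof -
  have nd: "chp a 0 \<in> I" "chp a 1 \<in> I" "chs a ! 0 = chp a 0" "chs a ! 1 = chp a 1"
    if "k \<in> rs" "a \<in> I" "mm ! a = g" for k a
  proof -
    have ne: "rs \<noteq> {}" using that(1) by blast
    show "chp a 0 \<in> I" "chp a 1 \<in> I" "chs a ! 0 = chp a 0" "chs a ! 1 = chp a 1"
      using tm_g[OF that(2,3) ne] g[OF ne] that(3) by (auto simp: nth_chs)
  qed
  interpret cl: closed_labelling ar F E P "kind_rules g z rs" g z "M - 1" rs I "(!) mm" chs tm l
  proof
    show "is_perm_eqn ar F e" if "e \<in> E" for e using E_perm that .
    show "g \<in> F \<and> ar g = 2" if "rs \<noteq> {}" using g that .
    show "z \<in> F \<and> ar z = 0 \<and> M - 1 \<in> I \<and> mm ! (M - 1) = z" if "Nilp \<in> rs \<or> Unit \<in> rs"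
      using last_node[OF that] by simp
    show "\<not> (Idem \<in> rs \<and> Nilp \<in> rs)" by (rule not_both)
    show "mm ! i \<in> F \<and> length (chs i) = ar (mm ! i) \<and> set (chs i) \<subseteq> I \<and>
        tm i = Fun (mm ! i) (map tm (chs i))" if "i \<in> I" for i
      using node(1,4)[OF that] set_chs[OF that] length_chs by simp
    show "l (M - 1) = z" if "Unit \<in> rs" using gd that by (simp add: good_def)
    show "Unit \<in> rs \<and> l i = z" if "i \<in> I" "l i \<in> F" for i
    proof -
      have "l i \<in> lab0 ` I" using gd that by (simp add: good_def)
      \<comment> \<open>Every value of \<open>lab0\<close> except \<open>z\<close> is at least
        \<open>base\<close> and thus outside \<open>F\<close>.\<close>
      then show ?thesis using base[OF that(2)] by (auto simp: lab0_def split: if_splits)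
    qed
    show "\<exists>i\<in>I. \<exists>j\<in>I. tm i = u \<and> tm j = v \<and> l i = l j" if "(u, v) \<in> P" for u v
    proof -
      have "\<forall>(u, v)\<in>P. \<exists>a\<in>I. tm a = u \<and> pt a \<in> I \<and> tm (pt a) = v"
        using pt unfolding partner_def by (rule conjunct2)
      from bspec[OF this that] obtain a where "a \<in> I" "tm a = u" "pt a \<in> I" "tm (pt a) = v"
        by auto
      moreover have "l a = l (pt a)" using sat[of a "pt a"] calculation by (simp add: tst_def)
      ultimately show ?thesis by blast
    qed
    show "l i = l j"
      if i: "i \<in> I" and j: "j \<in> I" and sy: "mm ! i = mm ! j"
        and p: "\<pi> \<in> arg_perms ar F E (mm ! i) (ar (mm ! i))"
        and k: "\<And>k. k < ar (mm ! i) \<Longrightarrow> l (chs i ! k) = l (chs j ! \<pi> k)" for i j \<pi>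
    proof -
      have "l (chp i k) = l (chp j (\<pi> k))" if "k < ar (mm ! i)" for k
        using k[OF that] arg_perms_less[OF p that] that sy by (simp add: nth_chs)
      then show ?thesis using sat[OF i j] p sy by (auto simp: tst_def)
    qed
    show "l i = l (chs i ! 0)" if "Idem \<in> rs" "i \<in> I" "mm ! i = g" "l (chs i ! 0) = l (chs i ! 1)" for i
      using nd[OF that(1-3)] that sat[of i "chp i 0"] by (auto simp: tst_def)
    show "l i = l (M - 1)" if "Nilp \<in> rs" "i \<in> I" "mm ! i = g" "l (chs i ! 0) = l (chs i ! 1)" for i
      using nd[OF that(1-3)] that last_node sat[of i "M - 1"] by (auto simp: tst_def)
    show "l i = l (chs i ! 0)" if "Unit \<in> rs" "i \<in> I" "mm ! i = g" "l (chs i ! 1) = z" for i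
      using nd[OF that(1-3)] that sat[of i "chp i 0"] by (auto simp: tst_def)
    show "l i = l (chs i ! 1)" if "Unit \<in> rs" "i \<in> I" "mm ! i = g" "l (chs i ! 0) = z" for i
      using nd[OF that(1-3)] that sat[of i "chp i 1"] by (auto simp: tst_def)
    show "(tm i, tm j) \<in> Q" if "i \<in> I" "j \<in> I" "l i = l j" for i j
      using gd that by (simp add: good_def)
  qed simp_all
  show ?thesis using cl.closure unfolding cl.K_def cl.D_def cl.lhs_def .
qed

subsection \<open>Output\<close>

text \<open>\<open>m0\<close> is a snapshot of the memory before output. Writing takes place from
  \<open>4 * M\<close> on, so the node data remain readable throughout.\<close>

definition out :: "(nat \<Rightarrow> nat) \<Rightarrow> state \<Rightarrow> nat list \<Rightarrow> bool" where
  "out m0 s w \<longleftrightarrow> Suc (fst s 0) = A \<and> fst s 1 = M \<and> (\<forall>a<4 * M. snd s a = m0 a) \<and>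
     fst s 7 = 4 * M + length w \<and> (\<forall>i<length w. snd s (4 * M + i) = w ! i)"

lemma push_out:
  assumes "out m0 s w" and "val e s = v"
  shows "out m0 (sem (push e) s) (w @ [v])" and "r \<noteq> 7 \<Longrightarrow> fst (sem (push e) s) r = fst s r"
  using assms by (auto simp: out_def push_def nth_append less_Suc_eq)

definition node_table :: "(nat \<Rightarrow> nat) \<Rightarrow> (nat \<Rightarrow> nat) \<Rightarrow> bool" where
  "node_table m0 l \<longleftrightarrow> (\<forall>a\<in>I. m0 a = mm ! a \<and> m0 (a + M) = en a \<and> m0 (a + 2 * M) = l a)"

lemma out_vals:
  assumes "node_table m0 l" and "out m0 s w" and "fst s 4 = a" and "a \<in> I"
  shows "val (Load (Reg 4)) s = mm ! a" and "val (labE (Reg 4)) s = l a"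
    and "k < ar (mm ! a) \<Longrightarrow> val (labE (chE k (Reg 4))) s = l (chp a k)"
proof -
  have m: "snd s c = mm ! c" "snd s (c + M) = en c" "snd s (c + 2 * M) = l c" if "c \<in> I" for c
    using assms(1,2) that by (auto simp: node_table_def out_def)
  have M: "fst s 1 = M" using assms(2) by (simp add: out_def)
  show "val (Load (Reg 4)) s = mm ! a" "val (labE (Reg 4)) s = l a" using m M assms(3,4) by simp_all
  show "val (labE (chE k (Reg 4))) s = l (chp a k)" if "k < ar (mm ! a)"
  proof -
    have "val (chE k (Reg 4)) s = chp a k" using that m M assms(3,4) by (intro val_chE) auto
    then show ?thesis using m(3)[of "chp a k"] node(2)[OF assms(4) that] M by simp
  qed
qed

lemma push_args_out:
  assumes "node_table m0 l" and "out m0 s w" and "fst s 4 = a" and "a \<in> I" and "k \<le> ar (mm ! a)"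
  shows "out m0 (sem (push_args k) s) (w @ map (\<lambda>j. l (chp a j)) [0..<k]) \<and>
    (\<forall>r. r \<noteq> 7 \<longrightarrow> fst (sem (push_args k) s) r = fst s r)"
  using assms(5)
proof (induction k)
  case 0
  then show ?case using assms(2) by simp
next
  case (Suc k)
  let ?s = "sem (push_args k) s"
  have IH: "out m0 ?s (w @ map (\<lambda>j. l (chp a j)) [0..<k])" "\<And>r. r \<noteq> 7 \<Longrightarrow> fst ?s r = fst s r"
    using Suc by auto
  have "val (labE (chE k (Reg 4))) ?s = l (chp a k)"
    using out_vals(3)[OF assms(1) IH(1) _ assms(4)] IH(2)[of 4] assms(3) Suc.prems by simp
  from push_out[OF IH(1) this] show ?case using IH(2) by simp
qed

definition rule_word :: "(nat \<Rightarrow> nat) \<Rightarrow> nat \<Rightarrow> nat list" where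
  "rule_word l a = mm ! a # map l (chs a) @ [l a]"

lemma push_rule_out:
  assumes "node_table m0 l" and "out m0 s w" and "fst s 4 = a" and "a \<in> I" and "mm ! a \<in> set fs"
  shows "out m0 (sem (push_rule ar fs) s) (w @ rule_word l a) \<and>
    (\<forall>r. r \<noteq> 7 \<longrightarrow> fst (sem (push_rule ar fs) s) r = fst s r)"
  using assms(5)
proof (induction fs)
  case (Cons f fs)
  show ?case
  proof (cases "mm ! a = f")
    case False
    then show ?thesis using Cons out_vals(1)[OF assms(1-4)] by simp
  next
    case True
    let ?s1 = "sem (push (Num f)) s"
    let ?s2 = "sem (push_args (ar f)) ?s1"
    have 1: "out m0 ?s1 (w @ [f])" "\<And>r. r \<noteq> 7 \<Longrightarrow> fst ?s1 r = fst s r"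
      using push_out[OF assms(2), of "Num f" f] by auto
    have 2: "out m0 ?s2 ((w @ [f]) @ map (\<lambda>j. l (chp a j)) [0..<ar f])"
      "\<And>r. r \<noteq> 7 \<Longrightarrow> fst ?s2 r = fst s r"
      using push_args_out[OF assms(1) 1(1) _ assms(4), of "ar f"] 1(2) assms(3) True by auto
    have v: "val (labE (Reg 4)) ?s2 = l a"
      using out_vals(2)[OF assms(1) 2(1) _ assms(4)] 2(2)[of 4] assms(3) by simp
    have "rule_word l a = [f] @ map (\<lambda>j. l (chp a j)) [0..<ar f] @ [l a]"
      using True by (simp add: rule_word_def chs_def comp_def)
    then show ?thesis using push_out[OF 2(1) v] 2(2) out_vals(1)[OF assms(1-4)] True by simp
  qed
qed simp

definition label_inv :: "(nat \<Rightarrow> nat) \<Rightarrow> (nat \<Rightarrow> nat) \<Rightarrow> state \<Rightarrow> bool" where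
  "label_inv m0 l s \<longleftrightarrow> A \<le> fst s 4 \<and> fst s 4 \<le> M \<and> out m0 s (N # map l [A..<fst s 4]) \<and>
     fst s 8 = length (filter (\<lambda>a. mm ! a \<noteq> l a) [A..<fst s 4])"

lemma label_step:
  assumes t: "node_table m0 l" and s: "label_inv m0 l s" and v: "val (Sub (Reg 1) (Reg 4)) s \<noteq> 0"
  shows "label_inv m0 l (sem label_body s) \<and> M - fst (sem label_body s) 4 < M - fst s 4"
proof -
  define a where "a = fst s 4"
  have o: "out m0 s (N # map l [A..<a])" using s by (simp add: label_inv_def a_def)
  have a: "a \<in> I" using s v by (auto simp: label_inv_def out_def a_def)
  let ?s1 = "sem (push (labE (Reg 4))) s"
  have 1: "out m0 ?s1 (N # map l [A..<Suc a])" "\<And>r. r \<noteq> 7 \<Longrightarrow> fst ?s1 r = fst s r"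
    using push_out[OF o out_vals(2)[OF t o a_def[symmetric] a]] a by auto
  have "val (Load (Reg 4)) ?s1 = mm ! a" "val (labE (Reg 4)) ?s1 = l a"
    using out_vals(1,2)[OF t 1(1) _ a] 1(2)[of 4] by (simp_all add: a_def)
  then have c: "val (Add (Reg 8) (Sub (Num 1) (neqE (Load (Reg 4)) (labE (Reg 4))))) ?s1 =
      length (filter (\<lambda>a. mm ! a \<noteq> l a) [A..<Suc a])" (is "val ?e _ = ?n")
    using s 1(2)[of 8] a
    by (auto simp: label_inv_def a_def[symmetric] neqE_def eqE_def simp del: val_neqE val_eqE)
  have "sem label_body s = ((fst ?s1)(8 := ?n, 4 := Suc a), snd ?s1)"
    using c 1(2)[of 4] by (simp add: label_body_def next_cmd_def a_def)
  moreover have "out m0 ((fst ?s1)(8 := ?n, 4 := Suc a), snd ?s1) (N # map l [A..<Suc a])"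
    using 1(1) by (simp add: out_def)
  ultimately show ?thesis using a unfolding label_inv_def by (auto simp: a_def[symmetric])
qed

definition rule_nodes :: "(nat \<Rightarrow> nat) \<Rightarrow> nat \<Rightarrow> nat list" where
  "rule_nodes l k = filter (\<lambda>a. mm ! a \<noteq> l a) [A..<k]"

definition rule_inv :: "(nat \<Rightarrow> nat) \<Rightarrow> (nat \<Rightarrow> nat) \<Rightarrow> nat list \<Rightarrow> state \<Rightarrow> bool" where
  "rule_inv m0 l w s \<longleftrightarrow> A \<le> fst s 4 \<and> fst s 4 \<le> M \<and>
     out m0 s (w @ concat (map (rule_word l) (rule_nodes l (fst s 4))))"

lemma rule_step:
  assumes t: "node_table m0 l" and s: "rule_inv m0 l w s" and v: "val (Sub (Reg 1) (Reg 4)) s \<noteq> 0"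
  shows "rule_inv m0 l w (sem (rule_body ar fl) s) \<and>
    M - fst (sem (rule_body ar fl) s) 4 < M - fst s 4"
proof -
  define a where "a = fst s 4"
  let ?w = "\<lambda>k. w @ concat (map (rule_word l) (rule_nodes l k))"
  have o: "out m0 s (?w a)" using s by (simp add: rule_inv_def a_def)
  have a: "a \<in> I" using s v by (auto simp: rule_inv_def out_def a_def)
  let ?s1 = "sem (Cond (eqE (Load (Reg 4)) (labE (Reg 4))) (push_rule ar fl) Skip) s"
  note vals = out_vals(1,2)[OF t o a_def[symmetric] a]
  have w: "?w (Suc a) = (if mm ! a = l a then ?w a else ?w a @ rule_word l a)"
    using a by (simp add: rule_nodes_def)
  have 1: "out m0 ?s1 (?w (Suc a)) \<and> fst ?s1 4 = a"
  proof (cases "mm ! a = l a")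
    case True
    then show ?thesis using vals o w by (simp add: a_def)
  next
    case False
    have "mm ! a \<in> set fl" using node(1)[OF a] fl by simp
    from push_rule_out[OF t o a_def[symmetric] a this]
    show ?thesis using False vals w by (simp add: a_def)
  qed
  have "sem (rule_body ar fl) s = ((fst ?s1)(4 := Suc a), snd ?s1)"
    unfolding rule_body_def sem.simps(4) using 1 by (simp only: next_cmd_def sem.simps val.simps) simp
  moreover have "out m0 ((fst ?s1)(4 := Suc a), snd ?s1) (?w (Suc a))"
    using 1 by (simp only: out_def) simp
  ultimately show ?thesis using a unfolding rule_inv_def by (auto simp: a_def[symmetric])
qed

text \<open>The last cell of \<open>w\<close> is the length of the empty list of
  \<open>C\<close>-rules.\<close>

lemma output_runs:
  assumes rd: "ready pt s"
  defines "l \<equiv> labels s"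
  defines "w \<equiv> (N # map l [A..<M]) @ [length (rule_nodes l M)] @
    concat (map (rule_word l) (rule_nodes l M)) @ [0]"
  shows "runs (output_cmd ar fl) s (output_time ar fl N)
    (\<lambda>s'. \<forall>i<length w. snd s' (fst s' 0 + i) = w ! i)"
proof -
  define m0 where "m0 = snd s"
  let ?b = "Sub (Reg 1) (Reg 4)"
  have fr: "Suc (fst s 0) = A" "fst s 1 = M" using rd by (auto simp: ready_def frame_def)
  have t: "node_table m0 l" using rd by (auto simp: node_table_def ready_def frame_def m0_def l_def)
  let ?w1 = "(N # map l [A..<M]) @ [length (rule_nodes l M)]"
  let ?w2 = "?w1 @ concat (map (rule_word l) (rule_nodes l M))"
  show ?thesis
    unfolding output_cmd_def output_time_def
  proof (rule runs_Seq)
    show "runs output_init s (max_cost output_init) (\<lambda>s'. label_inv m0 l s' \<and> M - fst s' 4 = N)"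
      using fr A_le_M by (intro runs_sem)
        (auto simp: output_init_def push_def label_inv_def out_def m0_def N_def)
    fix s1 assume s1: "label_inv m0 l s1 \<and> M - fst s1 4 = N"
    show "runs (Seq (While ?b label_body) (Seq (Seq (push (Reg 8)) (Assign 4 firstE))
      (Seq (While ?b (rule_body ar fl)) output_final))) s1
      (((1 + cost ?b + max_cost label_body) * N + 1 + cost ?b) +
        (max_cost (Seq (push (Reg 8)) (Assign 4 firstE)) +
        (((1 + cost ?b + max_cost (rule_body ar fl)) * N + 1 + cost ?b) + max_cost output_final)))
      (\<lambda>s'. \<forall>i<length w. snd s' (fst s' 0 + i) = w ! i)"
    proof (rule runs_Seq)
      show "runs (While ?b label_body) s1 ((1 + cost ?b + max_cost label_body) * N + 1 + cost ?b)
          (\<lambda>s'. label_inv m0 l s' \<and> val ?b s' = 0)"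
        using s1 label_step[OF t]
        by (intro runs_While_upto[where m = M and k = 4])
          (auto simp: label_body_def next_cmd_def push_def)
      fix s2 assume s2: "label_inv m0 l s2 \<and> val ?b s2 = 0"
      then have s2': "out m0 s2 (N # map l [A..<M])" "fst s2 8 = length (rule_nodes l M)"
        by (auto simp: label_inv_def out_def rule_nodes_def)
      show "runs (Seq (Seq (push (Reg 8)) (Assign 4 firstE)) (Seq (While ?b (rule_body ar fl)) output_final)) s2
        (max_cost (Seq (push (Reg 8)) (Assign 4 firstE)) +
        (((1 + cost ?b + max_cost (rule_body ar fl)) * N + 1 + cost ?b) + max_cost output_final))
        (\<lambda>s'. \<forall>i<length w. snd s' (fst s' 0 + i) = w ! i)"
      proof (rule runs_Seq)
        show "runs (Seq (push (Reg 8)) (Assign 4 firstE)) s2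
            (max_cost (Seq (push (Reg 8)) (Assign 4 firstE))) (\<lambda>s'. rule_inv m0 l ?w1 s' \<and> M - fst s' 4 = N)"
        proof (rule runs_sem)
          let ?s = "sem (push (Reg 8)) s2"
          have p: "out m0 ?s ?w1" using push_out(1)[OF s2'(1), of "Reg 8"] s2'(2) by simp
          have e: "sem (Seq (push (Reg 8)) (Assign 4 firstE)) s2 = ((fst ?s)(4 := A), snd ?s)"
            using p by (simp add: out_def)
          have "out m0 ((fst ?s)(4 := A), snd ?s) ?w1" using p by (simp add: out_def)
          then show "rule_inv m0 l ?w1 (sem (Seq (push (Reg 8)) (Assign 4 firstE)) s2) \<and>
              M - fst (sem (Seq (push (Reg 8)) (Assign 4 firstE)) s2) 4 = N"
            unfolding e using A_le_M by (simp add: rule_inv_def rule_nodes_def N_def)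
        qed (simp_all add: push_def)
        fix s3 assume s3: "rule_inv m0 l ?w1 s3 \<and> M - fst s3 4 = N"
        show "runs (Seq (While ?b (rule_body ar fl)) output_final) s3
          (((1 + cost ?b + max_cost (rule_body ar fl)) * N + 1 + cost ?b) + max_cost output_final)
          (\<lambda>s'. \<forall>i<length w. snd s' (fst s' 0 + i) = w ! i)"
        proof (rule runs_Seq)
          show "runs (While ?b (rule_body ar fl)) s3
            ((1 + cost ?b + max_cost (rule_body ar fl)) * N + 1 + cost ?b)
            (\<lambda>s'. rule_inv m0 l ?w1 s' \<and> val ?b s' = 0)"
            using s3 rule_step[OF t]
            by (intro runs_While_upto[where m = M and k = 4]) (auto simp: rule_body_def next_cmd_def)
          fix s4 assume s4: "rule_inv m0 l ?w1 s4 \<and> val ?b s4 = 0"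
          then have "fst s4 4 = M" by (auto simp: rule_inv_def out_def)
          then have "out m0 s4 ?w2" using s4 by (simp add: rule_inv_def)
          then have o: "out m0 (sem (push (Num 0)) s4) (?w2 @ [0])" by (rule push_out) simp
          have "w = ?w2 @ [0]" by (simp add: w_def)
          with o have "\<forall>i<length w. snd (sem (push (Num 0)) s4) (4 * M + i) = w ! i"
            "fst (sem (push (Num 0)) s4) 1 = M" by (simp_all add: out_def)
          then show "runs output_final s4 (max_cost output_final)
              (\<lambda>s'. \<forall>i<length w. snd s' (fst s' 0 + i) = w ! i)"
            unfolding output_final_def by (intro runs_sem) (simp_all add: push_def)
        qed
      qed
    qed
  qed
qed

lemma word_outputs:
  assumes "\<forall>i<length w. snd s (fst s 0 + i) = w ! i"
    and "w = (N # map l [A..<M]) @ [length (rule_nodes l M)] @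
      concat (map (rule_word l) (rule_nodes l M)) @ [0]"
  shows "outputs s (l ` I)
    {(Fun (mm ! i) (map (\<lambda>j. Cst (l j)) (chs i)), Cst (l i)) | i. i \<in> I \<and> mm ! i \<noteq> l i} {}"
proof -
  define rule where "rule i = (Fun (mm ! i) (map (\<lambda>j. Cst (l j)) (chs i)), Cst (l i))" for i
  have "concat (map (prefix_word \<circ> (\<lambda>j. Cst (l j))) xs) = map l xs" for xs
    by (induction xs) auto
  then have "(case rule i of (u, v) \<Rightarrow> prefix_word u @ prefix_word v) = rule_word l i" for i
    by (simp add: rule_def rule_word_def)
  then have "w = length (map l [A..<M]) # map l [A..<M] @ eqns_word (map rule (rule_nodes l M)) @ eqns_word []"
    using assms(2) by (simp add: eqns_word_def comp_def N_def)
  moreover have "set (map rule (rule_nodes l M)) =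
      {(Fun (mm ! i) (map (\<lambda>j. Cst (l j)) (chs i)), Cst (l i)) | i. i \<in> I \<and> mm ! i \<noteq> l i}"
    by (auto simp: rule_def rule_nodes_def)
  moreover have "set (map l [A..<M]) = l ` I" by simp
  ultimately show ?thesis
    unfolding outputs_def Let_def using assms(1)
    by (intro exI[of _ "map l [A..<M]"] exI[of _ "map rule (rule_nodes l M)"] exI[of _ "[]"]) auto
qed

lemma main_runs:
  assumes "frame s" and "\<forall>a\<ge>M. snd s a = 0"
  shows "runs (main_cmd ar fl base rs z test) s (main_time ar fl base rs z test N)
    (\<lambda>s'. \<exists>K D. outputs s' K D {} \<and> cong_closure_mod ar F E B P K D {})"
  unfolding main_cmd_def main_time_def
proof (rule runs_Seq[OF parse_runs[OF assms]])
  fix s1 assume "parsed s1 \<and> (\<forall>a\<in>I. snd s1 (a + 2 * M) = lab0 a)"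
  then have s1: "parsed s1" "\<forall>a\<in>I. snd s1 (a + 2 * M) = lab0 a" by auto
  show "runs (Seq pair_cmd (Seq (saturate_cmd test) (output_cmd ar fl))) s1
    (pair_time N + (saturate_time test N + output_time ar fl N))
    (\<lambda>s'. \<exists>K D. outputs s' K D {} \<and> cong_closure_mod ar F E B P K D {})"
  proof (rule runs_Seq[OF pair_runs[OF s1]], elim conjE exE)
    fix s2 pt assume s2: "partner pt" "ready pt s2" "\<forall>a\<in>I. labels s2 a = lab0 a"
    show "runs (Seq (saturate_cmd test) (output_cmd ar fl)) s2
      (saturate_time test N + output_time ar fl N)
      (\<lambda>s'. \<exists>K D. outputs s' K D {} \<and> cong_closure_mod ar F E B P K D {})"
    proof (rule runs_Seq[OF saturate_runs[OF s2]], elim conjE)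
      fix s3 assume s3: "ready pt s3" "good (labels s3)"
        "\<forall>a\<in>I. \<forall>b\<in>I. tst pt (labels s3) a b \<longrightarrow> labels s3 a = labels s3 b"
      have "cong_closure_mod ar F E B P (labels s3 ` I)
        {(Fun (mm ! i) (map (\<lambda>j. Cst (labels s3 j)) (chs i)), Cst (labels s3 i)) | i. i \<in> I \<and> mm ! i \<noteq> labels s3 i} {}"
        by (rule saturated_closure[OF s2(1) s3(2)]) (use s3(3) in blast)
      then show "runs (output_cmd ar fl) s3 (output_time ar fl N)
        (\<lambda>s'. \<exists>K D. outputs s' K D {} \<and> cong_closure_mod ar F E B P K D {})"
        by (intro runs_conseq[OF output_runs[OF s3(1)] order_refl]) (use word_outputs in blast)
    qed
  qed
qed

end

section \<open>Running time\<close>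

text \<open>Powers of \<open>Suc n\<close> rather than \<open>n\<close> make the bound hold from 0
  on, so that constants are covered and the closure rules have no side conditions.\<close>

definition poly_bound :: "nat \<Rightarrow> (nat \<Rightarrow> nat) \<Rightarrow> bool" where
  "poly_bound k f \<longleftrightarrow> (\<exists>C. \<forall>n. f n \<le> C * Suc n ^ k)"

lemma poly_bound_const: "poly_bound k (\<lambda>_. c)"
  unfolding poly_bound_def by (intro exI[of _ c]) simp

lemma poly_bound_id: "poly_bound (Suc k) (\<lambda>n. n)"
proof -
  have "n \<le> 1 * Suc n ^ Suc k" for n
  proof -
    have "n * 1 \<le> Suc n * Suc n ^ k" by (intro mult_le_mono) auto
    then show ?thesis by simp
  qed
  then show ?thesis unfolding poly_bound_def by blast
qed

lemma poly_bound_add: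
  assumes "poly_bound k f" and "poly_bound k h"
  shows "poly_bound k (\<lambda>n. f n + h n)"
proof -
  from assms obtain C C' where "\<And>n. f n \<le> C * Suc n ^ k" "\<And>n. h n \<le> C' * Suc n ^ k"
    unfolding poly_bound_def by blast
  then have "f n + h n \<le> (C + C') * Suc n ^ k" for n
    by (simp only: add_mult_distrib add_mono)
  then show ?thesis unfolding poly_bound_def by blast
qed

lemma poly_bound_mult:
  assumes "poly_bound j f" and "poly_bound k h"
  shows "poly_bound (j + k) (\<lambda>n. f n * h n)"
proof -
  from assms obtain C C' where 1: "\<And>n. f n \<le> C * Suc n ^ j" "\<And>n. h n \<le> C' * Suc n ^ k"
    unfolding poly_bound_def by blast
  have "f n * h n \<le> (C * C') * Suc n ^ (j + k)" for n
    using mult_le_mono[OF 1(1)[of n] 1(2)[of n]] by (simp only: power_add ac_simps)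
  then show ?thesis unfolding poly_bound_def by blast
qed

lemma poly_bound_cmult: "poly_bound k f \<Longrightarrow> poly_bound k (\<lambda>n. c * f n)"
  using poly_bound_mult[OF poly_bound_const[of 0 c], of k f] by simp

lemma poly_bound_main_time: "poly_bound 3 (main_time ar fl base rs z t)"
proof -
  have sq: "poly_bound (Suc (Suc k)) (\<lambda>n. n * n)" for k
    using poly_bound_mult[OF poly_bound_id[of 0] poly_bound_id[of k]] by simp
  note intros = poly_bound_add poly_bound_cmult poly_bound_const poly_bound_id sq
  have 1: "poly_bound 3 (parse_time ar fl base rs z)" "poly_bound 3 pair_time"
    "poly_bound 3 (output_time ar fl)" "poly_bound (Suc (Suc 0)) merge_time"
    unfolding parse_time_def[abs_def] pair_time_def[abs_def] output_time_def[abs_def]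
      merge_time_def[abs_def] numeral_3_eq_3
    by (intro intros)+
  have "poly_bound (Suc (Suc 0)) (phase_time t)"
    unfolding phase_time_def[abs_def] by (intro intros 1)
  from poly_bound_mult[OF poly_bound_id[of 0] this]
  have "poly_bound 3 (\<lambda>n. n * phase_time t n)" by (simp add: numeral_3_eq_3)
  then have "poly_bound 3 (saturate_time t)"
    unfolding saturate_time_def[abs_def] numeral_3_eq_3 by (intro intros)
  then show ?thesis unfolding main_time_def[abs_def] by (intro poly_bound_add 1)
qed

lemma poly_bound_bigo:
  assumes "\<And>n. f n \<le> C * (n + c) ^ k"
  shows "(\<lambda>n. real (f n)) \<in> O(\<lambda>n. real n ^ k)"
proof (rule bigoI)
  have "f n \<le> C * (1 + c) ^ k * n ^ k" if "n \<ge> 1" for n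
  proof -
    have "n + c \<le> (1 + c) * n" using that by simp
    then have "(n + c) ^ k \<le> ((1 + c) * n) ^ k" by (rule power_mono) simp
    then have "C * (n + c) ^ k \<le> C * ((1 + c) ^ k * n ^ k)"
      by (intro mult_le_mono2) (simp only: power_mult_distrib)
    then show ?thesis using assms[of n] by (simp only: mult.assoc)
  qed
  then have "real (f n) \<le> real (C * (1 + c) ^ k) * real n ^ k" if "n \<ge> 1" for n
    using that by (metis of_nat_le_iff of_nat_mult of_nat_power)
  then show "\<forall>\<^sub>F n in sequentially. norm (real (f n)) \<le> real (C * (1 + c) ^ k) * norm (real n ^ k)"
    by (intro eventually_sequentiallyI[of 1]) simp
qed

text \<open>The size of \<open>P\<close> is a sum over a set, so repeated equations in the list
  would make the word longer than the size.\<close>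

lemma eqns_size_eq:
  assumes "distinct ps"
  shows "eqns_size (set ps) = length (concat (map (\<lambda>(l, r). prefix_word l @ prefix_word r) ps))"
proof -
  have "eqns_size (set ps) = (\<Sum>(l, r)\<leftarrow>ps. nsyms l + nsyms r)"
    unfolding eqns_size_def using assms by (rule sum.distinct_set_conv_list)
  also have "\<dots> = length (concat (map (\<lambda>(l, r). prefix_word l @ prefix_word r) ps))"
    by (induction ps) (auto simp: length_prefix_word)
  finally show ?thesis .
qed

lemma is_B_rules_kinds:
  assumes "B = {} \<or> is_B_rules ar F E g z B"
  obtains rs where "B = kind_rules g z rs" and "rs \<noteq> {} \<Longrightarrow> g \<in> F \<and> ar g = 2"
    and "Nilp \<in> rs \<or> Unit \<in> rs \<Longrightarrow> z \<in> F \<and> ar z = 0" and "\<not> (Idem \<in> rs \<and> Nilp \<in> rs)"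
proof (cases "B = {}")
  case True
  then show ?thesis by (intro that[of "{}"]) (auto simp: kind_rules_def)
next
  case False
  with assms have B: "is_B_rules ar F E g z B" by simp
  then have g: "g \<in> F \<and> ar g = 2" and z: "B \<noteq> idem_rules g \<Longrightarrow> z \<in> F \<and> ar z = 0"
    by (auto simp: is_B_rules_def)
  have ne: "nilp_rules g z \<noteq> idem_rules g" "unit_rules g z \<noteq> idem_rules g"
    "idem_rules g \<union> unit_rules g z \<noteq> idem_rules g" "nilp_rules g z \<union> unit_rules g z \<noteq> idem_rules g"
    by (auto simp: idem_rules_def nilp_rules_def unit_rules_def)
  from B consider "B = idem_rules g" | "B = nilp_rules g z" | "B = unit_rules g z"
    | "B = idem_rules g \<union> unit_rules g z" | "B = nilp_rules g z \<union> unit_rules g z"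
    unfolding is_B_rules_def by blast
  then show ?thesis
  proof cases
    case 1
    then show ?thesis using g by (intro that[of "{Idem}"]) (auto simp: kind_rules_def)
  next
    case 2
    then show ?thesis using g z ne by (intro that[of "{Nilp}"]) (auto simp: kind_rules_def)
  next
    case 3
    then show ?thesis using g z ne by (intro that[of "{Unit}"]) (auto simp: kind_rules_def)
  next
    case 4
    then show ?thesis using g z ne by (intro that[of "{Idem, Unit}"]) (auto simp: kind_rules_def)
  next
    case 5
    then show ?thesis using g z ne by (intro that[of "{Nilp, Unit}"]) (auto simp: kind_rules_def)
  qed
qed

theorem theorem3:
  fixes F :: "nat set" and ar :: "nat \<Rightarrow> nat" and E B :: "eqn set" and g z :: nat
  assumes "finite F"
    and "finite E"
    and "\<And>e. e \<in> E \<Longrightarrow> is_perm_eqn ar F e"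
    and "B = {} \<or> is_B_rules ar F E g z B"
  shows "\<exists>(prog :: cmd) (time :: nat \<Rightarrow> nat).
    (\<lambda>n. real (time n)) \<in> O(\<lambda>n. real n ^ 3) \<and>
    (\<forall>(tabs :: nat \<Rightarrow> table) (P :: eqn set) (ps :: eqn list).
       (\<forall>f\<in>eqn_syms E. is_table ar F E f (tabs f)) \<and>
       P \<subseteq> gterms ar F {} \<times> gterms ar F {} \<and> finite P \<and>
       set ps = P \<and> distinct ps \<longrightarrow>
       (\<exists>t s K D C.
          exec prog (initial_state ar E tabs ps) t s \<and>
          t \<le> time (eqns_size P) \<and>
          outputs s K D C \<and>
          cong_closure_mod ar F E B P K D C))"
proof -
  obtain rs where B: "B = kind_rules g z rs" and g: "rs \<noteq> {} \<Longrightarrow> g \<in> F \<and> ar g = 2"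
    and z: "Nilp \<in> rs \<or> Unit \<in> rs \<Longrightarrow> z \<in> F \<and> ar z = 0" and nb: "\<not> (Idem \<in> rs \<and> Nilp \<in> rs)"
    using is_B_rules_kinds[OF assms(4)] by metis
  obtain fl where fl: "set fl = F" using finite_list[OF assms(1)] by blast
  have "\<forall>f. \<exists>xs. set xs = arg_perms ar F E f (ar f)" using finite_list[OF finite_arg_perms] by blast
  then obtain pl where pl: "\<And>f. set (pl f) = arg_perms ar F E f (ar f)" by metis
  \<comment> \<open>Inserting 0 keeps \<open>Max\<close> meaningful for an empty signature.\<close>
  define base where "base = Suc (Max (insert 0 F))"
  have base: "f < base" if "f \<in> F" for f using that assms(1) by (simp add: base_def le_imp_less_Suc)
  define t where "t = testE ar fl pl rs g z"
  define prog where "prog = Seq (append_cmd rs z) (main_cmd ar fl base rs z t)"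
  obtain C where C: "\<And>n. main_time ar fl base rs z t n \<le> C * Suc n ^ 3"
    using poly_bound_main_time[of ar fl base rs z t] unfolding poly_bound_def by blast
  \<comment> \<open>\<open>N\<close> exceeds the size of \<open>P\<close> by at most the two
    appended cells, and the cubic bound is one in \<open>Suc N\<close>; hence
    \<open>n + 3\<close>.\<close>
  define time where "time = (\<lambda>n. (max_cost (append_cmd rs z) + C) * (n + 3) ^ 3)"
  have "\<exists>u s K D C. exec prog (initial_state ar E tabs ps) u s \<and> u \<le> time (eqns_size P) \<and>
      outputs s K D C \<and> cong_closure_mod ar F E B P K D C"
    if P: "P \<subseteq> gterms ar F {} \<times> gterms ar F {}" "set ps = P" "distinct ps" for tabs P ps
  proof -
    define nz where "nz \<longleftrightarrow> Nilp \<in> rs \<or> Unit \<in> rs"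
    define ps' where "ps' = ps @ (if nz then [(Cst z, Cst z)] else [])"
    define tw where "tw = tables_word ar E tabs"
    define mm where "mm = tw @ eqns_word ps @ (if nz then [z, z] else [])"
    define roots where "roots = concat (map (\<lambda>(l, r). [l, r]) ps')"
    define A where "A = Suc (length tw)"
    define s0 where "s0 = initial_state ar E tabs ps"
    let ?w = "concat (map (\<lambda>(l, r). prefix_word l @ prefix_word r) ps)"
    have zn: "z \<in> F" "ar z = 0" if nz using z that by (auto simp: nz_def)
    have flat: "concat (map (\<lambda>(l, r). prefix_word l @ prefix_word r) qs) =
        concat (map prefix_word (concat (map (\<lambda>(l, r). [l, r]) qs)))" for qs :: "eqn list"
      by (induction qs) auto
    have dm: "drop A mm = ?w @ (if nz then [z, z] else [])" by (simp add: mm_def A_def eqns_word_def)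
    interpret pw: parsed_word ar F mm A roots
    proof
      show "drop A mm = concat (map prefix_word roots)"
        unfolding dm roots_def flat[symmetric] by (simp add: ps'_def)
      show "set roots \<subseteq> gterms ar F {}"
        using P zn by (fastforce simp: roots_def ps'_def gterms_Fun_iff split: if_splits)
      show "A \<le> length mm" by (simp add: A_def mm_def eqns_word_def)
    qed
    interpret iw: input_word ar F mm A roots E P ps' g z base rs fl pl
    proof unfold_locales
      have "A < length mm \<and> mm ! (length mm - 1) = z" if nz
      proof -
        have "mm = (tw @ eqns_word ps @ [z]) @ [z]" "A < length mm"
          using that by (simp_all add: mm_def A_def eqns_word_def)
        then show ?thesis by (metis butlast_snoc length_butlast nth_append_length)
      qed
      then show "z \<in> F \<and> ar z = 0 \<and> A < pw.M \<and> mm ! (pw.M - 1) = z" if "Nilp \<in> rs \<or> Unit \<in> rs"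
        using that zn by (simp add: nz_def pw.M_def)
    qed (use fl pl base g P nb assms(3) in \<open>auto simp: A_def roots_def ps'_def split: if_splits\<close>)
    define s1 where "s1 = sem (append_cmd rs z) s0"
    have s0: "fst s0 0 = length tw" "fst s0 1 = length (tw @ eqns_word ps)"
      "snd s0 = (\<lambda>a. if a < length (tw @ eqns_word ps) then (tw @ eqns_word ps) ! a else 0)"
      by (simp_all add: s0_def initial_state_def tw_def[symmetric] Let_def)
    have s1: "fst s1 0 = length tw" "fst s1 1 = length mm" "snd s1 = (\<lambda>a. if a < length mm then mm ! a else 0)"
      using s0 by (auto simp: s1_def append_cmd_def mm_def nz_def[symmetric] nth_append fun_eq_iff
          less_Suc_eq nth_Cons')
    have "iw.frame s1" "\<forall>a\<ge>pw.M. snd s1 a = 0"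
      unfolding iw.frame_def pw.M_def using s1 by (simp_all add: A_def)
    note main = iw.main_runs[OF this, folded B, folded t_def]
    have "runs prog s0 (max_cost (append_cmd rs z) + main_time ar fl base rs z t iw.N)
        (\<lambda>s'. \<exists>K D. outputs s' K D {} \<and> cong_closure_mod ar F E B P K D {})"
      unfolding prog_def
    proof (rule runs_Seq)
      show "runs (append_cmd rs z) s0 (max_cost (append_cmd rs z)) (\<lambda>s'. s' = s1)"
        unfolding s1_def by (rule runs_loopfree) (simp add: append_cmd_def)
    qed (use main in simp)
    then obtain u s K D where run: "exec prog s0 u s" "outputs s K D {}" "cong_closure_mod ar F E B P K D {}"
      and u: "u \<le> max_cost (append_cmd rs z) + main_time ar fl base rs z t iw.N"
      unfolding runs_def by blast
    let ?n = "eqns_size P"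
    have "iw.N = length (drop A mm)" by (simp add: iw.N_def pw.M_def)
    also have "\<dots> \<le> ?n + 2" unfolding dm using eqns_size_eq[OF P(3)] P(2) by simp
    finally have "Suc iw.N ^ 3 \<le> (?n + 3) ^ 3" by (intro power_mono) auto
    then have "main_time ar fl base rs z t iw.N \<le> C * (?n + 3) ^ 3"
      using C[of iw.N] by (meson le_trans mult_le_mono2)
    moreover have "max_cost (append_cmd rs z) * 1 \<le> max_cost (append_cmd rs z) * (?n + 3) ^ 3"
      by (intro mult_le_mono2) simp
    ultimately have "u \<le> time ?n" using u unfolding time_def add_mult_distrib by linarith
    with run show ?thesis unfolding s0_def by blast
  qed
  moreover have "(\<lambda>n. real (time n)) \<in> O(\<lambda>n. real n ^ 3)"
    by (rule poly_bound_bigo[where c = 3 and C = "max_cost (append_cmd rs z) + C"]) (simp add: time_def)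
  ultimately show ?thesis by (intro exI[of _ prog] exI[of _ time]) blast
qed

end
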